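(* Let $\lambda>0$ and let $f:[0,\infty)\to[0,\infty)$ be monotonically increasing (non-decreasing) and not identically zero. Consider the frog model with drift on $\mathbb{R}$ with drift $\lambda$ and intensity $f$. This model is transient if and only if $$\int_0^{\infty}e^{-\frac{f(t)}{2\lambda}}f(t)\,dt=\infty.$$
   Context: The frog model with drift on $\mathbb{R}$: sleeping frogs are placed at the points of a Poisson point process on $\mathbb{R}$ with intensity $f(x)$ for $x\ge 0$ and intensity $0$ for $x<0$. In addition there is one active frog at the origin, which at time $0$ starts performing Brownian motion with leftward drift $\lambda$, i.e. a process of the form $B_t-\lambda t$ with $B$ a standard Brownian motion. Whenever an active frog reaches a point where a sleeping frog resides, that sleeping frog becomes active and starts performing its own Brownian motion with leftward drift $\lambda$ from that point, independently of all other active frogs. The model is called transient if the probability that infinitely many distinct frogs hit the origin is $0$, and non-transient if this probability is positive. *)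

theory Defs
  imports "HOL-Probability.Probability"
begin

text \<open>Standard one-dimensional Brownian motion on the probability space M
  (time parameter t \<ge> 0; values for negative t are irrelevant).\<close>
definition std_brownian_motion :: "'a measure \<Rightarrow> (real \<Rightarrow> 'a \<Rightarrow> real) \<Rightarrow> bool" where
  "std_brownian_motion M B \<longleftrightarrow>
     prob_space M \<and>
     (\<forall>t. B t \<in> borel_measurable M) \<and>
     (\<forall>\<omega>\<in>space M. B 0 \<omega> = 0 \<and> continuous_on {0..} (\<lambda>t. B t \<omega>)) \<and>
     (\<forall>s t. 0 \<le> s \<longrightarrow> s < t \<longrightarrow>
        distributed M lborel (\<lambda>\<omega>. B t \<omega> - B s \<omega>) (normal_density 0 (sqrt (t - s)))) \<and>
     (\<forall>(ts :: nat \<Rightarrow> real) n. 0 \<le> ts 0 \<longrightarrow> (\<forall>i<n. ts i < ts (Suc i)) \<longrightarrow>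
        prob_space.indep_vars M (\<lambda>_. borel) (\<lambda>i \<omega>. B (ts (Suc i)) \<omega> - B (ts i) \<omega>) {..<n})"

definition pp_count :: "(nat \<Rightarrow> 'a \<Rightarrow> real) \<Rightarrow> real set \<Rightarrow> 'a \<Rightarrow> nat" where
  "pp_count X A \<omega> = card {n. X n \<omega> \<in> A}"

definition poisson_point_process ::
    "'a measure \<Rightarrow> (real \<Rightarrow> real) \<Rightarrow> (nat \<Rightarrow> 'a \<Rightarrow> real) \<Rightarrow> bool" where
  "poisson_point_process M g X \<longleftrightarrow>
     prob_space M \<and>
     (\<forall>n. X n \<in> borel_measurable M) \<and>
     (\<forall>\<omega>\<in>space M. strict_mono (\<lambda>n. X n \<omega>) \<and> filterlim (\<lambda>n. X n \<omega>) at_top sequentially) \<and>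
     (\<forall>A k. A \<in> sets borel \<longrightarrow> bounded A \<longrightarrow>
        pp_count X A \<in> measurable M (count_space UNIV) \<and>
        measure M {\<omega>\<in>space M. pp_count X A \<omega> = k}
          = exp (- (\<integral>x\<in>A. g x \<partial>lborel)) * (\<integral>x\<in>A. g x \<partial>lborel) ^ k / fact k) \<and>
     (\<forall>(A :: nat \<Rightarrow> real set) n.
        (\<forall>i<n. A i \<in> sets borel \<and> bounded (A i)) \<longrightarrow> disjoint_family_on A {..<n} \<longrightarrow>
        prob_space.indep_vars M (\<lambda>_. count_space UNIV) (\<lambda>i. pp_count X (A i)) {..<n})"

text \<open>Frogs are indexed by nat: frog 0 is the initially active frog at the origin,
  frog (Suc n) sleeps at position X n. pos i is the starting position of frog i and
  path i s its position s time units after its activation. Set of frogs that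
  ever become active: least set containing frog 0 and closed under "an active frog's
  path reaches the site of frog i".\<close>
inductive_set activated :: "(nat \<Rightarrow> real) \<Rightarrow> (nat \<Rightarrow> real \<Rightarrow> real) \<Rightarrow> nat set"
  for pos :: "nat \<Rightarrow> real" and path :: "nat \<Rightarrow> real \<Rightarrow> real" where
  start: "0 \<in> activated pos path"
| wake: "j \<in> activated pos path \<Longrightarrow> 0 \<le> s \<Longrightarrow> path j s = pos i \<Longrightarrow> i \<in> activated pos path"

definition frog_pos :: "(nat \<Rightarrow> 'a \<Rightarrow> real) \<Rightarrow> 'a \<Rightarrow> nat \<Rightarrow> real" where
  "frog_pos X \<omega> i = (case i of 0 \<Rightarrow> 0 | Suc n \<Rightarrow> X n \<omega>)"

definition frog_path ::
    "real \<Rightarrow> (nat \<Rightarrow> 'a \<Rightarrow> real) \<Rightarrow> (nat \<Rightarrow> real \<Rightarrow> 'a \<Rightarrow> real) \<Rightarrow> 'a \<Rightarrow> nat \<Rightarrow> real \<Rightarrow> real" where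
  "frog_path lam X W \<omega> i s = frog_pos X \<omega> i + W i s \<omega> - lam * s"

definition frogs_hitting_origin ::
    "real \<Rightarrow> (nat \<Rightarrow> 'a \<Rightarrow> real) \<Rightarrow> (nat \<Rightarrow> real \<Rightarrow> 'a \<Rightarrow> real) \<Rightarrow> 'a \<Rightarrow> nat set" where
  "frogs_hitting_origin lam X W \<omega> =
     {i. i \<in> activated (frog_pos X \<omega>) (frog_path lam X W \<omega>) \<and>
         (\<exists>s\<ge>0. frog_path lam X W \<omega> i s = 0)}"

definition frog_transient ::
    "'a measure \<Rightarrow> real \<Rightarrow> (nat \<Rightarrow> 'a \<Rightarrow> real) \<Rightarrow> (nat \<Rightarrow> real \<Rightarrow> 'a \<Rightarrow> real) \<Rightarrow> bool" where
  "frog_transient M lam X W \<longleftrightarrow> (AE \<omega> in M. finite (frogs_hitting_origin lam X W \<omega>))"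

end

theory Submission
  imports Defs "HOL-Real_Asymp.Real_Asymp"
begin

text \<open>The supremum of \<open>B\<^sub>t - \<lambda> t\<close> is exponentially distributed with rate \<open>c = 2 \<lambda>\<close>, so only the Poisson process
  of starting points marked with independent exponential jumps to the right matters: with positive
  probability infinitely many frogs wake up iff with positive probability no point \<open>x > 0\<close> is left
  uncovered by the jumps of the frogs before \<open>x\<close>. The probability that \<open>x\<close> is uncovered is
  \<open>exp (- \<integral>\<^sub>0\<^sup>x f(z) e\<^bsup>- c (x - z)\<^esup> dz)\<close>, which is at least \<open>exp (- f(x) / c)\<close>.

  If the integral diverges, take points \<open>x\<^sub>n\<close> with \<open>\<integral>\<^sub>0\<^bsup>x\<^sub>n\<^esup> f = n\<close>. The events that \<open>x\<^sub>n\<close> is uncovered regenerate: given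
  that \<open>x\<^sub>k\<close> is uncovered the frogs before \<open>x\<^sub>k\<close> are irrelevant, and by monotonicity of \<open>f\<close> the conditional
  probability that \<open>x\<^sub>n\<close> is uncovered is at most the probability that \<open>x\<^bsub>n-k\<^esub>\<close> is. Decomposing according to the first uncovered
  point, the partial sums \<open>S\<^sub>N\<close> of these probabilities satisfy \<open>S\<^sub>N - m \<le> p (1 + S\<^sub>N)\<close>, where \<open>p\<close> is the probability
  that some \<open>x\<^sub>i\<close> with \<open>i \<ge> m\<close> is uncovered. Since \<open>S\<^sub>N\<close> tends to infinity, \<open>p = 1\<close>.

  If the integral converges, cut the half-line into cells of length \<open>1 / k\<close> where \<open>f\<close> is about \<open>c k\<close>. The
  probability that some point of such a cell is not covered from the left is \<open>O(e\<^bsup>-k\<^esup>)\<close>, the sum over all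
  cells is finite, and with positive probability the first frog jumps over all cells
  that are not in a tail of small total probability.\<close>

section \<open>The supremum of Brownian motion with drift\<close>

text \<open>Two facts reduce the model to positions and jumps. The set of woken frogs is a closure
  under reachability, so the times of the wake-ups do not matter; and every drifted path almost
  surely takes arbitrarily low values, so each woken frog at a positive position hits the origin.
  Hence counting hits amounts to counting wake-ups.

  The rate \<open>2 \<lambda>\<close> is the non-zero root of
  \<open>\<theta>^2 / 2 = \<theta> \<lambda>\<close>, the exponent that turns
  \<open>exp (\<theta> (B_t - \<lambda> t))\<close> into a martingale.

  In the divergent half the points are spaced by equal mass so that windows at different places can
  be compared: where the intensity is larger, the same mass lies closer to the right end of its
  window and covers that end at least as well.

  In the convergent half uncountably many points must be covered at once. Demanding that a single
  frog jumps over a whole cell of length \<open>d\<close> costs a factor \<open>exp (- c d)\<close>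
  in the mean number of covering frogs. That number is about \<open>k\<close>, so
  \<open>d = 1 / k\<close> costs only a bounded amount, and a bounded amount in the exponent is a
  constant factor in the probability.\<close>

context prob_space begin

section \<open>Maximal inequalities for products of independent factors of mean one\<close>

context
  fixes \<xi> :: "nat \<Rightarrow> 'a \<Rightarrow> real" and n :: nat and A :: real
  assumes ind: "indep_vars (\<lambda>_. borel) \<xi> {..<n}"
    and pos: "\<And>i \<omega>. i < n \<Longrightarrow> \<xi> i \<omega> > 0"
    and int: "\<And>i. i < n \<Longrightarrow> integrable M (\<xi> i)"
    and one: "\<And>i. i < n \<Longrightarrow> expectation (\<xi> i) = 1"
    and A: "A \<ge> 1"
begin

text \<open>With \<open>\<tau>\<close> the first passage of the product martingale above
  \<open>A\<close>, this is the event \<open>\<tau> > k\<close>.\<close>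

definition below :: "nat \<Rightarrow> 'a set" where
  "below k = {\<omega>\<in>space M. \<forall>j\<le>k. (\<Prod>i<j. \<xi> i \<omega>) \<le> A}"

lemma factor_measurable: "i < n \<Longrightarrow> \<xi> i \<in> borel_measurable M"
  using int by blast

lemma partial_prod_measurable: "k \<le> n \<Longrightarrow> (\<lambda>\<omega>. \<Prod>i<k. \<xi> i \<omega>) \<in> borel_measurable M"
  by (intro borel_measurable_prod) (auto intro: factor_measurable)

lemma below_sets: "k \<le> n \<Longrightarrow> below k \<in> sets M"
proof -
  assume k: "k \<le> n"
  have "{\<omega>\<in>space M. \<forall>j\<in>{..k}. (\<Prod>i<j. \<xi> i \<omega>) \<le> A} \<in> sets M"
    using k by (intro sets.sets_Collect_finite_All borel_measurable_le partial_prod_measurable) auto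
  also have "{\<omega>\<in>space M. \<forall>j\<in>{..k}. (\<Prod>i<j. \<xi> i \<omega>) \<le> A} = below k"
    unfolding below_def by auto
  finally show ?thesis .
qed

lemma partial_prod_pos: "k \<le> n \<Longrightarrow> (\<Prod>i<k. \<xi> i \<omega>) > 0"
  by (intro prod_pos) (auto intro: pos)

lemma partial_prod_integrable: "k \<le> n \<Longrightarrow> integrable M (\<lambda>\<omega>. \<Prod>i<k. \<xi> i \<omega>)"
  by (intro indep_vars_integrable indep_vars_subset[OF ind]) (auto intro: int)

text \<open>The martingale stopped at its passage above \<open>A\<close> keeps mean 1; this is the
  share of that mean carried by the paths that have not yet passed.\<close>

definition stopped_mean :: "nat \<Rightarrow> real" where
  "stopped_mean k = expectation (\<lambda>\<omega>. (\<Prod>i<k. \<xi> i \<omega>) * indicator (below k) \<omega>)"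

lemma stopped_integrable: "k \<le> n \<Longrightarrow> j \<le> n \<Longrightarrow> integrable M (\<lambda>\<omega>. (\<Prod>i<k. \<xi> i \<omega>) * indicator (below j) \<omega>)"
  by (intro integrable_real_mult_indicator)
     (auto intro: partial_prod_integrable below_sets)

text \<open>Martingale step: the truncated product depends on the first \<open>k\<close> factors
  only, so the next factor, independent of them and of mean 1, drops out.\<close>

lemma stopped_step:
  assumes k: "k < n"
  shows "expectation (\<lambda>\<omega>. (\<Prod>i<Suc k. \<xi> i \<omega>) * indicator (below k) \<omega>) = stopped_mean k"
proof -
  \<comment> \<open>Independence is available between blocks of factors, so the truncated product is
    written as a measurable function of the first block.\<close>
  define F where "F p = (\<Prod>i<k. p i) * (if (\<forall>j\<le>k. (\<Prod>i<j. p i) \<le> A) then 1 else 0)" for p :: "nat \<Rightarrow> real"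
  have Fm: "F \<in> borel_measurable (PiM {..<k} (\<lambda>_. borel))"
  proof -
    have [measurable]: "j \<le> k \<Longrightarrow> (\<lambda>p. \<Prod>i<j. p i) \<in> borel_measurable (PiM {..<k} (\<lambda>_. borel :: real measure))" for j
      by (intro borel_measurable_prod measurable_component_singleton) auto
    have "Measurable.pred (PiM {..<k} (\<lambda>_. borel :: real measure)) (\<lambda>p. \<forall>j\<in>{..k}. (\<Prod>i<j. p i) \<le> A)"
      by (intro pred_intros_finite) auto
    hence [measurable]: "Measurable.pred (PiM {..<k} (\<lambda>_. borel :: real measure)) (\<lambda>p. \<forall>j\<le>k. (\<Prod>i<j. p i) \<le> A)"
      by (simp add: Ball_def)
    show ?thesis unfolding F_def by measurable
  qed
  have "indep_var borel ((\<lambda>f. f k) \<circ> (\<lambda>\<omega>. restrict (\<lambda>i. \<xi> i \<omega>) {k}))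
     borel (F \<circ> (\<lambda>\<omega>. restrict (\<lambda>i. \<xi> i \<omega>) {..<k}))"
    using k by (intro indep_var_compose[OF indep_var_restrict[OF ind]] Fm) auto
  also have "((\<lambda>f. f k) \<circ> (\<lambda>\<omega>. restrict (\<lambda>i. \<xi> i \<omega>) {k})) = \<xi> k"
    by auto
  finally have iv: "indep_var borel (\<xi> k) borel (F \<circ> (\<lambda>\<omega>. restrict (\<lambda>i. \<xi> i \<omega>) {..<k}))" .
  have Feq: "(F \<circ> (\<lambda>\<omega>. restrict (\<lambda>i. \<xi> i \<omega>) {..<k})) \<omega> = (\<Prod>i<k. \<xi> i \<omega>) * indicator (below k) \<omega>" if "\<omega> \<in> space M" for \<omega>
  proof -
    have "(\<Prod>i<j. restrict (\<lambda>i. \<xi> i \<omega>) {..<k} i) = (\<Prod>i<j. \<xi> i \<omega>)" if "j \<le> k" for j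
      using that by (intro prod.cong) auto
    then have "F (restrict (\<lambda>i. \<xi> i \<omega>) {..<k}) = (\<Prod>i<k. \<xi> i \<omega>) * (if \<forall>j\<le>k. (\<Prod>i<j. \<xi> i \<omega>) \<le> A then 1 else 0)"
      unfolding F_def by (simp cong: conj_cong)
    also have "(if \<forall>j\<le>k. (\<Prod>i<j. \<xi> i \<omega>) \<le> A then 1 else 0) = (indicator (below k) \<omega> :: real)"
      using that by (simp add: indicator_def below_def)
    finally show ?thesis by (simp only: o_def)
  qed
  have i2: "integrable M (F \<circ> (\<lambda>\<omega>. restrict (\<lambda>i. \<xi> i \<omega>) {..<k}))"
    using k by (intro Bochner_Integration.integrable_cong[THEN iffD2, OF refl Feq stopped_integrable]) auto
  have "expectation (\<lambda>\<omega>. (\<Prod>i<Suc k. \<xi> i \<omega>) * indicator (below k) \<omega>)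
      = expectation (\<lambda>\<omega>. \<xi> k \<omega> * (F \<circ> (\<lambda>\<omega>. restrict (\<lambda>i. \<xi> i \<omega>) {..<k})) \<omega>)"
  proof (intro Bochner_Integration.integral_cong refl)
    fix \<omega> assume "\<omega> \<in> space M"
    show "(\<Prod>i<Suc k. \<xi> i \<omega>) * indicator (below k) \<omega> = \<xi> k \<omega> * (F \<circ> (\<lambda>\<omega>. restrict (\<lambda>i. \<xi> i \<omega>) {..<k})) \<omega>"
      unfolding Feq[OF \<open>\<omega> \<in> space M\<close>] by (simp add: mult_ac)
  qed
  also have "\<dots> = expectation (\<xi> k) * expectation (F \<circ> (\<lambda>\<omega>. restrict (\<lambda>i. \<xi> i \<omega>) {..<k}))"
    by (rule indep_var_lebesgue_integral[OF iv int[OF k] i2])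
  also have "expectation (F \<circ> (\<lambda>\<omega>. restrict (\<lambda>i. \<xi> i \<omega>) {..<k})) = stopped_mean k"
    unfolding stopped_mean_def by (intro Bochner_Integration.integral_cong refl Feq)
  finally show ?thesis using one k by simp
qed

lemma below_Suc: "below (Suc k) \<subseteq> below k"
  unfolding below_def by auto

text \<open>The mean lost in one step is carried by the paths that pass \<open>A\<close> exactly
  then. Bounding the product on this event from below and from above yields the two maximal
  inequalities.\<close>

lemma stopped_drop:
  assumes k: "k < n"
  shows "stopped_mean k - stopped_mean (Suc k) =
    expectation (\<lambda>\<omega>. (\<Prod>i<Suc k. \<xi> i \<omega>) * indicator (below k - below (Suc k)) \<omega>)"
proof -
  have "stopped_mean k - stopped_mean (Suc k) = expectation (\<lambda>\<omega>. (\<Prod>i<Suc k. \<xi> i \<omega>) * indicator (below k) \<omega>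
     - (\<Prod>i<Suc k. \<xi> i \<omega>) * indicator (below (Suc k)) \<omega>)"
    using k stopped_integrable[of "Suc k" k] stopped_integrable[of "Suc k" "Suc k"]
    by (subst Bochner_Integration.integral_diff) (auto simp: stopped_step[OF k] stopped_mean_def simp del: prod.lessThan_Suc)
  also have "\<dots> = expectation (\<lambda>\<omega>. (\<Prod>i<Suc k. \<xi> i \<omega>) * indicator (below k - below (Suc k)) \<omega>)"
    using below_Suc[of k] by (intro Bochner_Integration.integral_cong) (auto simp: indicator_def)
  finally show ?thesis .
qed

lemma stopped_mean_0: "stopped_mean 0 = 1" and prob_below_0: "prob (below 0) = 1"
proof -
  have "below 0 = space M" unfolding below_def using A by auto
  then show "stopped_mean 0 = 1" "prob (below 0) = 1"
    unfolding stopped_mean_def by (simp_all add: prob_space)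
qed

lemma stopped_diff_integrable: "k < n \<Longrightarrow> integrable M (\<lambda>\<omega>. (\<Prod>i<Suc k. \<xi> i \<omega>) * indicator (below k - below (Suc k)) \<omega>)"
  by (intro integrable_real_mult_indicator partial_prod_integrable sets.Diff below_sets) auto

lemma prob_below_diff:
  "k < n \<Longrightarrow> prob (below k - below (Suc k)) = prob (below k) - prob (below (Suc k))"
  by (intro finite_measure_Diff below_sets below_Suc) auto

text \<open>At its passage the product is at least \<open>A\<close>, so every unit of passage
  probability takes at least \<open>A\<close> from a mean that starts at 1 and never becomes
  negative.\<close>

lemma maximal_upper: "A * (1 - prob (below n)) \<le> 1"
proof -
  have "k \<le> n \<Longrightarrow> stopped_mean k + A * (1 - prob (below k)) \<le> 1" for k
  proof (induction k)
    case 0 then show ?case by (simp add: stopped_mean_0 prob_below_0)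
  next
    case (Suc k)
    have "A * prob (below k - below (Suc k)) = expectation (\<lambda>\<omega>. A * indicator (below k - below (Suc k)) \<omega>)"
      using Suc below_sets[of k] below_sets[of "Suc k"] by simp
    also have "\<dots> \<le> expectation (\<lambda>\<omega>. (\<Prod>i<Suc k. \<xi> i \<omega>) * indicator (below k - below (Suc k)) \<omega>)"
      using Suc below_sets[of k] below_sets[of "Suc k"] stopped_diff_integrable[of k]
    proof (intro integral_mono)
      fix \<omega> assume "\<omega> \<in> space M"
      have "A \<le> (\<Prod>i<Suc k. \<xi> i \<omega>)" if "\<omega> \<in> below k - below (Suc k)"
      proof -
        from that obtain j where j: "j \<le> Suc k" "\<not> (\<Prod>i<j. \<xi> i \<omega>) \<le> A" and "\<forall>j\<le>k. (\<Prod>i<j. \<xi> i \<omega>) \<le> A"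
          unfolding below_def by blast
        then have "j = Suc k" using le_SucE by blast
        with j show ?thesis by simp
      qed
      then show "A * indicator (below k - below (Suc k)) \<omega> \<le> (\<Prod>i<Suc k. \<xi> i \<omega>) * indicator (below k - below (Suc k)) \<omega>"
        by (simp add: indicator_def del: prod.lessThan_Suc)
    qed (auto simp: less_top[symmetric] simp del: prod.lessThan_Suc)
    also have "\<dots> = stopped_mean k - stopped_mean (Suc k)" using Suc by (simp only: stopped_drop)
    finally show ?case using Suc by (simp add: prob_below_diff algebra_simps)
  qed
  from this[of n] have "stopped_mean n + A * (1 - prob (below n)) \<le> 1" by simp
  moreover have "stopped_mean n \<ge> 0" unfolding stopped_mean_def
    by (intro integral_nonneg_AE) (auto simp: indicator_def intro!: less_imp_le[OF partial_prod_pos])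
  ultimately show ?thesis by simp
qed

text \<open>A converse of the maximal inequality that keeps track of the overshoot: just before the
  passage the product is at most \<open>A\<close>, hence just after it at most \<open>A\<close>
  times the last factor. Either that factor is at most \<open>\<eta>\<close>, or the loss is charged
  to the tail term of this factor.\<close>

lemma maximal_lower:
  assumes \<eta>: "\<eta> \<ge> 1"
  shows "1 \<le> stopped_mean n + A * \<eta> * (1 - prob (below n))
     + A * (\<Sum>k<n. expectation (\<lambda>\<omega>. \<xi> k \<omega> * indicator {\<omega>\<in>space M. \<xi> k \<omega> > \<eta>} \<omega>))"
proof -
  let ?t = "\<lambda>k. expectation (\<lambda>\<omega>. \<xi> k \<omega> * indicator {\<omega>\<in>space M. \<xi> k \<omega> > \<eta>} \<omega>)"
  have "k \<le> n \<Longrightarrow> 1 \<le> stopped_mean k + A * \<eta> * (1 - prob (below k)) + A * (\<Sum>i<k. ?t i)" for k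
  proof (induction k)
    case 0 then show ?case by (simp add: stopped_mean_0 prob_below_0)
  next
    case (Suc k)
    let ?D = "below k - below (Suc k)" 
    have k: "k < n" using Suc by simp
    note [measurable] = factor_measurable[OF k]
    have Dm: "?D \<in> sets M" using Suc below_sets[of k] below_sets[of "Suc k"] by auto
    have it: "integrable M (\<lambda>\<omega>. \<xi> k \<omega> * indicator {\<omega>\<in>space M. \<xi> k \<omega> > \<eta>} \<omega>)"
      by (intro integrable_real_mult_indicator)
        (auto intro: int[OF k])
    have "stopped_mean k - stopped_mean (Suc k)
        = expectation (\<lambda>\<omega>. (\<Prod>i<Suc k. \<xi> i \<omega>) * indicator ?D \<omega>)" using k by (rule stopped_drop)
    also have "\<dots> \<le> expectation (\<lambda>\<omega>. A * \<eta> * indicator ?D \<omega> + A * (\<xi> k \<omega> * indicator {\<omega>\<in>space M. \<xi> k \<omega> > \<eta>} \<omega>))"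
    proof (intro integral_mono stopped_diff_integrable k Bochner_Integration.integrable_add integrable_mult_right it)
      show "integrable M (indicat_real ?D)" using Dm by (simp add: less_top[symmetric])
      fix \<omega> assume w: "\<omega> \<in> space M"
      have p: "\<xi> k \<omega> > 0" using pos k by blast
      show "(\<Prod>i<Suc k. \<xi> i \<omega>) * indicator ?D \<omega> \<le> A * \<eta> * indicator ?D \<omega> + A * (\<xi> k \<omega> * indicator {\<omega> \<in> space M. \<eta> < \<xi> k \<omega>} \<omega>)"
      proof (cases "\<omega> \<in> ?D")
        case True
        then have "(\<Prod>i<k. \<xi> i \<omega>) \<le> A" unfolding below_def by auto
        then have le: "(\<Prod>i<Suc k. \<xi> i \<omega>) \<le> A * \<xi> k \<omega>" using p by (simp add: mult_right_mono)
        show ?thesis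
        proof (cases "\<xi> k \<omega> > \<eta>")
          case True
          have "A * \<eta> \<ge> 0" using A \<eta> by simp
          then show ?thesis using le True w \<open>\<omega> \<in> ?D\<close> by (auto simp: indicator_def)
        next
          case False
          then have "A * \<xi> k \<omega> \<le> A * \<eta>" using A by simp
          then show ?thesis using le False w \<open>\<omega> \<in> ?D\<close> by (auto simp: indicator_def)
        qed
      next
        case False
        then show ?thesis using A p by (auto simp: indicator_def)
      qed
    qed
    also have "\<dots> = A * \<eta> * prob ?D + A * ?t k"
      using Dm it by (subst Bochner_Integration.integral_add) (auto simp: less_top[symmetric])
    also have "prob ?D = prob (below k) - prob (below (Suc k))" using k by (rule prob_below_diff)
    finally show ?case using Suc by (simp add: algebra_simps)
  qed
  from this[of n] show ?thesis by simp
qed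

end

end

section \<open>Exponential moments and Brownian motion on a finite grid\<close>

lemma (in prob_space) normal_mgf:
  assumes N: "distributed M lborel N (normal_density 0 \<sigma>)" and \<sigma>: "\<sigma> > 0"
  shows "integrable M (\<lambda>\<omega>. exp (\<theta> * N \<omega>))"
    and "expectation (\<lambda>\<omega>. exp (\<theta> * N \<omega>)) = exp (\<theta>\<^sup>2 * \<sigma>\<^sup>2 / 2)"
proof -
  have eq: "normal_density 0 \<sigma> x * exp (\<theta> * x) = exp (\<theta>\<^sup>2 * \<sigma>\<^sup>2 / 2) * normal_density (\<theta> * \<sigma>\<^sup>2) \<sigma> x" for x
  proof -
    have "- x\<^sup>2 / (2 * \<sigma>\<^sup>2) + \<theta> * x = \<theta>\<^sup>2 * \<sigma>\<^sup>2 / 2 + (- (x - \<theta> * \<sigma>\<^sup>2)\<^sup>2 / (2 * \<sigma>\<^sup>2))"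
      using \<sigma> by (simp add: field_simps power2_eq_square)
    then have "exp (- x\<^sup>2 / (2 * \<sigma>\<^sup>2)) * exp (\<theta> * x) = exp (\<theta>\<^sup>2 * \<sigma>\<^sup>2 / 2) * exp (- (x - \<theta> * \<sigma>\<^sup>2)\<^sup>2 / (2 * \<sigma>\<^sup>2))"
      by (simp add: mult_exp_exp)
    then show ?thesis unfolding normal_density_def by (simp add: mult_ac)
  qed
  have "integrable lborel (\<lambda>x. normal_density 0 \<sigma> x * exp (\<theta> * x))"
    unfolding eq using \<sigma> by (intro integrable_mult_right integrable_normal_density)
  then show "integrable M (\<lambda>\<omega>. exp (\<theta> * N \<omega>))"
    by (subst (asm) distributed_integrable[OF N]) auto
  have "expectation (\<lambda>\<omega>. exp (\<theta> * N \<omega>)) = (\<integral>x. normal_density 0 \<sigma> x * exp (\<theta> * x) \<partial>lborel)"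
    by (subst distributed_integral[OF N]) auto
  also have "\<dots> = exp (\<theta>\<^sup>2 * \<sigma>\<^sup>2 / 2)"
    unfolding eq using \<sigma> by (simp add: integral_normal_density)
  finally show "expectation (\<lambda>\<omega>. exp (\<theta> * N \<omega>)) = exp (\<theta>\<^sup>2 * \<sigma>\<^sup>2 / 2)" .
qed

lemma bm_prob_space: "std_brownian_motion M B \<Longrightarrow> prob_space M"
  unfolding std_brownian_motion_def by blast

lemma bm_measurable: "std_brownian_motion M B \<Longrightarrow> B t \<in> borel_measurable M"
  unfolding std_brownian_motion_def by blast

lemma bm_zero: "std_brownian_motion M B \<Longrightarrow> \<omega> \<in> space M \<Longrightarrow> B 0 \<omega> = 0"
  unfolding std_brownian_motion_def by blast

lemma bm_continuous: "std_brownian_motion M B \<Longrightarrow> \<omega> \<in> space M \<Longrightarrow> continuous_on {0..} (\<lambda>t. B t \<omega>)"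
  unfolding std_brownian_motion_def by blast

lemma bm_increment: "std_brownian_motion M B \<Longrightarrow> 0 \<le> s \<Longrightarrow> s < t \<Longrightarrow>
    distributed M lborel (\<lambda>\<omega>. B t \<omega> - B s \<omega>) (normal_density 0 (sqrt (t - s)))"
  unfolding std_brownian_motion_def by blast

lemma bm_indep: "std_brownian_motion M B \<Longrightarrow> 0 \<le> ts 0 \<Longrightarrow> (\<And>i. i < n \<Longrightarrow> ts i < ts (Suc i)) \<Longrightarrow>
    prob_space.indep_vars M (\<lambda>_. borel) (\<lambda>i \<omega>. B (ts (Suc i)) \<omega> - B (ts i) \<omega>) {..<n}"
  unfolding std_brownian_motion_def by blast

definition grid_exceed :: "'a measure \<Rightarrow> (real \<Rightarrow> 'a \<Rightarrow> real) \<Rightarrow> real \<Rightarrow> real \<Rightarrow> real \<Rightarrow> nat \<Rightarrow> 'a set" where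
  "grid_exceed M B lam a \<delta> n = {\<omega>\<in>space M. \<exists>j\<le>n. B (real j * \<delta>) \<omega> - lam * (real j * \<delta>) > a}"

lemma grid_exceed_sets:
  assumes "std_brownian_motion M B"
  shows "grid_exceed M B lam a \<delta> n \<in> sets M"
proof -
  note [measurable] = bm_measurable[OF assms]
  have "grid_exceed M B lam a \<delta> n = (\<Union>j\<in>{..n}. {\<omega>\<in>space M. B (real j * \<delta>) \<omega> - lam * (real j * \<delta>) > a})"
    unfolding grid_exceed_def by auto
  also have "\<dots> \<in> sets M" by measurable
  finally show ?thesis .
qed

text \<open>The partial products of \<open>\<xi>\<close> are the values of
  \<open>exp (2 * lam * (B t - lam * t))\<close> on the grid, so passing \<open>a\<close> becomes
  passing \<open>A = exp (2 * lam * a)\<close>. The moment parameter \<open>p\<close> stays free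
  because it has to grow with \<open>n\<close> later.\<close>

lemma grid_bounds:
  fixes lam a \<delta> :: real and n :: nat
  assumes bm: "std_brownian_motion M B" and lam: "lam > 0" and a: "a \<ge> 0" and \<delta>: "\<delta> > 0"
  shows grid_upper: "measure M (grid_exceed M B lam a \<delta> n) \<le> exp (- 2 * lam * a)"
    and grid_lower: "\<eta> > 1 \<Longrightarrow> p > 0 \<Longrightarrow> 1 \<le> exp (lam * a) * exp (- lam\<^sup>2 * (real n * \<delta>) / 2)
      + exp (2 * lam * a) * \<eta> * measure M (grid_exceed M B lam a \<delta> n)
      + exp (2 * lam * a) * (real n * (exp (2 * lam\<^sup>2 * \<delta> * p * (1 + p)) * \<eta> powr (- p)))"
proof -
  interpret prob_space M using bm by (rule bm_prob_space)
  note [measurable] = bm_measurable[OF bm]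
  define ts where "ts i = real i * \<delta>" for i
  define inc where "inc i \<omega> = B (ts (Suc i)) \<omega> - B (ts i) \<omega>" for i \<omega>
  define \<xi> where "\<xi> i \<omega> = exp (2 * lam * inc i \<omega> - 2 * lam\<^sup>2 * \<delta>)" for i \<omega>
  define A where "A = exp (2 * lam * a)"
  have A: "A \<ge> 1" using lam a by (simp add: A_def)
  have inc_distr: "distributed M lborel (inc i) (normal_density 0 (sqrt \<delta>))" for i
    using bm_increment[OF bm, of "ts i" "ts (Suc i)"] \<delta> by (simp add: ts_def inc_def[abs_def] algebra_simps)
  have s: "sqrt \<delta> > 0" using \<delta> by simp
  have mgf: "integrable M (\<lambda>\<omega>. exp (\<theta> * inc i \<omega>))" "expectation (\<lambda>\<omega>. exp (\<theta> * inc i \<omega>)) = exp (\<theta>\<^sup>2 * \<delta> / 2)" for \<theta> i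
    using normal_mgf[OF inc_distr s, of \<theta>] \<delta> by simp_all
  have pow: "\<xi> i \<omega> powr q = exp (- (2 * lam\<^sup>2 * \<delta> * q)) * exp (2 * lam * q * inc i \<omega>)" for i \<omega> q
    unfolding \<xi>_def by (simp add: powr_def mult_exp_exp algebra_simps)
  have pow_int: "integrable M (\<lambda>\<omega>. \<xi> i \<omega> powr q)" for i q
    unfolding pow by (intro integrable_mult_right mgf)
  have pow_exp: "expectation (\<lambda>\<omega>. \<xi> i \<omega> powr q) = exp (2 * lam\<^sup>2 * \<delta> * (q\<^sup>2 - q))" for i q
  proof -
    have "expectation (\<lambda>\<omega>. \<xi> i \<omega> powr q) = exp (- (2 * lam\<^sup>2 * \<delta> * q)) * exp ((2 * lam * q)\<^sup>2 * \<delta> / 2)"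
      unfolding pow by (simp only: mgf integral_mult_right_zero)
    then show ?thesis by (simp add: mult_exp_exp algebra_simps power2_eq_square)
  qed
  have pos: "\<xi> i \<omega> > 0" for i \<omega> by (simp add: \<xi>_def)
  have int: "integrable M (\<xi> i)" for i using pow_int[of i 1] pos by (simp add: powr_one less_imp_le)
  have one: "expectation (\<xi> i) = 1" for i using pow_exp[of i 1] pos by (simp add: powr_one less_imp_le)
  have ind: "indep_vars (\<lambda>_. borel) \<xi> {..<n}"
  proof -
    have "indep_vars (\<lambda>_. borel) inc {..<n}"
      unfolding inc_def[abs_def] using \<delta> by (intro bm_indep[OF bm]) (auto simp: ts_def)
    then have "indep_vars (\<lambda>_. borel) (\<lambda>i \<omega>. (\<lambda>x. exp (2 * lam * x - 2 * lam\<^sup>2 * \<delta>)) (inc i \<omega>)) {..<n}"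
      by (rule indep_vars_compose2) simp
    then show ?thesis by (simp add: \<xi>_def[abs_def])
  qed
  note hyps = ind pos int one A
  let ?b = "below \<xi> A"
  have Z: "(\<Prod>i<k. \<xi> i \<omega>) = exp (2 * lam * (B (ts k) \<omega> - lam * ts k))" if "\<omega> \<in> space M" for k \<omega>
  proof (induction k)
    case 0 then show ?case using bm_zero[OF bm that] by (simp add: ts_def)
  next
    case (Suc k) then show ?case
      by (simp add: \<xi>_def inc_def mult_exp_exp ts_def algebra_simps power2_eq_square)
  qed
  have ge: "grid_exceed M B lam a \<delta> n = space M - ?b n"
    unfolding grid_exceed_def below_def[OF hyps] using lam
    by (auto simp: Z A_def ts_def not_le)
  have pr: "prob (grid_exceed M B lam a \<delta> n) = 1 - prob (?b n)"
    unfolding ge by (intro prob_compl below_sets[OF hyps]) simp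
  have "A * (1 - prob (?b n)) \<le> 1" by (rule maximal_upper[OF hyps])
  then show "prob (grid_exceed M B lam a \<delta> n) \<le> exp (- 2 * lam * a)"
    unfolding pr A_def by (simp add: exp_minus field_simps)
  assume \<eta>: "\<eta> > 1" and p: "p > 0"
  have "1 \<le> stopped_mean \<xi> A n + A * \<eta> * (1 - prob (?b n))
     + A * (\<Sum>k<n. expectation (\<lambda>\<omega>. \<xi> k \<omega> * indicator {\<omega>\<in>space M. \<xi> k \<omega> > \<eta>} \<omega>))"
    using \<eta> by (intro maximal_lower[OF hyps]) auto
  \<comment> \<open>On the tail \<open>(\<xi> / \<eta>) powr p\<close> is at least 1, which trades
    the truncated mean for the moment of order \<open>1 + p\<close>.\<close>
  moreover have "expectation (\<lambda>\<omega>. \<xi> k \<omega> * indicator {\<omega>\<in>space M. \<xi> k \<omega> > \<eta>} \<omega>)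
      \<le> exp (2 * lam\<^sup>2 * \<delta> * p * (1 + p)) * \<eta> powr (- p)" for k
  proof -
    have "expectation (\<lambda>\<omega>. \<xi> k \<omega> * indicator {\<omega>\<in>space M. \<xi> k \<omega> > \<eta>} \<omega>)
       \<le> expectation (\<lambda>\<omega>. \<eta> powr (- p) * \<xi> k \<omega> powr (1 + p))"
    proof (intro integral_mono integrable_mult_right pow_int integrable_real_mult_indicator int)
      show "{\<omega>\<in>space M. \<xi> k \<omega> > \<eta>} \<in> events"
        using borel_measurable_integrable[OF int[of k]] by measurable
      fix \<omega>
      have "\<xi> k \<omega> \<le> \<eta> powr (- p) * \<xi> k \<omega> powr (1 + p)" if "\<xi> k \<omega> > \<eta>"
      proof -
        have "\<eta> powr p \<le> \<xi> k \<omega> powr p" using that \<eta> p by (intro powr_mono2) auto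
        then have "\<xi> k \<omega> * 1 \<le> \<xi> k \<omega> * (\<xi> k \<omega> powr p / \<eta> powr p)"
          using pos[of k \<omega>] \<eta> by (intro mult_left_mono) auto
        then show ?thesis using pos[of k \<omega>] by (simp add: powr_minus powr_add field_simps)
      qed
      then show "\<xi> k \<omega> * indicator {\<omega> \<in> space M. \<eta> < \<xi> k \<omega>} \<omega> \<le> \<eta> powr (- p) * \<xi> k \<omega> powr (1 + p)"
        by (auto simp: indicator_def)
    qed
    also have "\<dots> = exp (2 * lam\<^sup>2 * \<delta> * p * (1 + p)) * \<eta> powr (- p)"
      by (simp add: pow_exp power2_eq_square algebra_simps)
    finally show ?thesis .
  qed
  then have "(\<Sum>k<n. expectation (\<lambda>\<omega>. \<xi> k \<omega> * indicator {\<omega>\<in>space M. \<xi> k \<omega> > \<eta>} \<omega>))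
      \<le> (\<Sum>k<n. exp (2 * lam\<^sup>2 * \<delta> * p * (1 + p)) * \<eta> powr (- p))" by (rule sum_mono)
  then have "A * (\<Sum>k<n. expectation (\<lambda>\<omega>. \<xi> k \<omega> * indicator {\<omega>\<in>space M. \<xi> k \<omega> > \<eta>} \<omega>))
      \<le> A * (real n * (exp (2 * lam\<^sup>2 * \<delta> * p * (1 + p)) * \<eta> powr (- p)))"
    using A by (intro mult_left_mono) auto
  \<comment> \<open>As long as the product \<open>Z\<close> is at most \<open>A\<close>, it is at
    most \<open>sqrt A * sqrt Z\<close>, and \<open>sqrt A\<close> is \<open>exp (lam * a)\<close>.
    The half powers of the factors have mean below 1, which makes the surviving mean decay in the
    total time \<open>n * \<delta>\<close>.\<close>
  moreover have "stopped_mean \<xi> A n \<le> exp (lam * a) * exp (- lam\<^sup>2 * (real n * \<delta>) / 2)"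
  proof -
    have indh: "indep_vars (\<lambda>_. borel) (\<lambda>i \<omega>. \<xi> i \<omega> powr (1/2)) {..<n}"
      using ind by (rule indep_vars_compose2) simp
    have "stopped_mean \<xi> A n \<le> expectation (\<lambda>\<omega>. exp (lam * a) * (\<Prod>i<n. \<xi> i \<omega> powr (1/2)))"
      unfolding stopped_mean_def[OF hyps]
    proof (intro integral_mono stopped_integrable[OF hyps] integrable_mult_right indep_vars_integrable indh pow_int)
      fix \<omega> assume w: "\<omega> \<in> space M"
      have pr: "(\<Prod>i<n. \<xi> i \<omega> powr (1/2)) = (\<Prod>i<n. \<xi> i \<omega>) powr (1/2)"
        using pos by (subst prod_powr_distrib) (auto simp: less_imp_le)
      have "(\<Prod>i<n. \<xi> i \<omega>) \<le> exp (lam * a) * (\<Prod>i<n. \<xi> i \<omega>) powr (1/2)" if "\<omega> \<in> ?b n"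
      proof -
        have "(\<Prod>i<n. \<xi> i \<omega>) \<le> A" using that unfolding below_def[OF hyps] by auto
        then have "B (ts n) \<omega> - lam * ts n \<le> a" using lam by (simp add: Z[OF w] A_def)
        then have "lam * (B (ts n) \<omega> - lam * ts n) \<le> lam * a" using lam by simp
        then show ?thesis by (simp add: Z[OF w] powr_def mult_exp_exp)
      qed
      then show "(\<Prod>i<n. \<xi> i \<omega>) * indicator (?b n) \<omega> \<le> exp (lam * a) * (\<Prod>i<n. \<xi> i \<omega> powr (1/2))"
        unfolding pr by (auto simp: indicator_def)
    qed auto
    also have "\<dots> = exp (lam * a) * (\<Prod>i<n. expectation (\<lambda>\<omega>. \<xi> i \<omega> powr (1/2)))"
      by (simp add: indep_vars_lebesgue_integral[OF _ indh pow_int])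
    also have "(\<Prod>i<n. expectation (\<lambda>\<omega>. \<xi> i \<omega> powr (1/2))) = exp (- lam\<^sup>2 * (real n * \<delta>) / 2)"
      unfolding pow_exp by (simp add: exp_of_nat_mult[symmetric] power2_eq_square)
    finally show ?thesis .
  qed
  ultimately show "1 \<le> exp (lam * a) * exp (- lam\<^sup>2 * (real n * \<delta>) / 2)
      + exp (2 * lam * a) * \<eta> * prob (grid_exceed M B lam a \<delta> n)
      + exp (2 * lam * a) * (real n * (exp (2 * lam\<^sup>2 * \<delta> * p * (1 + p)) * \<eta> powr (- p)))"
    unfolding pr A_def by linarith
qed

section \<open>From grids to continuous time\<close>

lemma exceed_grid_Union:
  assumes bm: "std_brownian_motion M B"
  shows "{\<omega>\<in>space M. \<exists>t\<ge>0. B t \<omega> - lam * t > a} = (\<Union>m. grid_exceed M B lam a (1 / 2 ^ m) (4 ^ m))" (is "?L = ?R")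
proof
  show "?R \<subseteq> ?L"
  proof
    fix \<omega> assume "\<omega> \<in> ?R"
    then obtain m j where "\<omega> \<in> space M" "B (real j * (1 / 2 ^ m)) \<omega> - lam * (real j * (1 / 2 ^ m)) > a"
      unfolding grid_exceed_def by blast
    moreover have "real j * (1 / 2 ^ m) \<ge> 0" by simp
    ultimately show "\<omega> \<in> ?L" by blast
  qed
  show "?L \<subseteq> ?R"
  proof
    fix \<omega> assume "\<omega> \<in> ?L"
    then obtain t where w: "\<omega> \<in> space M" and t: "t \<ge> 0" "B t \<omega> - lam * t > a" by auto
    define s where "s m = real (nat \<lfloor>t * 2 ^ m\<rfloor>) * (1 / 2 ^ m)" for m :: nat
    have s: "s m = of_int \<lfloor>t * 2 ^ m\<rfloor> / 2 ^ m" for m using t by (simp add: s_def)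
    have b: "t - 1 / 2 ^ m \<le> s m \<and> s m \<le> t" for m
    proof -
    have "t * 2 ^ m - 1 \<le> of_int \<lfloor>t * 2 ^ m\<rfloor>" "of_int \<lfloor>t * 2 ^ m\<rfloor> \<le> t * 2 ^ m" by linarith+
    then have "(t * 2 ^ m - 1) / 2 ^ m \<le> s m" "s m \<le> (t * 2 ^ m) / 2 ^ m"
      unfolding s by (intro divide_right_mono; simp)+
    then show ?thesis by (simp add: diff_divide_distrib)
  qed
    have "(\<lambda>m. t - 1 / 2 ^ m) \<longlonglongrightarrow> t" by real_asymp
    then have st: "s \<longlonglongrightarrow> t"
      by (rule tendsto_sandwich[rotated 2, OF _ tendsto_const]) (use b in auto)
    have c: "continuous_on {0..} (\<lambda>t. B t \<omega> - lam * t)"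
      by (intro continuous_intros bm_continuous[OF bm w])
    have "(\<lambda>m. B (s m) \<omega> - lam * s m) \<longlonglongrightarrow> B t \<omega> - lam * t"
      by (rule continuous_on_tendsto_compose[OF c st]) (use t in \<open>auto simp: s_def\<close>)
    then have 1: "\<forall>\<^sub>F m in sequentially. B (s m) \<omega> - lam * s m > a"
      using t(2) by (rule order_tendstoD)
    \<comment> \<open>The \<open>m\<close>-th grid has mesh \<open>1 / 2 ^ m\<close> and ends at
      time \<open>4 ^ m / 2 ^ m = 2 ^ m\<close>, so it becomes finer and also longer; from some
      \<open>m\<close> on it reaches past \<open>t\<close>.\<close>
    have "filterlim (\<lambda>m. 2 ^ m :: real) at_top sequentially" by real_asymp
    then have 2: "\<forall>\<^sub>F m in sequentially. (2::real) ^ m \<ge> t"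
      by (simp add: filterlim_at_top)
    from eventually_happens'[OF sequentially_bot eventually_conj[OF 1 2]]
    obtain m where m: "B (s m) \<omega> - lam * s m > a" "(2::real) ^ m \<ge> t" by auto
    have "real (nat \<lfloor>t * 2 ^ m\<rfloor>) \<le> t * 2 ^ m" using t by simp
    also have "\<dots> \<le> 2 ^ m * 2 ^ m" using m(2) by simp
    also have "\<dots> = real (4 ^ m)" by (simp add: power_mult_distrib[symmetric])
    finally have "nat \<lfloor>t * 2 ^ m\<rfloor> \<le> 4 ^ m" by (simp only: of_nat_le_iff)
    then have "\<omega> \<in> grid_exceed M B lam a (1 / 2 ^ m) (4 ^ m)"
      unfolding grid_exceed_def using m(1) w unfolding s_def by blast
    then show "\<omega> \<in> ?R" by blast
  qed
qed

text \<open>The upper bound passes to the increasing union of the dyadic grids. The lower bound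
  takes three limits in this order: mesh to 0 at a fixed horizon \<open>T\<close>, which removes the
  tail terms; \<open>T\<close> to infinity, which removes the surviving mean; \<open>\<eta>\<close>
  to 1, which removes the overshoot.\<close>

lemma brownian_drift_sup_law:
  assumes bm: "std_brownian_motion M B" and lam: "lam > 0" and a: "a \<ge> 0"
  shows "{\<omega>\<in>space M. \<exists>t\<ge>0. B t \<omega> - lam * t > a} \<in> sets M"
    and "measure M {\<omega>\<in>space M. \<exists>t\<ge>0. B t \<omega> - lam * t > a} = exp (- 2 * lam * a)"
proof -
  interpret prob_space M using bm by (rule bm_prob_space)
  let ?E = "{\<omega>\<in>space M. \<exists>t\<ge>0. B t \<omega> - lam * t > a}"
  let ?G = "\<lambda>m. grid_exceed M B lam a (1 / 2 ^ m) (4 ^ m)"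
  show sets: "?E \<in> sets M"
    unfolding exceed_grid_Union[OF bm] using grid_exceed_sets[OF bm] by blast
  have inc: "incseq ?G"
  proof (rule incseq_SucI)
    fix m
    show "?G m \<subseteq> ?G (Suc m)"
    proof
      fix \<omega> assume "\<omega> \<in> ?G m"
      then obtain j where j: "j \<le> 4 ^ m" "\<omega> \<in> space M" "B (real j * (1 / 2 ^ m)) \<omega> - lam * (real j * (1 / 2 ^ m)) > a"
        unfolding grid_exceed_def by auto
      have "real (2 * j) * (1 / 2 ^ Suc m) = real j * (1 / 2 ^ m)" by simp
      moreover have "2 * j \<le> 4 ^ Suc m" using j(1) by simp
      ultimately show "\<omega> \<in> ?G (Suc m)" unfolding grid_exceed_def using j by (metis (mono_tags, lifting) mem_Collect_eq)
    qed
  qed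
  have "(\<lambda>m. prob (?G m)) \<longlonglongrightarrow> prob (\<Union>m. ?G m)"
    using inc grid_exceed_sets[OF bm] by (intro finite_Lim_measure_incseq) auto
  then have upper: "prob ?E \<le> exp (- 2 * lam * a)"
    unfolding exceed_grid_Union[OF bm]
    by (rule LIMSEQ_le_const2) (use grid_upper[OF bm lam a] in auto)
  have lower1: "1 \<le> exp (lam * a) * exp (- lam\<^sup>2 * T / 2) + exp (2 * lam * a) * \<eta> * prob ?E"
    if T: "T > 0" and \<eta>: "\<eta> > 1" for T \<eta>
  proof -
    \<comment> \<open>Mesh \<open>T / n\<close> and moment parameter \<open>p = sqrt n\<close>: then
      \<open>\<delta> * p * (1 + p)\<close> stays bounded, while
      \<open>n * \<eta> powr (- sqrt n)\<close> tends to 0.\<close>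
    let ?r = "\<lambda>n::nat. exp (2 * lam * a) * (real n * (exp (2 * lam\<^sup>2 * (T / real n) * sqrt (real n) * (1 + sqrt (real n))) * \<eta> powr (- sqrt (real n))))"
    have "?r \<longlonglongrightarrow> 0" using T \<eta> lam by real_asymp
    then have "(\<lambda>n. exp (lam * a) * exp (- lam\<^sup>2 * T / 2) + exp (2 * lam * a) * \<eta> * prob ?E + ?r n) \<longlonglongrightarrow>
       exp (lam * a) * exp (- lam\<^sup>2 * T / 2) + exp (2 * lam * a) * \<eta> * prob ?E + 0"
      by (intro tendsto_intros)
    then have "1 \<le> exp (lam * a) * exp (- lam\<^sup>2 * T / 2) + exp (2 * lam * a) * \<eta> * prob ?E + 0"
    proof (rule LIMSEQ_le_const)
      show "\<exists>N. \<forall>n\<ge>N. 1 \<le> exp (lam * a) * exp (- lam\<^sup>2 * T / 2) + exp (2 * lam * a) * \<eta> * prob ?E + ?r n"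
      proof (intro exI[of _ 1] allI impI)
        fix n :: nat assume n: "1 \<le> n"
        have "grid_exceed M B lam a (T / real n) n \<subseteq> ?E"
        proof
          fix \<omega> assume "\<omega> \<in> grid_exceed M B lam a (T / real n) n"
          then obtain j where "\<omega> \<in> space M" "B (real j * (T / real n)) \<omega> - lam * (real j * (T / real n)) > a"
            unfolding grid_exceed_def by blast
          moreover have "real j * (T / real n) \<ge> 0" using T by simp
          ultimately show "\<omega> \<in> ?E" by blast
        qed
        then have "prob (grid_exceed M B lam a (T / real n) n) \<le> prob ?E"
          using sets by (intro finite_measure_mono)
        then have "exp (2 * lam * a) * \<eta> * prob (grid_exceed M B lam a (T / real n) n) \<le> exp (2 * lam * a) * \<eta> * prob ?E"
          using \<eta> by (intro mult_left_mono) auto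
        moreover have "T / real n > 0" "sqrt (real n) > 0" using n T by auto
        from grid_lower[OF bm lam a this(1) \<eta> this(2), of n] have "1 \<le> exp (lam * a) * exp (- lam\<^sup>2 * T / 2) +
          exp (2 * lam * a) * \<eta> * prob (grid_exceed M B lam a (T / real n) n) + ?r n" using n by simp
        ultimately show "1 \<le> exp (lam * a) * exp (- lam\<^sup>2 * T / 2) + exp (2 * lam * a) * \<eta> * prob ?E + ?r n"
          by linarith
      qed
    qed
    then show ?thesis by simp
  qed
  have lower2: "1 \<le> exp (2 * lam * a) * \<eta> * prob ?E" if \<eta>: "\<eta> > 1" for \<eta>
  proof -
    have "((\<lambda>T. exp (lam * a) * exp (- lam\<^sup>2 * T / 2)) \<longlongrightarrow> 0) at_top" using lam by real_asymp
    then have "((\<lambda>T. exp (lam * a) * exp (- lam\<^sup>2 * T / 2) + exp (2 * lam * a) * \<eta> * prob ?E) \<longlongrightarrow> 0 + exp (2 * lam * a) * \<eta> * prob ?E) at_top"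
      by (intro tendsto_intros)
    then have "1 \<le> 0 + exp (2 * lam * a) * \<eta> * prob ?E"
    proof (rule tendsto_lowerbound)
      show "\<forall>\<^sub>F T in at_top. 1 \<le> exp (lam * a) * exp (- lam\<^sup>2 * T / 2) + exp (2 * lam * a) * \<eta> * prob ?E"
        using eventually_gt_at_top[of 0] by (rule eventually_mono) (rule lower1[OF _ \<eta>])
    qed simp
    then show ?thesis by simp
  qed
  have "((\<lambda>\<eta>. exp (2 * lam * a) * \<eta> * prob ?E) \<longlongrightarrow> exp (2 * lam * a) * 1 * prob ?E) (at_right 1)"
    by (intro tendsto_intros)
  then have "1 \<le> exp (2 * lam * a) * 1 * prob ?E"
    by (rule tendsto_lowerbound) (auto simp: eventually_at_filter intro!: always_eventually lower2)
  then have "exp (- 2 * lam * a) \<le> prob ?E" by (simp add: exp_minus field_simps)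
  with upper show "prob ?E = exp (- 2 * lam * a)" by simp
qed

section \<open>Void probabilities of the marked Poisson process\<close>

lemma pp_measurable: "poisson_point_process M g X \<Longrightarrow> X n \<in> borel_measurable M"
  unfolding poisson_point_process_def by blast

lemma pp_strict_mono: "poisson_point_process M g X \<Longrightarrow> \<omega> \<in> space M \<Longrightarrow> strict_mono (\<lambda>n. X n \<omega>)"
  unfolding poisson_point_process_def by blast

lemma pp_at_top: "poisson_point_process M g X \<Longrightarrow> \<omega> \<in> space M \<Longrightarrow> filterlim (\<lambda>n. X n \<omega>) at_top sequentially"
  unfolding poisson_point_process_def by blast

lemma pp_count_measurable: "poisson_point_process M g X \<Longrightarrow> A \<in> sets borel \<Longrightarrow> bounded A \<Longrightarrow>
    pp_count X A \<in> measurable M (count_space UNIV)"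
  unfolding poisson_point_process_def by blast

lemma pp_count_distr: "poisson_point_process M g X \<Longrightarrow> A \<in> sets borel \<Longrightarrow> bounded A \<Longrightarrow>
    measure M {\<omega>\<in>space M. pp_count X A \<omega> = k}
      = exp (- (\<integral>x\<in>A. g x \<partial>lborel)) * (\<integral>x\<in>A. g x \<partial>lborel) ^ k / fact k"
  unfolding poisson_point_process_def by blast

lemma pp_count_indep:
  fixes A :: "nat \<Rightarrow> real set"
  assumes pp: "poisson_point_process M g X" and A: "\<And>i. i < n \<Longrightarrow> A i \<in> sets borel \<and> bounded (A i)"
    and disj: "disjoint_family_on A {..<n}"
  shows "prob_space.indep_vars M (\<lambda>_. count_space UNIV) (\<lambda>i. pp_count X (A i)) {..<n}"
proof -
  have "\<forall>(A :: nat \<Rightarrow> real set) n. (\<forall>i<n. A i \<in> sets borel \<and> bounded (A i)) \<longrightarrow> disjoint_family_on A {..<n} \<longrightarrow>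
        prob_space.indep_vars M (\<lambda>_. count_space UNIV) (\<lambda>i. pp_count X (A i)) {..<n}"
    using pp unfolding poisson_point_process_def by (elim conjE)
  from this[rule_format, OF A disj] show ?thesis by simp
qed

lemma pp_bounded_ev:
  assumes "poisson_point_process M g X" "\<omega> \<in> space M" "bounded B"
  shows "\<exists>N. \<forall>n\<ge>N. X n \<omega> \<notin> B"
proof -
  from \<open>bounded B\<close> obtain b where b: "\<And>x. x \<in> B \<Longrightarrow> \<bar>x\<bar> \<le> b" by (auto simp: bounded_iff)
  have "\<forall>\<^sub>F n in sequentially. X n \<omega> > b"
    using pp_at_top[OF assms(1,2)] by (simp add: filterlim_at_top_dense)
  then show ?thesis using b unfolding eventually_sequentially by (metis abs_ge_self leD order_trans)
qed

section \<open>Generating functionals of the Poisson process\<close>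

context prob_space begin

lemma pp_count_pgf:
  assumes pp: "poisson_point_process M g X" and A: "A \<in> sets borel" "bounded A"
    and v: "v \<ge> 0" and nn: "(\<integral>x\<in>A. g x \<partial>lborel) \<ge> 0"
  shows "integrable M (\<lambda>\<omega>. v ^ pp_count X A \<omega>)"
    and "expectation (\<lambda>\<omega>. v ^ pp_count X A \<omega>) = exp (- ((1 - v) * (\<integral>x\<in>A. g x \<partial>lborel)))"
proof -
  let ?\<mu> = "\<integral>x\<in>A. g x \<partial>lborel" and ?C = "pp_count X A"
  have [measurable]: "?C \<in> measurable M (count_space UNIV)" using pp_count_measurable[OF pp A] .
  have "(\<integral>\<^sup>+\<omega>. ennreal (v ^ ?C \<omega>) \<partial>M) = (\<integral>\<^sup>+k. ennreal (v ^ k) \<partial>distr M (count_space UNIV) ?C)"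
    by (subst nn_integral_distr) auto
  also have "distr M (count_space UNIV) ?C = density (count_space UNIV) (\<lambda>k. ennreal (exp (- ?\<mu>) * ?\<mu> ^ k / fact k))"
  proof (rule measure_eqI_countable[of _ UNIV])
    fix k :: nat assume "k \<in> UNIV"
    have "emeasure (distr M (count_space UNIV) ?C) {k} = emeasure M {\<omega>\<in>space M. ?C \<omega> = k}"
      by (subst emeasure_distr) (auto intro!: arg_cong2[where f=emeasure])
    also have "\<dots> = ennreal (exp (- ?\<mu>) * ?\<mu> ^ k / fact k)"
      by (simp add: emeasure_eq_measure pp_count_distr[OF pp A])
    finally show "emeasure (distr M (count_space UNIV) ?C) {k} = emeasure (density (count_space UNIV) (\<lambda>k. ennreal (exp (- ?\<mu>) * ?\<mu> ^ k / fact k))) {k}"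
      by (simp add: emeasure_density)
  qed auto
  also have "(\<integral>\<^sup>+k. ennreal (v ^ k) \<partial>density (count_space UNIV) (\<lambda>k. ennreal (exp (- ?\<mu>) * ?\<mu> ^ k / fact k)))
     = (\<Sum>k. ennreal (exp (- ?\<mu>) * ((v * ?\<mu>) ^ k / fact k)))"
    using v nn by (subst nn_integral_density)
      (auto simp: nn_integral_count_space_nat ennreal_mult[symmetric] power_mult_distrib mult_ac intro!: suminf_cong)
  also have "\<dots> = ennreal (exp (- ?\<mu>) * exp (v * ?\<mu>))"
  proof (rule suminf_ennreal_eq)
    show "(\<lambda>k. exp (- ?\<mu>) * ((v * ?\<mu>) ^ k / fact k)) sums (exp (- ?\<mu>) * exp (v * ?\<mu>))"
      using exp_converges[of "v * ?\<mu>"] by (intro sums_mult) (simp add: divide_inverse mult_ac)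
  qed (use v nn in auto)
  finally have eq: "(\<integral>\<^sup>+\<omega>. ennreal (v ^ ?C \<omega>) \<partial>M) = ennreal (exp (- ?\<mu>) * exp (v * ?\<mu>))" .
  have m: "(\<lambda>\<omega>. v ^ ?C \<omega>) \<in> borel_measurable M" by measurable
  show "integrable M (\<lambda>\<omega>. v ^ ?C \<omega>)"
    using v by (intro integrableI_nonneg m) (auto simp: eq)
  have "expectation (\<lambda>\<omega>. v ^ ?C \<omega>) = exp (- ?\<mu>) * exp (v * ?\<mu>)"
    using v by (intro integral_eq_nn_integral[OF m, THEN trans]) (auto simp: eq)
  then show "expectation (\<lambda>\<omega>. v ^ ?C \<omega>) = exp (- ((1 - v) * ?\<mu>))"
    by (simp add: mult_exp_exp algebra_simps)
qed

text \<open>The Laplace functional for a weight with finitely many values: the counts on the level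
  sets of \<open>\<kappa>\<close> are independent Poisson variables, and the exponents of their
  generating functions add up to a single integral.\<close>

lemma pp_simple_pgf:
  fixes \<kappa> :: "real \<Rightarrow> nat"
  assumes pp: "poisson_point_process M g X" and B[measurable]: "B \<in> sets borel" and Bb: "bounded B"
    and \<kappa>[measurable]: "\<kappa> \<in> measurable borel (count_space UNIV)" and K: "\<And>x. x \<in> B \<Longrightarrow> \<kappa> x < K"
    and v: "\<And>k. v k \<ge> 0" and g: "\<And>x. g x \<ge> 0" and gi: "set_integrable lborel B g"
  shows "integrable M (\<lambda>\<omega>. \<Prod>k<K. v k ^ pp_count X {x\<in>B. \<kappa> x = k} \<omega>)"
    and "expectation (\<lambda>\<omega>. \<Prod>k<K. v k ^ pp_count X {x\<in>B. \<kappa> x = k} \<omega>)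
      = exp (- (\<integral>x\<in>B. (1 - v (\<kappa> x)) * g x \<partial>lborel))"
proof -
  let ?A = "\<lambda>k. {x\<in>B. \<kappa> x = k}"
  have A: "?A k \<in> sets borel" "bounded (?A k)" for k
    using bounded_subset[OF Bb, of "?A k"] by auto
  have gA: "set_integrable lborel (?A k) g" for k
    by (rule set_integrable_subset[OF gi]) (use A in auto)
  have nn: "(\<integral>x\<in>?A k. g x \<partial>lborel) \<ge> 0" for k
    unfolding set_lebesgue_integral_def using g by (intro integral_nonneg_AE) auto
  have ind: "indep_vars (\<lambda>_. borel) (\<lambda>k \<omega>. v k ^ pp_count X (?A k) \<omega>) {..<K}"
    by (rule indep_vars_compose2[OF pp_count_indep[OF pp]]) (use A in \<open>auto simp: disjoint_family_on_def\<close>)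
  show "integrable M (\<lambda>\<omega>. \<Prod>k<K. v k ^ pp_count X (?A k) \<omega>)"
    by (intro indep_vars_integrable ind pp_count_pgf[OF pp A v nn]) auto
  have "expectation (\<lambda>\<omega>. \<Prod>k<K. v k ^ pp_count X (?A k) \<omega>) = (\<Prod>k<K. expectation (\<lambda>\<omega>. v k ^ pp_count X (?A k) \<omega>))"
    by (intro indep_vars_lebesgue_integral ind pp_count_pgf[OF pp A v nn]) auto
  also have "\<dots> = exp (- (\<Sum>k<K. (1 - v k) * (\<integral>x\<in>?A k. g x \<partial>lborel)))"
    by (simp add: pp_count_pgf[OF pp A v nn] exp_sum sum_negf[symmetric])
  also have "(\<Sum>k<K. (1 - v k) * (\<integral>x\<in>?A k. g x \<partial>lborel)) = (\<integral>x\<in>B. (1 - v (\<kappa> x)) * g x \<partial>lborel)"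
  proof -
    have "(\<Sum>k<K. (1 - v k) * (\<integral>x\<in>?A k. g x \<partial>lborel)) = (\<integral>x. (\<Sum>k<K. (1 - v k) * (indicator (?A k) x * g x)) \<partial>lborel)"
      using gA unfolding set_lebesgue_integral_def set_integrable_def
      by (subst Bochner_Integration.integral_sum) auto
    also have "\<dots> = (\<integral>x\<in>B. (1 - v (\<kappa> x)) * g x \<partial>lborel)"
      unfolding set_lebesgue_integral_def
    proof (intro Bochner_Integration.integral_cong refl)
      fix x
      have "(\<Sum>k<K. (1 - v k) * (indicator (?A k) x * g x)) = (\<Sum>k<K. if k = \<kappa> x then (1 - v k) * (indicator B x * g x) else 0)"
        by (intro sum.cong) (auto simp: indicator_def)
      also have "\<dots> = indicator B x *\<^sub>R ((1 - v (\<kappa> x)) * g x)"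
        using K[of x] by (auto simp: indicator_def)
      finally show "(\<Sum>k<K. (1 - v k) * (indicator (?A k) x * g x)) = indicator B x *\<^sub>R ((1 - v (\<kappa> x)) * g x)" .
    qed
    finally show ?thesis .
  qed
  finally show "expectation (\<lambda>\<omega>. \<Prod>k<K. v k ^ pp_count X (?A k) \<omega>) = exp (- (\<integral>x\<in>B. (1 - v (\<kappa> x)) * g x \<partial>lborel))" .
qed

text \<open>The product over all points is taken as a limit over the enumeration \<open>X\<close>;
  since \<open>s\<close> is 1 off a bounded set, the partial products are eventually constant. For
  the value, \<open>s\<close> is squeezed between step weights at distance at most
  \<open>1 / m\<close>, which changes the exponent by at most \<open>?G / m\<close>.\<close>

lemma pp_laplace:
  assumes pp: "poisson_point_process M g X" and B[measurable]: "B \<in> sets borel" and Bb: "bounded B"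
    and s[measurable]: "s \<in> borel_measurable borel" and s01: "\<And>x. 0 \<le> s x" "\<And>x. s x \<le> 1"
    and sB: "\<And>x. x \<notin> B \<Longrightarrow> s x = 1"
    and gm[measurable]: "g \<in> borel_measurable borel" and g: "\<And>x. g x \<ge> 0" and gi: "set_integrable lborel B g"
  shows "(\<lambda>N. expectation (\<lambda>\<omega>. \<Prod>n<N. s (X n \<omega>))) \<longlonglongrightarrow> exp (- (\<integral>x\<in>B. (1 - s x) * g x \<partial>lborel))"
proof -
  note [measurable] = pp_measurable[OF pp]
  define S where "S \<omega> = {n. X n \<omega> \<in> B}" for \<omega>
  define L where "L \<omega> = (\<Prod>n\<in>S \<omega>. s (X n \<omega>))" for \<omega>
  have S: "finite (S \<omega>)" if w: "\<omega> \<in> space M" for \<omega>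
  proof -
    obtain N where "\<forall>n\<ge>N. X n \<omega> \<notin> B" using pp_bounded_ev[OF pp w Bb] by blast
    then have "S \<omega> \<subseteq> {..<N}" unfolding S_def using not_le by auto
    then show ?thesis by (rule finite_subset) auto
  qed
  have lim: "(\<lambda>N. \<Prod>n<N. s (X n \<omega>)) \<longlonglongrightarrow> L \<omega>" if w: "\<omega> \<in> space M" for \<omega>
  proof -
    obtain N where N: "\<forall>n\<ge>N. X n \<omega> \<notin> B" using pp_bounded_ev[OF pp w Bb] by blast
    have "(\<Prod>n<N'. s (X n \<omega>)) = L \<omega>" if "N' \<ge> N" for N'
      unfolding L_def
    proof (rule prod.mono_neutral_right)
      show "S \<omega> \<subseteq> {..<N'}" unfolding S_def using N that by (auto simp: not_le[symmetric])
      show "\<forall>i\<in>{..<N'} - S \<omega>. s (X i \<omega>) = 1" by (auto simp: S_def sB)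
    qed auto
    then have "\<forall>\<^sub>F N' in sequentially. (\<Prod>n<N'. s (X n \<omega>)) = L \<omega>"
      unfolding eventually_sequentially by blast
    then show ?thesis by (rule tendsto_eventually)
  qed
  have Lm[measurable]: "L \<in> borel_measurable M"
    by (rule borel_measurable_LIMSEQ_real[OF lim]) auto
  have p01: "0 \<le> (\<Prod>n<N. s (X n \<omega>))" "(\<Prod>n<N. s (X n \<omega>)) \<le> 1" for N \<omega>
    using s01 by (auto intro!: prod_nonneg prod_le_1)
  have 1: "(\<lambda>N. expectation (\<lambda>\<omega>. \<Prod>n<N. s (X n \<omega>))) \<longlonglongrightarrow> expectation L"
    by (rule integral_dominated_convergence[where w="\<lambda>_. 1"]) (auto simp: lim p01)
  have L01: "0 \<le> L \<omega>" "L \<omega> \<le> 1" for \<omega>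
    unfolding L_def using s01 by (auto intro!: prod_nonneg prod_le_1)
  have Li: "integrable M L"
    by (rule integrable_const_bound[of _ 1]) (auto simp: L01)
  have I_int: "set_integrable lborel B (\<lambda>x. h x * g x)" if [measurable]: "h \<in> borel_measurable borel" and h: "\<And>x. x \<in> B \<Longrightarrow> \<bar>h x\<bar> \<le> 1" for h
  proof (rule set_integrable_bound[OF gi])
    show "set_borel_measurable lborel B (\<lambda>x. h x * g x)" unfolding set_borel_measurable_def by measurable
    show "AE x in lborel. x \<in> B \<longrightarrow> norm (h x * g x) \<le> norm (g x)"
      using h g by (auto simp: abs_mult intro!: AE_I2 mult_left_le_one_le)
  qed
  let ?I = "\<integral>x\<in>B. (1 - s x) * g x \<partial>lborel" and ?G = "\<integral>x\<in>B. g x \<partial>lborel"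
  have bounds: "exp (- (?I + ?G / m)) \<le> expectation L \<and> expectation L \<le> exp (- (?I - ?G / m))" if m: "m > 0" for m :: nat
  proof -
    \<comment> \<open>The value \<open>m\<close> is taken exactly where \<open>s x = 1\<close>, so
      there are \<open>Suc m\<close> classes.\<close>
    define \<kappa> where "\<kappa> x = nat \<lfloor>real m * s x\<rfloor>" for x
    have [measurable]: "\<kappa> \<in> measurable borel (count_space UNIV)" unfolding \<kappa>_def by measurable
    have \<kappa>: "real (\<kappa> x) \<le> real m * s x" "real m * s x < real (\<kappa> x) + 1" for x
      unfolding \<kappa>_def using s01(1)[of x] by (auto simp: of_nat_nat)
    have \<kappa>m: "\<kappa> x < Suc m" for x
    proof -
      have "real m * s x \<le> real m * 1" using s01(2)[of x] by (intro mult_left_mono) auto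
      with \<kappa>(1)[of x] have "real (\<kappa> x) \<le> real m" by linarith
      then show ?thesis by simp
    qed
    define vl where "vl k = real k / real m" for k
    define vu where "vu k = min 1 ((real k + 1) / real m)" for k
    have sl: "vl (\<kappa> x) \<le> s x" and su: "s x \<le> vu (\<kappa> x)" for x
      unfolding vl_def vu_def using \<kappa>[of x] m s01(2)[of x] by (auto simp: field_simps)
    have v0: "vl k \<ge> 0" "vu k \<ge> 0" for k unfolding vl_def vu_def by auto
    have v1: "vl (\<kappa> x) \<le> 1" "vu k \<le> 1" for x k
      using sl[of x] s01(2)[of x] unfolding vu_def by auto
    have vd: "vu (\<kappa> x) \<le> s x + 1 / m" "s x - 1 / m \<le> vl (\<kappa> x)" for x
    proof -
      have "s x \<le> (real (\<kappa> x) + 1) / m" using \<kappa>(2)[of x] m by (simp add: field_simps)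
      then show "vu (\<kappa> x) \<le> s x + 1 / m" "s x - 1 / m \<le> vl (\<kappa> x)"
        using sl[of x] by (auto simp: vl_def vu_def add_divide_distrib)
    qed
    have grp: "(\<Prod>k<Suc m. v k ^ pp_count X {x\<in>B. \<kappa> x = k} \<omega>) = (\<Prod>n\<in>S \<omega>. v (\<kappa> (X n \<omega>)))"
      if "\<omega> \<in> space M" for v :: "nat \<Rightarrow> real" and \<omega>
    proof -
      have "(\<Prod>n\<in>S \<omega>. v (\<kappa> (X n \<omega>))) = (\<Prod>k<Suc m. \<Prod>n\<in>{n\<in>S \<omega>. \<kappa> (X n \<omega>) = k}. v (\<kappa> (X n \<omega>)))"
        using S[OF that] \<kappa>m by (intro prod.group[symmetric]) auto
      also have "\<dots> = (\<Prod>k<Suc m. v k ^ pp_count X {x\<in>B. \<kappa> x = k} \<omega>)"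
        by (intro prod.cong refl) (simp add: pp_count_def S_def)
      finally show ?thesis by simp
    qed
    note pl = pp_simple_pgf[OF pp B Bb \<open>\<kappa> \<in> measurable borel (count_space UNIV)\<close> \<kappa>m v0(1) g gi]
    note pu = pp_simple_pgf[OF pp B Bb \<open>\<kappa> \<in> measurable borel (count_space UNIV)\<close> \<kappa>m v0(2) g gi]
    have "expectation (\<lambda>\<omega>. \<Prod>k<Suc m. vl k ^ pp_count X {x\<in>B. \<kappa> x = k} \<omega>) \<le> expectation L"
    proof (intro integral_mono pl(1) Li)
      fix \<omega> assume w: "\<omega> \<in> space M"
      show "(\<Prod>k<Suc m. vl k ^ pp_count X {x \<in> B. \<kappa> x = k} \<omega>) \<le> L \<omega>"
        unfolding grp[OF w] L_def using sl v0 by (intro prod_mono) auto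
    qed
    then have 1: "exp (- (\<integral>x\<in>B. (1 - vl (\<kappa> x)) * g x \<partial>lborel)) \<le> expectation L" by (simp only: pl(2))
    have "expectation L \<le> expectation (\<lambda>\<omega>. \<Prod>k<Suc m. vu k ^ pp_count X {x\<in>B. \<kappa> x = k} \<omega>)"
    proof (intro integral_mono pu(1) Li)
      fix \<omega> assume w: "\<omega> \<in> space M"
      show "L \<omega> \<le> (\<Prod>k<Suc m. vu k ^ pp_count X {x \<in> B. \<kappa> x = k} \<omega>)"
        unfolding grp[OF w] L_def using su s01 by (intro prod_mono) auto
    qed
    then have 2: "expectation L \<le> exp (- (\<integral>x\<in>B. (1 - vu (\<kappa> x)) * g x \<partial>lborel))" by (simp only: pu(2))
    have [measurable]: "vl \<in> measurable (count_space UNIV) borel" "vu \<in> measurable (count_space UNIV) borel" by auto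
    have si: "set_integrable lborel B (\<lambda>x. (1 - s x) * g x)"
      using s01 by (intro I_int) (auto simp: abs_le_iff intro: order_trans[of _ 0])
    have gi': "set_integrable lborel B (\<lambda>x. 1 / m * g x)" by (intro set_integrable_mult_right gi)
    have "(\<integral>x\<in>B. (1 - vl (\<kappa> x)) * g x \<partial>lborel) \<le> (\<integral>x\<in>B. (1 - s x) * g x + 1 / m * g x \<partial>lborel)"
    proof (intro set_integral_mono set_integral_add si gi' I_int)
      fix x
      have "(1 - vl (\<kappa> x)) * g x \<le> (1 - s x + 1 / m) * g x"
        using vd(2)[of x] g by (intro mult_right_mono) auto
      then show "(1 - vl (\<kappa> x)) * g x \<le> (1 - s x) * g x + 1 / m * g x" by (simp add: algebra_simps)
      show "\<bar>1 - vl (\<kappa> x)\<bar> \<le> 1" using v0(1)[of "\<kappa> x"] v1(1)[of x] by auto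
    qed measurable
    also have "\<dots> = ?I + 1 / m * ?G" using si gi' by (simp add: set_integral_add)
    finally have 3: "(\<integral>x\<in>B. (1 - vl (\<kappa> x)) * g x \<partial>lborel) \<le> ?I + ?G / m" by simp
    have "?I \<le> (\<integral>x\<in>B. (1 - vu (\<kappa> x)) * g x + 1 / m * g x \<partial>lborel)"
    proof (intro set_integral_mono set_integral_add si gi' I_int)
      fix x
      have "(1 - s x) * g x \<le> (1 - vu (\<kappa> x) + 1 / m) * g x"
        using vd(1)[of x] g by (intro mult_right_mono) auto
      then show "(1 - s x) * g x \<le> (1 - vu (\<kappa> x)) * g x + 1 / m * g x" by (simp add: algebra_simps)
      show "\<bar>1 - vu (\<kappa> x)\<bar> \<le> 1" using v0(2)[of "\<kappa> x"] v1(2)[of "\<kappa> x"] by auto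
    qed measurable
    also have "\<dots> = (\<integral>x\<in>B. (1 - vu (\<kappa> x)) * g x \<partial>lborel) + 1 / m * ?G"
    proof -
      have "set_integrable lborel B (\<lambda>x. (1 - vu (\<kappa> x)) * g x)"
        using v0(2) v1(2) by (intro I_int) (auto simp: abs_le_iff intro: order_trans[of _ 0])
      then show ?thesis using gi' by (simp add: set_integral_add)
    qed
    finally have 4: "?I - ?G / m \<le> (\<integral>x\<in>B. (1 - vu (\<kappa> x)) * g x \<partial>lborel)" by simp
    have "exp (- (?I + ?G / m)) \<le> exp (- (\<integral>x\<in>B. (1 - vl (\<kappa> x)) * g x \<partial>lborel))" using 3 by simp
    moreover have "exp (- (\<integral>x\<in>B. (1 - vu (\<kappa> x)) * g x \<partial>lborel)) \<le> exp (- (?I - ?G / m))" using 4 by simp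
    ultimately show ?thesis using 1 2 by linarith
  qed
  have z: "(\<lambda>m. ?G / real m) \<longlonglongrightarrow> 0" by (rule lim_const_over_n)
  have "(\<lambda>m. exp (- (?I + ?G / real m))) \<longlonglongrightarrow> exp (- (?I + 0))" by (intro tendsto_intros z)
  then have "exp (- (?I + 0)) \<le> expectation L"
    by (rule LIMSEQ_le_const2) (use bounds in \<open>auto intro!: exI[of _ 1]\<close>)
  moreover have "(\<lambda>m. exp (- (?I - ?G / real m))) \<longlonglongrightarrow> exp (- (?I - 0))" by (intro tendsto_intros z)
  then have "expectation L \<le> exp (- (?I - 0))"
    by (rule LIMSEQ_le_const) (use bounds in \<open>auto intro!: exI[of _ 1]\<close>)
  ultimately have "expectation L = exp (- ?I)" by simp
  with 1 show ?thesis by simp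
qed

end

section \<open>Independent marks attached to the points\<close>

lemma set_integral_eq_measure_pair:
  fixes g :: "real \<Rightarrow> real" and C :: "(real \<times> real) set"
  assumes \<nu>: "prob_space \<nu>" and s\<nu>: "sets \<nu> = sets borel"
    and [measurable]: "g \<in> borel_measurable borel" and g: "\<And>x. g x \<ge> 0"
    and C: "C \<in> sets (borel \<Otimes>\<^sub>M borel)" and B[measurable]: "B \<in> sets borel" and gi: "set_integrable lborel B g"
    and CB: "C \<subseteq> B \<times> UNIV"
  shows "emeasure (density lborel g \<Otimes>\<^sub>M \<nu>) C = ennreal (\<integral>x\<in>B. measure \<nu> (Pair x -` C) * g x \<partial>lborel)"
    and "(\<lambda>x. measure \<nu> (Pair x -` C)) \<in> borel_measurable borel"
    and "set_integrable lborel B (\<lambda>x. measure \<nu> (Pair x -` C) * g x)"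
proof -
  interpret \<nu>: prob_space \<nu> by fact
  have C': "C \<in> sets (borel \<Otimes>\<^sub>M \<nu>)" using C by (simp cong: sets_pair_measure_cong add: s\<nu>)
  have C'': "C \<in> sets (density lborel g \<Otimes>\<^sub>M \<nu>)"
    using C' by (subst sets_pair_measure_cong[of _ borel _ \<nu>]) auto
  have em: "(\<lambda>x. emeasure \<nu> (Pair x -` C)) \<in> borel_measurable borel"
    by (rule \<nu>.measurable_emeasure_Pair[OF C'])
  then show [measurable]: "(\<lambda>x. measure \<nu> (Pair x -` C)) \<in> borel_measurable borel"
    unfolding measure_def by measurable
  have "set_integrable lborel B (\<lambda>x. g x * measure \<nu> (Pair x -` C))"
  proof (rule set_integrable_bound[OF gi])
    show "set_borel_measurable lborel B (\<lambda>x. g x * measure \<nu> (Pair x -` C))" unfolding set_borel_measurable_def by measurable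
    show "AE x in lborel. x \<in> B \<longrightarrow> norm (g x * measure \<nu> (Pair x -` C)) \<le> norm (g x)"
      using g by (auto simp: abs_mult intro!: AE_I2 mult_left_le)
  qed
  then show si: "set_integrable lborel B (\<lambda>x. measure \<nu> (Pair x -` C) * g x)" by (simp add: mult.commute)
  have "emeasure (density lborel g \<Otimes>\<^sub>M \<nu>) C = (\<integral>\<^sup>+x. emeasure \<nu> (Pair x -` C) \<partial>density lborel g)"
    by (rule \<nu>.emeasure_pair_measure_alt[OF C''])
  also have "\<dots> = (\<integral>\<^sup>+x. ennreal (g x) * emeasure \<nu> (Pair x -` C) \<partial>lborel)"
    using em by (subst nn_integral_density) auto
  also have "\<dots> = (\<integral>\<^sup>+x. ennreal (indicator B x * (measure \<nu> (Pair x -` C) * g x)) \<partial>lborel)"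
  proof (intro nn_integral_cong)
    fix x
    show "ennreal (g x) * emeasure \<nu> (Pair x -` C) = ennreal (indicator B x * (measure \<nu> (Pair x -` C) * g x))"
    proof (cases "x \<in> B")
      case True then show ?thesis using g by (simp add: \<nu>.emeasure_eq_measure ennreal_mult mult.commute)
    next
      case False then have "Pair x -` C = {}" using CB by auto
      then show ?thesis using False by simp
    qed
  qed
  also have "\<dots> = ennreal (\<integral>x\<in>B. measure \<nu> (Pair x -` C) * g x \<partial>lborel)"
    unfolding set_lebesgue_integral_def using si g unfolding set_integrable_def
    by (subst nn_integral_eq_integral) (auto simp: indicator_def)
  finally show "emeasure (density lborel g \<Otimes>\<^sub>M \<nu>) C = ennreal (\<integral>x\<in>B. measure \<nu> (Pair x -` C) * g x \<partial>lborel)" .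
qed

context prob_space begin

text \<open>Given the positions, the marks are still independent with law \<open>\<nu>\<close>, so
  the \<open>n\<close>-th point avoids \<open>C\<close> with probability 1 minus the measure of the
  section of \<open>C\<close> over it. Point \<open>n\<close> carries the mark \<open>Suc n\<close>
  because mark 0 belongs to the initially active frog, whose constraint \<open>A\<close> splits off
  as a factor.\<close>

lemma marked_finite_void:
  fixes X Y :: "nat \<Rightarrow> 'a \<Rightarrow> real"
  assumes XY: "indep_var (Pi\<^sub>M UNIV (\<lambda>_. borel)) (\<lambda>\<omega> n. X n \<omega>) (Pi\<^sub>M UNIV (\<lambda>_. borel)) (\<lambda>\<omega> n. Y n \<omega>)"
    and Y: "indep_vars (\<lambda>_. borel) Y UNIV" and \<nu>: "\<And>i. distr M borel (Y i) = \<nu>"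
    and C: "C \<in> sets (borel \<Otimes>\<^sub>M borel)" and A: "A \<in> sets borel"
  shows "prob {\<omega>\<in>space M. Y 0 \<omega> \<in> A \<and> (\<forall>n<N. (X n \<omega>, Y (Suc n) \<omega>) \<notin> C)}
       = prob {\<omega>\<in>space M. Y 0 \<omega> \<in> A} * expectation (\<lambda>\<omega>. \<Prod>n<N. 1 - measure \<nu> (Pair (X n \<omega>) -` C))"
proof -
  let ?P = "Pi\<^sub>M UNIV (\<lambda>_::nat. borel :: real measure)"
  note [measurable] = C A
  have rX: "(\<lambda>\<omega> n. X n \<omega>) \<in> measurable M ?P" and rY: "(\<lambda>\<omega> n. Y n \<omega>) \<in> measurable M ?P"
    using XY by (auto dest: indep_var_rv1 indep_var_rv2)
  have Xm[measurable]: "X n \<in> borel_measurable M" and Ym[measurable]: "Y n \<in> borel_measurable M" for n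
    using measurable_compose[OF rX measurable_component_singleton[of n]] measurable_compose[OF rY measurable_component_singleton[of n]] by auto
  have p\<nu>: "prob_space \<nu>" using prob_space_distr[OF Ym[of 0]] by (simp add: \<nu>)
  interpret \<nu>: prob_space \<nu> by fact
  have s\<nu>: "sets \<nu> = sets borel" "space \<nu> = UNIV" using \<nu>[of 0] by auto
  define E where "E = {p \<in> space (?P \<Otimes>\<^sub>M ?P). snd p 0 \<in> A \<and> (\<forall>n<N. (fst p n, snd p (Suc n)) \<notin> C)}"
  have E[measurable]: "E \<in> sets (?P \<Otimes>\<^sub>M ?P)" unfolding E_def by measurable
  interpret DY: prob_space "distr M ?P (\<lambda>\<omega> n. Y n \<omega>)" by (rule prob_space_distr[OF rY])
  have secm: "(\<lambda>x. measure \<nu> (Pair x -` C)) \<in> borel_measurable borel"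
    using \<nu>.measurable_emeasure_Pair[of C borel] C s\<nu> by (simp add: measure_def cong: sets_pair_measure_cong)
  note [measurable] = measurable_compose[OF _ secm]
  have Cx: "Pair x -` C \<in> sets borel" for x using sets_Pair1[OF C] .
  have sec: "emeasure (distr M ?P (\<lambda>\<omega> n. Y n \<omega>)) (Pair x -` E)
      = ennreal (prob {\<omega>\<in>space M. Y 0 \<omega> \<in> A} * (\<Prod>n<N. 1 - measure \<nu> (Pair (x n) -` C)))" for x
  proof -
    \<comment> \<open>One constraint per mark, so that a single use of independence gives the whole
      product.\<close>
    define D where "D i = (case i of 0 \<Rightarrow> A | Suc n \<Rightarrow> - (Pair (x n) -` C))" for i
    have D: "D i \<in> sets borel" for i using A Cx by (auto simp: D_def split: nat.split)
    have "Pair x -` E = {y \<in> space ?P. y 0 \<in> A \<and> (\<forall>n<N. (x n, y (Suc n)) \<notin> C)}"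
      unfolding E_def by (auto simp: space_pair_measure space_PiM)
    moreover have "Pair x -` E \<in> sets ?P" by (rule sets_Pair1[OF E])
    ultimately have "emeasure (distr M ?P (\<lambda>\<omega> n. Y n \<omega>)) (Pair x -` E) =
       emeasure M {\<omega>\<in>space M. Y 0 \<omega> \<in> A \<and> (\<forall>n<N. (x n, Y (Suc n) \<omega>) \<notin> C)}"
      using rY by (subst emeasure_distr) (auto intro!: arg_cong[where f="emeasure M"] simp: space_PiM)
    also have "{\<omega>\<in>space M. Y 0 \<omega> \<in> A \<and> (\<forall>n<N. (x n, Y (Suc n) \<omega>) \<notin> C)} = (\<Inter>i\<in>{..N}. Y i -` D i \<inter> space M)"
    proof (intro equalityI subsetI)
      fix \<omega> assume w: "\<omega> \<in> {\<omega>\<in>space M. Y 0 \<omega> \<in> A \<and> (\<forall>n<N. (x n, Y (Suc n) \<omega>) \<notin> C)}"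
      show "\<omega> \<in> (\<Inter>i\<in>{..N}. Y i -` D i \<inter> space M)"
      proof
        fix i assume "i \<in> {..N}"
        with w show "\<omega> \<in> Y i -` D i \<inter> space M" by (cases i) (auto simp: D_def)
      qed
    next
      fix \<omega> assume w: "\<omega> \<in> (\<Inter>i\<in>{..N}. Y i -` D i \<inter> space M)"
      have "Y i \<omega> \<in> D i" "\<omega> \<in> space M" if "i \<le> N" for i using w that by auto
      from this(1)[of 0] this(2)[of 0] this(1)[of "Suc _"] show "\<omega> \<in> {\<omega>\<in>space M. Y 0 \<omega> \<in> A \<and> (\<forall>n<N. (x n, Y (Suc n) \<omega>) \<notin> C)}"
        by (auto simp: D_def)
    qed
    also have "emeasure M \<dots> = ennreal (\<Prod>i\<in>{..N}. prob (Y i -` D i \<inter> space M))"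
      using D by (subst indep_varsD[OF Y, symmetric]) (auto simp: emeasure_eq_measure)
    also have "(\<Prod>i\<in>{..N}. prob (Y i -` D i \<inter> space M)) = prob (Y 0 -` D 0 \<inter> space M) * (\<Prod>n<N. prob (Y (Suc n) -` D (Suc n) \<inter> space M))"
      by (simp add: lessThan_Suc_atMost[symmetric] prod.lessThan_Suc_shift del: prod.lessThan_Suc)
    also have "prob (Y 0 -` D 0 \<inter> space M) = prob {\<omega>\<in>space M. Y 0 \<omega> \<in> A}"
      by (auto simp: D_def intro!: arg_cong[where f=prob])
    also have "(\<Prod>n<N. prob (Y (Suc n) -` D (Suc n) \<inter> space M)) = (\<Prod>n<N. 1 - measure \<nu> (Pair (x n) -` C))"
    proof (intro prod.cong refl)
      fix n
      have "prob (Y (Suc n) -` D (Suc n) \<inter> space M) = measure \<nu> (- (Pair (x n) -` C))"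
        using Cx by (subst \<nu>[of "Suc n", symmetric], subst measure_distr) (auto simp: D_def)
      also have "\<dots> = 1 - measure \<nu> (Pair (x n) -` C)"
        using \<nu>.prob_compl[of "Pair (x n) -` C"] Cx s\<nu> by (simp add: Compl_eq_Diff_UNIV)
      finally show "prob (Y (Suc n) -` D (Suc n) \<inter> space M) = 1 - measure \<nu> (Pair (x n) -` C)" .
    qed
    finally show ?thesis .
  qed
  have p01: "0 \<le> (\<Prod>n<N. 1 - measure \<nu> (Pair (x n) -` C))" "(\<Prod>n<N. 1 - measure \<nu> (Pair (x n) -` C)) \<le> 1" for x
    by (auto intro!: prod_nonneg prod_le_1)
  have "ennreal (prob {\<omega>\<in>space M. Y 0 \<omega> \<in> A \<and> (\<forall>n<N. (X n \<omega>, Y (Suc n) \<omega>) \<notin> C)})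
     = emeasure (distr M (?P \<Otimes>\<^sub>M ?P) (\<lambda>\<omega>. (\<lambda>n. X n \<omega>, \<lambda>n. Y n \<omega>))) E"
  proof -
    have "(\<lambda>\<omega>. (\<lambda>n. X n \<omega>, \<lambda>n. Y n \<omega>)) \<in> measurable M (?P \<Otimes>\<^sub>M ?P)" using rX rY by measurable
    then show ?thesis
      by (subst emeasure_distr[OF _ E]) (auto simp: emeasure_eq_measure[symmetric] E_def space_pair_measure space_PiM intro!: arg_cong[where f="emeasure M"])
  qed
  also have "distr M (?P \<Otimes>\<^sub>M ?P) (\<lambda>\<omega>. (\<lambda>n. X n \<omega>, \<lambda>n. Y n \<omega>)) = distr M ?P (\<lambda>\<omega> n. X n \<omega>) \<Otimes>\<^sub>M distr M ?P (\<lambda>\<omega> n. Y n \<omega>)"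
    using XY unfolding indep_var_distribution_eq by simp
  also have "emeasure \<dots> E = (\<integral>\<^sup>+x. emeasure (distr M ?P (\<lambda>\<omega> n. Y n \<omega>)) (Pair x -` E) \<partial>distr M ?P (\<lambda>\<omega> n. X n \<omega>))"
    using E by (intro DY.emeasure_pair_measure_alt) (simp cong: sets_pair_measure_cong)
  also have "\<dots> = (\<integral>\<^sup>+\<omega>. ennreal (prob {\<omega>\<in>space M. Y 0 \<omega> \<in> A} * (\<Prod>n<N. 1 - measure \<nu> (Pair (X n \<omega>) -` C))) \<partial>M)"
    unfolding sec by (subst nn_integral_distr[OF rX]) measurable
  also have "\<dots> = ennreal (expectation (\<lambda>\<omega>. prob {\<omega>\<in>space M. Y 0 \<omega> \<in> A} * (\<Prod>n<N. 1 - measure \<nu> (Pair (X n \<omega>) -` C))))"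
  proof (rule nn_integral_eq_integral)
    show "integrable M (\<lambda>\<omega>. prob {\<omega>\<in>space M. Y 0 \<omega> \<in> A} * (\<Prod>n<N. 1 - measure \<nu> (Pair (X n \<omega>) -` C)))"
      using p01 by (intro integrable_mult_right integrable_const_bound[of _ 1]) auto
  qed (use p01 in auto)
  finally have "prob {\<omega>\<in>space M. Y 0 \<omega> \<in> A \<and> (\<forall>n<N. (X n \<omega>, Y (Suc n) \<omega>) \<notin> C)} =
      expectation (\<lambda>\<omega>. prob {\<omega>\<in>space M. Y 0 \<omega> \<in> A} * (\<Prod>n<N. 1 - measure \<nu> (Pair (X n \<omega>) -` C)))"
    using p01 by (subst (asm) ennreal_inj) (auto intro!: Bochner_Integration.integral_nonneg mult_nonneg_nonneg)
  then show ?thesis by simp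
qed

lemma marked_void:
  fixes X Y :: "nat \<Rightarrow> 'a \<Rightarrow> real"
  assumes XY: "indep_var (Pi\<^sub>M UNIV (\<lambda>_. borel)) (\<lambda>\<omega> n. X n \<omega>) (Pi\<^sub>M UNIV (\<lambda>_. borel)) (\<lambda>\<omega> n. Y n \<omega>)"
    and Y: "indep_vars (\<lambda>_. borel) Y UNIV" and \<nu>: "\<And>i. distr M borel (Y i) = \<nu>"
    and pp: "poisson_point_process M g X"
    and gm: "g \<in> borel_measurable borel" and g: "\<And>x. g x \<ge> 0"
    and C: "C \<in> sets (borel \<Otimes>\<^sub>M borel)" and A: "A \<in> sets borel"
    and B: "B \<in> sets borel" "bounded B" and gi: "set_integrable lborel B g" and CB: "C \<subseteq> B \<times> UNIV"
  shows "{\<omega>\<in>space M. Y 0 \<omega> \<in> A \<and> (\<forall>n. (X n \<omega>, Y (Suc n) \<omega>) \<notin> C)} \<in> events"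
    and "prob {\<omega>\<in>space M. Y 0 \<omega> \<in> A \<and> (\<forall>n. (X n \<omega>, Y (Suc n) \<omega>) \<notin> C)}
       = prob {\<omega>\<in>space M. Y 0 \<omega> \<in> A} * exp (- measure (density lborel g \<Otimes>\<^sub>M \<nu>) C)"
proof -
  note [measurable] = C A
  have Xm[measurable]: "X n \<in> borel_measurable M" for n by (rule pp_measurable[OF pp])
  have Ym[measurable]: "Y n \<in> borel_measurable M" for n
    using Y by (simp add: indep_vars_def)
  have p\<nu>: "prob_space \<nu>" using prob_space_distr[OF Ym[of 0]] by (simp add: \<nu>)
  interpret \<nu>: prob_space \<nu> by fact
  have s\<nu>: "sets \<nu> = sets borel" using \<nu>[of 0] by auto
  note mp = set_integral_eq_measure_pair[OF p\<nu> s\<nu> gm g C B(1) gi CB]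
  let ?F = "\<lambda>N. {\<omega>\<in>space M. Y 0 \<omega> \<in> A \<and> (\<forall>n<N. (X n \<omega>, Y (Suc n) \<omega>) \<notin> C)}"
  let ?V = "{\<omega>\<in>space M. Y 0 \<omega> \<in> A \<and> (\<forall>n. (X n \<omega>, Y (Suc n) \<omega>) \<notin> C)}"
  show "?V \<in> events" by measurable
  have F: "?F N \<in> events" for N by measurable
  have "(\<lambda>N. prob (?F N)) \<longlonglongrightarrow> prob (\<Inter>N. ?F N)"
    using F by (intro finite_Lim_measure_decseq) (auto simp: decseq_def)
  also have "(\<Inter>N. ?F N) = ?V" by auto
  finally have 1: "(\<lambda>N. prob (?F N)) \<longlonglongrightarrow> prob ?V" .
  have "(\<lambda>N. expectation (\<lambda>\<omega>. \<Prod>n<N. 1 - measure \<nu> (Pair (X n \<omega>) -` C)))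
     \<longlonglongrightarrow> exp (- (\<integral>x\<in>B. (1 - (1 - measure \<nu> (Pair x -` C))) * g x \<partial>lborel))"
  proof (rule pp_laplace[OF pp B _ _ _ _ gm g gi])
    show "(\<lambda>x. 1 - measure \<nu> (Pair x -` C)) \<in> borel_measurable borel" using mp(2) by measurable
    fix x assume "x \<notin> B"
    then have "Pair x -` C = {}" using CB by auto
    then show "1 - measure \<nu> (Pair x -` C) = 1" by simp
  qed auto
  also have "(\<integral>x\<in>B. (1 - (1 - measure \<nu> (Pair x -` C))) * g x \<partial>lborel) = measure (density lborel g \<Otimes>\<^sub>M \<nu>) C"
    unfolding measure_def[of "density lborel g \<Otimes>\<^sub>M \<nu>"] mp(1) using g
    by (subst enn2real_ennreal) (auto simp: set_lebesgue_integral_def intro!: Bochner_Integration.integral_nonneg)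
  finally have 2: "(\<lambda>N. prob {\<omega>\<in>space M. Y 0 \<omega> \<in> A} * expectation (\<lambda>\<omega>. \<Prod>n<N. 1 - measure \<nu> (Pair (X n \<omega>) -` C)))
     \<longlonglongrightarrow> prob {\<omega>\<in>space M. Y 0 \<omega> \<in> A} * exp (- measure (density lborel g \<Otimes>\<^sub>M \<nu>) C)" by (intro tendsto_intros)
  show "prob ?V = prob {\<omega>\<in>space M. Y 0 \<omega> \<in> A} * exp (- measure (density lborel g \<Otimes>\<^sub>M \<nu>) C)"
    by (rule LIMSEQ_unique[OF 1]) (use 2 in \<open>simp only: marked_finite_void[OF XY Y \<nu> C A]\<close>)
qed

end

section \<open>Divergence of the integral\<close>

context prob_space begin

text \<open>Here \<open>e k n\<close> is the conditional probability of \<open>U n\<close> given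
  \<open>U k\<close>, unaffected by earlier occurrences. The hypothesis \<open>regen\<close> speaks
  of intersections of the events \<open>U i\<close> only, because an intersection of void events is
  again a void event, whereas complements are not.\<close>

lemma renewal_covers:
  fixes U :: "nat \<Rightarrow> 'a set" and e :: "nat \<Rightarrow> nat \<Rightarrow> real" and u :: "nat \<Rightarrow> real"
  assumes U: "\<And>i. U i \<in> events"
    and regen: "\<And>S k n. finite S \<Longrightarrow> S \<subseteq> {1..<k} \<Longrightarrow> 1 \<le> k \<Longrightarrow> k < n \<Longrightarrow>
       prob {\<omega>\<in>space M. (\<forall>i\<in>S. \<omega> \<in> U i) \<and> \<omega> \<in> U k \<and> \<omega> \<in> U n} = prob {\<omega>\<in>space M. (\<forall>i\<in>S. \<omega> \<in> U i) \<and> \<omega> \<in> U k} * e k n"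
    and e: "\<And>k n. 1 \<le> k \<Longrightarrow> k < n \<Longrightarrow> e k n \<le> prob (U (n - k))"
    and div: "\<not> summable (\<lambda>n. prob (U n))" and m: "1 \<le> m"
  shows "AE \<omega> in M. \<exists>i\<ge>m. \<omega> \<in> U i"
proof -
  note [measurable] = U
  \<comment> \<open>The first occurrence is defined through complements. Excluding one more index
    writes an event as a difference of two events already treated, and the claimed identity is
    linear in such differences.\<close>
  have neg: "prob {\<omega>\<in>space M. (\<forall>i\<in>S. \<omega> \<in> U i) \<and> (\<forall>i\<in>T. \<omega> \<notin> U i) \<and> \<omega> \<in> U k \<and> \<omega> \<in> U n}
     = prob {\<omega>\<in>space M. (\<forall>i\<in>S. \<omega> \<in> U i) \<and> (\<forall>i\<in>T. \<omega> \<notin> U i) \<and> \<omega> \<in> U k} * e k n"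
    if "finite T" "T \<subseteq> {1..<k}" "finite S" "S \<subseteq> {1..<k}" "1 \<le> k" "k < n" for S T k n
    using that
  proof (induction T arbitrary: S rule: finite_induct)
    case empty then show ?case using regen by simp
  next
    case (insert t T)
    let ?B = "\<lambda>S T. {\<omega>\<in>space M. (\<forall>i\<in>S. \<omega> \<in> U i) \<and> (\<forall>i\<in>T. \<omega> \<notin> U i) \<and> \<omega> \<in> U k}"
    let ?C = "\<lambda>S T. {\<omega>\<in>space M. (\<forall>i\<in>S. \<omega> \<in> U i) \<and> (\<forall>i\<in>T. \<omega> \<notin> U i) \<and> \<omega> \<in> U k \<and> \<omega> \<in> U n}"
    have sets: "?B S T \<in> events" "?C S T \<in> events" if "finite S" for S
      using that insert(1) by measurable
    have 1: "prob (?B S (insert t T)) = prob (?B S T) - prob (?B (insert t S) T)"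
      using insert.prems by (subst finite_measure_Diff[symmetric]) (auto intro!: sets arg_cong[where f=prob])
    have 2: "prob (?C S (insert t T)) = prob (?C S T) - prob (?C (insert t S) T)"
      using insert.prems by (subst finite_measure_Diff[symmetric]) (auto intro!: sets arg_cong[where f=prob])
    have "prob (?C S T) = prob (?B S T) * e k n" "prob (?C (insert t S) T) = prob (?B (insert t S) T) * e k n"
      using insert.prems by (intro insert.IH; auto)+
    then show ?case unfolding 1 2 by (simp add: algebra_simps)
  qed
  define fst_at where "fst_at k = {\<omega>\<in>space M. (\<forall>i\<in>{}. \<omega> \<in> U i) \<and> (\<forall>i\<in>{m..<k}. \<omega> \<notin> U i) \<and> \<omega> \<in> U k}" for k
  have fs: "fst_at k \<in> events" for k unfolding fst_at_def by measurable
  have fU: "prob (fst_at k \<inter> U n) = prob (fst_at k) * e k n" if "m \<le> k" "k < n" for k n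
  proof -
    have "fst_at k \<inter> U n = {\<omega>\<in>space M. (\<forall>i\<in>{}. \<omega> \<in> U i) \<and> (\<forall>i\<in>{m..<k}. \<omega> \<notin> U i) \<and> \<omega> \<in> U k \<and> \<omega> \<in> U n}"
      unfolding fst_at_def by auto
    then show ?thesis unfolding fst_at_def using that m by (simp only:) (intro neg, auto)
  qed
  have disj: "disjoint_family_on fst_at A" if "A \<subseteq> {m..}" for A
  proof -
    have "fst_at i \<inter> fst_at j = {}" if "i \<in> A" "j \<in> A" "i < j" for i j
      using that \<open>A \<subseteq> {m..}\<close> unfolding fst_at_def by force
    then show ?thesis unfolding disjoint_family_on_def by (metis Int_commute linorder_neqE_nat)
  qed
  have sub: "\<exists>k\<in>{m..n}. \<omega> \<in> fst_at k" if "\<omega> \<in> U n" "m \<le> n" for \<omega> n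
  proof -
    define k where "k = (LEAST i. m \<le> i \<and> \<omega> \<in> U i)"
    have 1: "m \<le> k \<and> \<omega> \<in> U k" unfolding k_def by (rule LeastI[of _ n]) (use that in auto)
    have 2: "k \<le> n" unfolding k_def by (rule Least_le) (use that in auto)
    have 3: "\<omega> \<notin> U i" if "i \<in> {m..<k}" for i
      using that not_less_Least[of i "\<lambda>i. m \<le> i \<and> \<omega> \<in> U i"] unfolding k_def by auto
    have "\<omega> \<in> space M" using that U sets.sets_into_space by blast
    with 1 3 have "\<omega> \<in> fst_at k" unfolding fst_at_def by blast
    with 1 2 show ?thesis by (intro bexI[of _ k]) auto
  qed
  define p where "p = prob (\<Union>i\<in>{m..}. U i)"
  define S where "S N = (\<Sum>n\<in>{1..N}. prob (U n))" for N
  have key: "(1 - p) * S N \<le> real m + 1" for N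
  proof -
    have "(\<Sum>n\<in>{m..N}. prob (U n)) = (\<Sum>n\<in>{m..N}. \<Sum>k\<in>{m..n}. prob (fst_at k \<inter> U n))"
    proof (intro sum.cong refl)
      fix n assume n: "n \<in> {m..N}"
      have "prob (U n) = prob (\<Union>k\<in>{m..n}. fst_at k \<inter> U n)"
        using sub[of _ n] n by (intro arg_cong[where f=prob]) auto
      also have "\<dots> = (\<Sum>k\<in>{m..n}. prob (fst_at k \<inter> U n))"
        using fs disj[of "{m..n}"] by (intro finite_measure_finite_Union) (auto simp: disjoint_family_on_def)
      finally show "prob (U n) = (\<Sum>k\<in>{m..n}. prob (fst_at k \<inter> U n))" .
    qed
    also have "\<dots> = (\<Sum>k\<in>{m..N}. \<Sum>n\<in>{k..N}. prob (fst_at k \<inter> U n))"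
    proof -
      have "(\<Sum>n\<in>{m..N}. \<Sum>k\<in>{m..n}. prob (fst_at k \<inter> U n)) = (\<Sum>n\<in>{m..N}. \<Sum>k | k \<in> {m..N} \<and> k \<le> n. prob (fst_at k \<inter> U n))"
        by (intro sum.cong) auto
      also have "\<dots> = (\<Sum>k\<in>{m..N}. \<Sum>n | n \<in> {m..N} \<and> k \<le> n. prob (fst_at k \<inter> U n))"
        by (intro sum.swap_restrict) auto
      also have "\<dots> = (\<Sum>k\<in>{m..N}. \<Sum>n\<in>{k..N}. prob (fst_at k \<inter> U n))"
        by (intro sum.cong) auto
      finally show ?thesis .
    qed
    \<comment> \<open>In \<open>1 + S N\<close> the 1 bounds the term \<open>n = k\<close>, and
      \<open>S N\<close> bounds the sum of \<open>prob (U (n - k))\<close> over the later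
      \<open>n\<close>.\<close>
    also have "\<dots> \<le> (\<Sum>k\<in>{m..N}. prob (fst_at k) * (1 + S N))"
    proof (intro sum_mono)
      fix k assume k: "k \<in> {m..N}"
      have "(\<Sum>n\<in>{k..N}. prob (fst_at k \<inter> U n)) = prob (fst_at k \<inter> U k) + (\<Sum>n\<in>{Suc k..N}. prob (fst_at k \<inter> U n))"
        using k by (simp add: sum.atLeast_Suc_atMost)
      also have "\<dots> \<le> prob (fst_at k) + (\<Sum>n\<in>{Suc k..N}. prob (fst_at k) * prob (U (n - k)))"
      proof (intro add_mono sum_mono)
        show "prob (fst_at k \<inter> U k) \<le> prob (fst_at k)" using fs by (intro finite_measure_mono) auto
        fix n assume "n \<in> {Suc k..N}"
        then show "prob (fst_at k \<inter> U n) \<le> prob (fst_at k) * prob (U (n - k))"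
          using k m by (subst fU) (auto intro!: mult_left_mono e)
      qed
      also have "(\<Sum>n\<in>{Suc k..N}. prob (fst_at k) * prob (U (n - k))) = prob (fst_at k) * (\<Sum>j\<in>{1..N-k}. prob (U j))"
        unfolding sum_distrib_left
        by (rule sum.reindex_bij_witness[of _ "\<lambda>j. j + k" "\<lambda>n. n - k"]) auto
      also have "prob (fst_at k) * (\<Sum>j\<in>{1..N-k}. prob (U j)) \<le> prob (fst_at k) * S N"
        unfolding S_def by (intro mult_left_mono sum_mono2) auto
      finally show "(\<Sum>n\<in>{k..N}. prob (fst_at k \<inter> U n)) \<le> prob (fst_at k) * (1 + S N)"
        by (simp add: algebra_simps)
    qed
    also have "\<dots> = prob (\<Union>k\<in>{m..N}. fst_at k) * (1 + S N)"
      unfolding sum_distrib_right[symmetric] using fs disj[of "{m..N}"]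
      by (subst finite_measure_finite_Union) auto
    also have "\<dots> \<le> p * (1 + S N)"
    proof (rule mult_right_mono)
      show "prob (\<Union>k\<in>{m..N}. fst_at k) \<le> p"
        unfolding p_def by (intro finite_measure_mono) (auto simp: fst_at_def)
      show "0 \<le> 1 + S N" unfolding S_def by (simp add: sum_nonneg add_nonneg_nonneg)
    qed
    finally have 1: "(\<Sum>n\<in>{m..N}. prob (U n)) \<le> p * (1 + S N)" .
    have "S N \<le> (\<Sum>n\<in>{1..<m} \<union> {m..N}. prob (U n))" unfolding S_def by (intro sum_mono2) auto
    also have "\<dots> = (\<Sum>n\<in>{1..<m}. prob (U n)) + (\<Sum>n\<in>{m..N}. prob (U n))" by (intro sum.union_disjoint) auto
    also have "(\<Sum>n\<in>{1..<m}. prob (U n)) \<le> real (card {1..<m}) * 1" by (intro sum_bounded_above) auto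
    finally have "S N \<le> real m + (\<Sum>n\<in>{m..N}. prob (U n))" by simp
    with 1 have "S N \<le> real m + p * (1 + S N)" by simp
    moreover have "p \<le> 1" by (simp add: p_def)
    ultimately show ?thesis by (simp add: algebra_simps)
  qed
  have "p = 1"
  proof (rule ccontr)
    assume "p \<noteq> 1"
    then have p: "1 - p > 0" using prob_le_1[of "\<Union>i\<in>{m..}. U i"] by (simp add: p_def less_le)
    have "(\<Sum>i<n. prob (U i)) \<le> 1 + (real m + 1) / (1 - p)" for n
    proof -
      have "(\<Sum>i<n. prob (U i)) \<le> (\<Sum>i\<in>{0} \<union> {1..n}. prob (U i))" by (intro sum_mono2) auto
      also have "\<dots> = prob (U 0) + S n" unfolding S_def by (subst sum.union_disjoint) auto
      also have "prob (U 0) \<le> 1" by simp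
      also have "S n \<le> (real m + 1) / (1 - p)" using key[of n] p by (simp add: field_simps)
      finally show ?thesis by simp
    qed
    then have "summable (\<lambda>n. prob (U n))" by (intro summableI_nonneg_bounded) auto
    with div show False by blast
  qed
  then have "AE \<omega> in M. \<omega> \<in> (\<Union>i\<in>{m..}. U i)"
    unfolding p_def by (subst (asm) prob_eq_1) auto
  then show ?thesis by (rule AE_mp) auto
qed

end

section \<open>Positions and exponential jumps: uncovered points and their probabilities\<close>

definition void :: "'a measure \<Rightarrow> (nat \<Rightarrow> 'a \<Rightarrow> real) \<Rightarrow> (nat \<Rightarrow> 'a \<Rightarrow> real) \<Rightarrow> (real \<times> real) set \<Rightarrow> 'a set" where
  "void M X Y C = {\<omega>\<in>space M. \<forall>n. (X n \<omega>, Y (Suc n) \<omega>) \<notin> C}"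

text \<open>The marked points of \<open>(a, b]\<close> that jump past \<open>b\<close>. For
  \<open>a = 0\<close> their absence says that no frog of the process covers \<open>b\<close>; a
  general \<open>a\<close> appears once \<open>a\<close> itself is known to be uncovered, so that
  only the frogs after \<open>a\<close> count.\<close>

definition shadow :: "real \<Rightarrow> real \<Rightarrow> (real \<times> real) set" where
  "shadow a b = {(z, y). a < z \<and> z \<le> b \<and> b - z < y}"

lemma shadow_sets [measurable]: "shadow a b \<in> sets (borel \<Otimes>\<^sub>M borel)"
proof -
  have "{p \<in> space (borel \<Otimes>\<^sub>M borel). a < fst p \<and> fst p \<le> b \<and> b - fst p < (snd p :: real)} \<in> sets (borel \<Otimes>\<^sub>M borel)"
    by measurable
  also have "{p \<in> space (borel \<Otimes>\<^sub>M borel). a < fst p \<and> fst p \<le> b \<and> b - fst p < (snd p :: real)} = shadow a b"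
    by (auto simp: shadow_def space_pair_measure)
  finally show ?thesis .
qed

text \<open>The model after the reduction: \<open>c\<close> stands for \<open>2 * lam\<close> and
  \<open>Y i\<close> for the supremum of the displacement of frog \<open>i\<close>. The jump
  \<open>Y 0\<close> of the initial frog belongs to no point of the process and stays outside all
  void events.\<close>

locale marked_frogs = prob_space M for M :: "'a measure" +
  fixes g :: "real \<Rightarrow> real" and X Y :: "nat \<Rightarrow> 'a \<Rightarrow> real" and c :: real
  assumes c: "c > 0"
    and g_mono: "mono g" and g_nonneg: "\<And>x. g x \<ge> 0" and g_neg: "\<And>x. x < 0 \<Longrightarrow> g x = 0" and g_pos: "\<exists>x\<ge>0. g x > 0"
    and pp: "poisson_point_process M g X"
    and XY: "indep_var (Pi\<^sub>M UNIV (\<lambda>_. borel)) (\<lambda>\<omega> n. X n \<omega>) (Pi\<^sub>M UNIV (\<lambda>_. borel)) (\<lambda>\<omega> n. Y n \<omega>)"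
    and Y_indep: "indep_vars (\<lambda>_. borel) Y UNIV"
    and Y_distr: "\<And>i. distr M borel (Y i) = density lborel (exponential_density c)"
begin

definition \<nu> :: "real measure" where "\<nu> = density lborel (exponential_density c)"
definition \<mu> :: "real measure" where "\<mu> = density lborel g"
text \<open>The mean number of marked points in \<open>C\<close>. Since \<open>measure\<close>
  returns 0 on sets of infinite measure, its properties are stated over bounded windows only, where
  the mean is finite.\<close>

definition intensity :: "(real \<times> real) set \<Rightarrow> real" where "intensity C = measure (\<mu> \<Otimes>\<^sub>M \<nu>) C"

lemma g_measurable [measurable]: "g \<in> borel_measurable borel"
  using g_mono by (rule borel_measurable_mono)

lemma Y_measurable [measurable]: "Y n \<in> borel_measurable M"
  using Y_indep by (simp add: indep_vars_def)

lemma prob_space_\<nu>: "prob_space \<nu>"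
  using prob_space_distr[OF Y_measurable[of 0]] by (simp add: Y_distr \<nu>_def)

lemma sets_\<nu> [measurable_cong, simp]: "sets \<nu> = sets borel" and space_\<nu> [simp]: "space \<nu> = UNIV"
  by (simp_all add: \<nu>_def)

lemma sets_\<mu> [measurable_cong, simp]: "sets \<mu> = sets borel" and space_\<mu> [simp]: "space \<mu> = UNIV"
  by (simp_all add: \<mu>_def)

lemma sigma_finite_\<mu>: "sigma_finite_measure \<mu>"
  unfolding \<mu>_def by (subst sigma_finite_measure.sigma_finite_iff_density_finite[OF sigma_finite_lborel]) auto

lemma g_int: "B \<in> sets borel \<Longrightarrow> bounded B \<Longrightarrow> set_integrable lborel B g"
proof -
  assume B[measurable]: "B \<in> sets borel" and "bounded B"
  then obtain b where b: "\<And>x. x \<in> B \<Longrightarrow> \<bar>x\<bar> \<le> b" by (auto simp: bounded_iff)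
  have "set_integrable lborel B (\<lambda>_. g b)"
    unfolding set_integrable_def using emeasure_bounded_finite[OF \<open>bounded B\<close>] by (simp add: less_top)
  then show ?thesis
  proof (rule set_integrable_bound)
    show "set_borel_measurable lborel B g" unfolding set_borel_measurable_def by measurable
    show "AE x in lborel. x \<in> B \<longrightarrow> norm (g x) \<le> norm (g b)"
    proof (intro AE_I2 impI)
      fix x assume "x \<in> B"
      then have "x \<le> b" using b[of x] by linarith
      then show "norm (g x) \<le> norm (g b)" using g_nonneg monoD[OF g_mono] by simp
    qed
  qed
qed

lemma \<mu>_finite: "B \<in> sets borel \<Longrightarrow> bounded B \<Longrightarrow> emeasure \<mu> B = ennreal (\<integral>x\<in>B. g x \<partial>lborel)"
  unfolding \<mu>_def set_lebesgue_integral_def using g_int[of B] g_nonneg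
  by (simp add: emeasure_density set_integrable_def nn_integral_eq_integral[symmetric] ennreal_mult indicator_def)
    (auto intro!: nn_integral_cong)

lemma prob_Y_gt: "a \<ge> 0 \<Longrightarrow> prob {\<omega>\<in>space M. Y i \<omega> > a} = exp (- c * a)"
proof -
  assume a: "a \<ge> 0"
  have "distributed M lborel (Y i) (exponential_density c)"
    unfolding distributed_def using Y_distr[of i] by (simp add: measurable_lborel1 distr_cong[OF refl sets_lborel])
  from exponential_distributedD_gt[OF this a c] show ?thesis by (simp add: mult.commute)
qed

lemma \<nu>_gt: "a \<ge> 0 \<Longrightarrow> measure \<nu> {y. y > a} = exp (- c * a)"
  using prob_Y_gt[of a 0] unfolding \<nu>_def Y_distr[of 0, symmetric]
  by (subst measure_distr) (auto simp: vimage_def Int_def conj_commute)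

lemma void_props:
  assumes C: "C \<in> sets (borel \<Otimes>\<^sub>M borel)" and CB: "C \<subseteq> {a..b} \<times> UNIV"
  shows void_sets: "void M X Y C \<in> events"
    and void_prob: "prob (void M X Y C) = exp (- intensity C)"
    and void_prob_Y: "A \<in> sets borel \<Longrightarrow> prob {\<omega>\<in>void M X Y C. Y 0 \<omega> \<in> A} = prob {\<omega>\<in>space M. Y 0 \<omega> \<in> A} * exp (- intensity C)"
    and intensity_finite: "emeasure (\<mu> \<Otimes>\<^sub>M \<nu>) C = ennreal (intensity C)"
    and intensity_eq: "intensity C = (\<integral>x\<in>{a..b}. measure \<nu> (Pair x -` C) * g x \<partial>lborel)"
proof -
  have nu: "distr M borel (Y i) = \<nu>" for i by (simp add: Y_distr \<nu>_def)
  note mv = marked_void[OF XY Y_indep nu pp g_measurable g_nonneg C _ _ _ g_int CB, folded \<mu>_def intensity_def]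
  have "void M X Y C = {\<omega>\<in>space M. Y 0 \<omega> \<in> UNIV \<and> (\<forall>n. (X n \<omega>, Y (Suc n) \<omega>) \<notin> C)}"
    by (auto simp: void_def)
  then show "void M X Y C \<in> events" "prob (void M X Y C) = exp (- intensity C)"
    using mv[of UNIV] by (auto simp: prob_space intensity_def)
  { assume A: "A \<in> sets borel"
    have "{\<omega>\<in>void M X Y C. Y 0 \<omega> \<in> A} = {\<omega>\<in>space M. Y 0 \<omega> \<in> A \<and> (\<forall>n. (X n \<omega>, Y (Suc n) \<omega>) \<notin> C)}"
      by (auto simp: void_def)
    then show "prob {\<omega>\<in>void M X Y C. Y 0 \<omega> \<in> A} = prob {\<omega>\<in>space M. Y 0 \<omega> \<in> A} * exp (- intensity C)"
      using mv[of A] A by (auto simp: intensity_def) }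
  have em: "emeasure (\<mu> \<Otimes>\<^sub>M \<nu>) C = ennreal (\<integral>x\<in>{a..b}. measure \<nu> (Pair x -` C) * g x \<partial>lborel)"
    unfolding \<mu>_def by (rule set_integral_eq_measure_pair[OF prob_space_\<nu> sets_\<nu> g_measurable g_nonneg C _ g_int CB]) auto
  show "intensity C = (\<integral>x\<in>{a..b}. measure \<nu> (Pair x -` C) * g x \<partial>lborel)"
    unfolding intensity_def measure_def[of "\<mu> \<Otimes>\<^sub>M \<nu>"] em using g_nonneg
    by (subst enn2real_ennreal) (auto simp: set_lebesgue_integral_def intro!: Bochner_Integration.integral_nonneg)
  then show "emeasure (\<mu> \<Otimes>\<^sub>M \<nu>) C = ennreal (intensity C)" using em by simp
qed

lemma intensity_nonneg: "intensity C \<ge> 0" by (simp add: intensity_def)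

lemma intensity_Un:
  assumes "C \<in> sets (borel \<Otimes>\<^sub>M borel)" "D \<in> sets (borel \<Otimes>\<^sub>M borel)" "C \<subseteq> {a..b} \<times> UNIV" "D \<subseteq> {a..b} \<times> UNIV" "C \<inter> D = {}"
  shows "intensity (C \<union> D) = intensity C + intensity D"
proof -
  have "sets (\<mu> \<Otimes>\<^sub>M \<nu>) = sets (borel \<Otimes>\<^sub>M borel)" by (intro sets_pair_measure_cong) auto
  then have "emeasure (\<mu> \<Otimes>\<^sub>M \<nu>) (C \<union> D) = emeasure (\<mu> \<Otimes>\<^sub>M \<nu>) C + emeasure (\<mu> \<Otimes>\<^sub>M \<nu>) D"
    using assms by (intro plus_emeasure[symmetric]) auto
  then have "ennreal (intensity (C \<union> D)) = ennreal (intensity C) + ennreal (intensity D)"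
    using assms intensity_finite[of C a b] intensity_finite[of D a b] intensity_finite[of "C \<union> D" a b] by simp
  then show ?thesis
    by (simp add: ennreal_plus[symmetric] intensity_nonneg del: ennreal_plus)
qed

lemma shadow_window: "shadow a b \<subseteq> {a..b} \<times> UNIV"
  by (auto simp: shadow_def)

lemma intensity_shadow: "intensity (shadow a b) = (\<integral>x\<in>{a<..b}. exp (- c * (b - x)) * g x \<partial>lborel)"
proof -
  have "intensity (shadow a b) = (\<integral>x\<in>{a..b}. measure \<nu> (Pair x -` shadow a b) * g x \<partial>lborel)"
    by (rule intensity_eq[OF shadow_sets shadow_window])
  also have "\<dots> = (\<integral>x\<in>{a<..b}. exp (- c * (b - x)) * g x \<partial>lborel)"
    unfolding set_lebesgue_integral_def
  proof (intro Bochner_Integration.integral_cong refl)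
    fix x
    show "indicator {a..b} x *\<^sub>R (measure \<nu> (Pair x -` shadow a b) * g x) = indicator {a<..b} x *\<^sub>R (exp (- c * (b - x)) * g x)"
    proof (cases "a < x \<and> x \<le> b")
      case True
      then have "Pair x -` shadow a b = {y. y > b - x}" by (auto simp: shadow_def)
      then show ?thesis using True \<nu>_gt[of "b - x"] by (simp add: indicator_def)
    next
      case False
      then have "Pair x -` shadow a b = {}" by (auto simp: shadow_def)
      then show ?thesis using False by (auto simp: indicator_def)
    qed
  qed
  finally show ?thesis .
qed

lemma exp_primitive:
  assumes "a \<le> b"
  shows "(\<integral>x\<in>{a..b}. exp (- c * (d - x)) \<partial>lborel) = (exp (- c * (d - b)) - exp (- c * (d - a))) / c"
    and "set_integrable lborel {a..b} (\<lambda>x. exp (- c * (d - x)))"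
proof -
  have co: "continuous_on {a..b} (\<lambda>x. exp (- c * (d - x)))" by (intro continuous_intros)
  have "(\<integral>x. exp (- c * (d - x)) * indicator {a..b} x \<partial>lborel) = exp (- c * (d - b)) / c - exp (- c * (d - a)) / c"
    by (rule integral_FTC_Icc_real) (use assms c in \<open>auto intro!: derivative_eq_intros continuous_intros\<close>)
  then show "(\<integral>x\<in>{a..b}. exp (- c * (d - x)) \<partial>lborel) = (exp (- c * (d - b)) - exp (- c * (d - a))) / c"
    by (simp add: set_lebesgue_integral_def mult.commute diff_divide_distrib)
  show "set_integrable lborel {a..b} (\<lambda>x. exp (- c * (d - x)))"
    by (rule borel_integrable_atLeastAtMost'[OF co])
qed

lemma exp_g_integrable: "B \<in> sets borel \<Longrightarrow> bounded B \<Longrightarrow> (\<And>x. x \<in> B \<Longrightarrow> x \<le> d) \<Longrightarrow> set_integrable lborel B (\<lambda>x. exp (- c * (d - x)) * g x)"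
proof (rule set_integrable_bound[OF g_int])
  assume [measurable]: "B \<in> sets borel"
  show "set_borel_measurable lborel B (\<lambda>x. exp (- c * (d - x)) * g x)" unfolding set_borel_measurable_def by measurable
  assume d: "\<And>x. x \<in> B \<Longrightarrow> x \<le> d"
  show "AE x in lborel. x \<in> B \<longrightarrow> norm (exp (- c * (d - x)) * g x) \<le> norm (g x)"
    using d g_nonneg c by (intro AE_I2) (auto simp: abs_mult intro!: mult_left_le_one_le mult_nonneg_nonneg)
qed

text \<open>Up to \<open>b\<close> the intensity is at most \<open>g b\<close>, and the kernel
  \<open>exp (- c * (b - x))\<close> has total mass at most \<open>1 / c\<close>.\<close>

lemma intensity_shadow_le:
  assumes "a \<le> b"
  shows "intensity (shadow a b) \<le> g b / c"
proof -
  have "intensity (shadow a b) \<le> (\<integral>x\<in>{a<..b}. exp (- c * (b - x)) * g b \<partial>lborel)"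
    unfolding intensity_shadow
  proof (rule set_integral_mono)
    show "set_integrable lborel {a<..b} (\<lambda>x. exp (- c * (b - x)) * g b)"
      by (intro set_integrable_mult_left set_integrable_subset[OF exp_primitive(2)[OF assms]]) auto
    show "set_integrable lborel {a<..b} (\<lambda>x. exp (- c * (b - x)) * g x)"
      by (rule exp_g_integrable) (auto intro!: bounded_subset[OF bounded_closed_interval[of a b]])
  qed (auto intro!: mult_left_mono monoD[OF g_mono])
  also have "\<dots> \<le> (\<integral>x\<in>{a..b}. exp (- c * (b - x)) * g b \<partial>lborel)"
  proof -
    have i: "set_integrable lborel {a..b} (\<lambda>x. exp (- c * (b - x)) * g b)"
      by (intro set_integrable_mult_left exp_primitive(2)[OF assms])
    have "set_integrable lborel {a<..b} (\<lambda>x. exp (- c * (b - x)) * g b)"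
      by (rule set_integrable_subset[OF i]) auto
    then show ?thesis using i g_nonneg unfolding set_lebesgue_integral_def set_integrable_def
      by (intro integral_mono) (auto simp: indicator_def)
  qed
  also have "\<dots> = (1 - exp (- c * (b - a))) / c * g b"
    using exp_primitive(1)[OF assms, of b] by simp
  also have "\<dots> \<le> 1 / c * g b" using c g_nonneg by (intro mult_right_mono divide_right_mono) auto
  finally show ?thesis by simp
qed

lemma \<mu>_shift:
  assumes A[measurable]: "A \<in> sets borel" and s: "s \<ge> 0"
  shows "emeasure \<mu> A \<le> emeasure \<mu> ((\<lambda>z. z + s) ` A)"
proof -
  have im: "(\<lambda>z. z + s) ` A = (\<lambda>z. z - s) -` A" by (auto simp: image_iff intro!: bexI[of _ "_ - s"])
  have [measurable]: "(\<lambda>z. z - s) -` A \<in> sets borel"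
    using measurable_sets[of "\<lambda>z. z - s" borel borel A] by simp
  have "emeasure \<mu> A = (\<integral>\<^sup>+x. ennreal (g x) * indicator A x \<partial>lborel)" by (simp add: \<mu>_def emeasure_density)
  also have "\<dots> \<le> (\<integral>\<^sup>+x. ennreal (g (s + x)) * indicator A x \<partial>lborel)"
    using s by (intro nn_integral_mono mult_right_mono ennreal_leI monoD[OF g_mono]) auto
  also have "\<dots> = (\<integral>\<^sup>+x. ennreal (g x) * indicator ((\<lambda>z. z - s) -` A) x \<partial>distr lborel borel ((+) s))"
    by (subst nn_integral_distr) (auto simp: indicator_def intro!: nn_integral_cong)
  also have "\<dots> = emeasure \<mu> ((\<lambda>z. z + s) ` A)"
    unfolding im by (simp add: lborel_distr_plus \<mu>_def emeasure_density)
  finally show ?thesis .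
qed

text \<open>Fubini in the other order: for a fixed mark \<open>y\<close>, the part of \<open>(a', b']\<close> whose frogs jump past \<open>b'\<close>,
  shifted right by \<open>b - b'\<close>, gains mass because \<open>g\<close> is non-decreasing.\<close>

lemma intensity_shadow_shift:
  assumes b: "b' \<le> b" and eq: "emeasure \<mu> {a<..b} = emeasure \<mu> {a'<..b'}"
  shows "intensity (shadow a' b') \<le> intensity (shadow a b)"
proof -
  interpret \<nu>: prob_space \<nu> by (rule prob_space_\<nu>)
  interpret \<mu>: sigma_finite_measure \<mu> by (rule sigma_finite_\<mu>)
  interpret pair_sigma_finite \<mu> \<nu> ..
  have S: "shadow p q \<in> sets (\<mu> \<Otimes>\<^sub>M \<nu>)" for p q
    using shadow_sets[of p q] by (simp cong: sets_pair_measure_cong)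
  define J where "J p q y = (\<lambda>x. (x, y)) -` shadow p q" for p q y
  have J: "J p q y = {z. p < z \<and> z \<le> q \<and> q - z < y}" for p q y by (auto simp: J_def shadow_def)
  have Jm: "J p q y \<in> sets borel" for p q y unfolding J by measurable
  \<comment> \<open>If every point of \<open>(a, b]\<close> reaches past \<open>b\<close> with mark
    \<open>y\<close>, equality of the total masses is enough. Otherwise some \<open>z0 > a\<close>
    fails to do so; a point that does is then further right than \<open>z0\<close>, so the shifted
    points cannot fall to the left of \<open>a\<close>.\<close>
  have "emeasure \<mu> (J a' b' y) \<le> emeasure \<mu> (J a b y)" for y
  proof (cases "J a b y = {a<..b}")
    case True
    have "emeasure \<mu> (J a' b' y) \<le> emeasure \<mu> {a'<..b'}" by (intro emeasure_mono) (auto simp: J)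
    then show ?thesis using eq True by simp
  next
    case False
    then have "\<exists>z0. a < z0 \<and> z0 \<le> b \<and> \<not> b - z0 < y" unfolding J by auto
    then obtain z0 where z0: "a < z0" "z0 \<le> b" "y \<le> b - z0" by (auto simp: not_less)
    have "(\<lambda>z. z + (b - b')) ` J a' b' y \<subseteq> J a b y" using z0 by (auto simp: J)
    then have "emeasure \<mu> ((\<lambda>z. z + (b - b')) ` J a' b' y) \<le> emeasure \<mu> (J a b y)"
      using Jm by (intro emeasure_mono) auto
    with \<mu>_shift[OF Jm, of "b - b'" a' b' y] b show ?thesis by (auto intro: order_trans)
  qed
  then have "emeasure (\<mu> \<Otimes>\<^sub>M \<nu>) (shadow a' b') \<le> emeasure (\<mu> \<Otimes>\<^sub>M \<nu>) (shadow a b)"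
    unfolding emeasure_pair_measure_alt2[OF S] J_def[symmetric] by (intro nn_integral_mono)
  then show ?thesis
    using intensity_finite[OF shadow_sets shadow_window] intensity_nonneg by (simp add: ennreal_le_iff)
qed

end

section \<open>Levels of equal mass and the divergent case\<close>

context marked_frogs begin

lemma \<mu>_singleton: "emeasure \<mu> {a} = 0"
  unfolding \<mu>_def by (subst emeasure_density) (auto intro!: nn_integral_null_set)

lemma bounded_Ioc: "bounded {a<..b::real}"
  by (rule bounded_subset[OF bounded_closed_interval[of a b]]) auto

lemma \<mu>_Icc: "a \<le> b \<Longrightarrow> emeasure \<mu> {a..b} = emeasure \<mu> {a<..b}"
proof -
  assume "a \<le> b"
  then have "{a..b} = {a} \<union> {a<..b}" by auto
  then have "emeasure \<mu> {a..b} = emeasure \<mu> {a} + emeasure \<mu> {a<..b}"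
    by (simp only:) (rule plus_emeasure[symmetric], auto)
  then show ?thesis by (simp add: \<mu>_singleton)
qed

lemma \<mu>_Icc_integral:
  assumes "a \<le> b"
  shows "emeasure \<mu> {a<..b} = ennreal (integral {a..b} g)" and "g integrable_on {a..b}"
proof -
  have "set_integrable lborel {a..b} g" by (rule g_int) auto
  from set_borel_integral_eq_integral[OF this] \<mu>_finite[of "{a..b}"] \<mu>_Icc[OF assms]
  show "emeasure \<mu> {a<..b} = ennreal (integral {a..b} g)" "g integrable_on {a..b}" by auto
qed

lemma \<mu>_ge: "a \<le> b \<Longrightarrow> ennreal (g a * (b - a)) \<le> emeasure \<mu> {a<..b}"
proof -
  assume ab: "a \<le> b"
  have "ennreal (g a * (b - a)) = (\<integral>\<^sup>+x. ennreal (g a) * indicator {a<..b} x \<partial>lborel)"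
    using ab g_nonneg by (simp add: nn_integral_cmult ennreal_mult)
  also have "\<dots> \<le> (\<integral>\<^sup>+x. ennreal (g x) * indicator {a<..b} x \<partial>lborel)"
    by (intro nn_integral_mono) (auto simp: indicator_def intro!: ennreal_leI monoD[OF g_mono])
  also have "\<dots> = emeasure \<mu> {a<..b}" by (simp add: \<mu>_def emeasure_density)
  finally show ?thesis .
qed

lemma level_exists: "\<exists>x\<ge>0. emeasure \<mu> {0<..x} = ennreal (real n)"
proof -
  obtain t where t: "t \<ge> 0" "g t > 0" using g_pos by blast
  define b where "b = t + real n / g t"
  have b: "b \<ge> t" using t by (simp add: b_def)
  have "ennreal (real n) = ennreal (g t * (b - t))" using t by (simp add: b_def)
  also have "\<dots> \<le> emeasure \<mu> {t<..b}" by (rule \<mu>_ge[OF b])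
  also have "\<dots> \<le> emeasure \<mu> {0<..b}" using t by (intro emeasure_mono) auto
  also have "\<dots> = ennreal (integral {0..b} g)" using b t by (intro \<mu>_Icc_integral) auto
  finally have le: "real n \<le> integral {0..b} g"
    using g_nonneg by (subst (asm) ennreal_le_iff) (auto intro!: Henstock_Kurzweil_Integration.integral_nonneg \<mu>_Icc_integral b t order_trans[OF t(1) b])
  have "continuous_on {0..b} (\<lambda>x. integral {0..x} g)"
    by (intro indefinite_integral_continuous_1 \<mu>_Icc_integral order_trans[OF t(1) b])
  then obtain x where "0 \<le> x" "x \<le> b" "integral {0..x} g = real n"
    using IVT'[of "\<lambda>x. integral {0..x} g" 0 "real n" b] le b t by auto
  then show ?thesis using \<mu>_Icc_integral(1)[of 0 x] by auto
qed

text \<open>These are the points \<open>x_n\<close> of the overview. The windows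
  \<open>(level k, level n]\<close> and \<open>(0, level (n - k)]\<close> have the same mass, as the
  shift comparison of shadows requires. Level 0 is fixed separately: \<open>g\<close> may vanish on
  an initial interval, and then any point of it has mass 0 to its left.\<close>

definition level :: "nat \<Rightarrow> real" where
  "level n = (if n = 0 then 0 else (SOME x. x \<ge> 0 \<and> emeasure \<mu> {0<..x} = ennreal (real n)))"

lemma level_0: "level 0 = 0" by (simp add: level_def)

lemma level_nonneg: "level n \<ge> 0" and level_mass: "emeasure \<mu> {0<..level n} = ennreal (real n)"
  using someI_ex[OF level_exists[of n]] by (auto simp: level_def)

lemma level_less: "k < n \<Longrightarrow> level k < level n"
proof (rule ccontr)
  assume kn: "k < n" and "\<not> level k < level n"
  then have "emeasure \<mu> {0<..level n} \<le> emeasure \<mu> {0<..level k}" by (intro emeasure_mono) auto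
  then show False using kn by (simp add: level_mass)
qed

lemma level_le: "k \<le> n \<Longrightarrow> level k \<le> level n"
  using level_less[of k n] by (cases "k = n") auto

lemma level_between: "k \<le> n \<Longrightarrow> emeasure \<mu> {level k<..level n} = ennreal (real (n - k))"
proof -
  assume kn: "k \<le> n"
  obtain r where r: "r \<ge> 0" "emeasure \<mu> {level k<..level n} = ennreal r"
    using \<mu>_finite[OF _ bounded_Ioc, of "level k" "level n"] by (metis ennreal_cases ennreal_neq_top greaterThanAtMost_borel)
  have "{0<..level n} = {0<..level k} \<union> {level k<..level n}"
    using level_le[OF kn] level_nonneg[of k] by auto
  then have "emeasure \<mu> {0<..level n} = emeasure \<mu> {0<..level k} + emeasure \<mu> {level k<..level n}"
    by (simp only:) (rule plus_emeasure[symmetric], auto)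
  then have "ennreal (real n) = ennreal (real k + r)" unfolding level_mass r using r by simp
  then have "real n = real k + r" using r by (subst (asm) ennreal_inj) auto
  then have "r = real (n - k)" using kn by (simp add: of_nat_diff)
  then show ?thesis using r by simp
qed

lemma level_unbounded: "\<exists>n. level n > t"
proof -
  obtain r where r: "r \<ge> 0" "emeasure \<mu> {0<..t} = ennreal r"
    using \<mu>_finite[OF _ bounded_Ioc, of 0 t] by (metis ennreal_cases ennreal_neq_top greaterThanAtMost_borel)
  obtain n where n: "real n > r" using reals_Archimedean2 by blast
  have "level n > t"
  proof (rule ccontr)
    assume "\<not> level n > t"
    then have "emeasure \<mu> {0<..level n} \<le> emeasure \<mu> {0<..t}" by (intro emeasure_mono) auto
    then show False using n r by (simp add: level_mass)
  qed
  then show ?thesis by blast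
qed

text \<open>Between consecutive levels the \<open>g\<close>-mass is 1 and the factor
  \<open>exp (- g t / c)\<close> is largest at the left end, so the integral is at most the sum of
  \<open>exp (- g (level n) / c)\<close>. Each of these terms is at most the void probability at
  that level.\<close>

lemma level_divergence:
  assumes inf: "(\<integral>\<^sup>+t\<in>{0..}. ennreal (exp (- g t / c) * g t) \<partial>lborel) = \<infinity>"
  shows "\<not> summable (\<lambda>n. exp (- intensity (shadow 0 (level n))))"
proof
  assume s: "summable (\<lambda>n. exp (- intensity (shadow 0 (level n))))"
  have s': "summable (\<lambda>n. exp (- g (level n) / c))"
  proof (rule summable_comparison_test'[OF s, of 0])
    fix n
    show "norm (exp (- g (level n) / c)) \<le> exp (- intensity (shadow 0 (level n)))"
      using intensity_shadow_le[of 0 "level n"] level_nonneg by simp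
  qed
  define N where "N = density lborel (\<lambda>t. ennreal (exp (- g t / c) * g t))"
  have setsN[simp]: "sets N = sets borel" by (simp add: N_def)
  have "emeasure N {0<..} \<le> emeasure N (\<Union>n. {level n<..level (Suc n)})"
  proof (intro emeasure_mono subsetI)
    fix t assume t: "t \<in> {0::real<..}"
    define n where "n = (LEAST n. t \<le> level n)"
    obtain n' where "level n' > t" using level_unbounded by blast
    then have 1: "t \<le> level n" unfolding n_def by (rule LeastI[of _ n', OF less_imp_le])
    then have "n \<noteq> 0" using t level_0 by (cases "n = 0") auto
    then obtain k where k: "n = Suc k" by (cases n) auto
    then have "\<not> t \<le> level k" using not_less_Least[of k "\<lambda>n. t \<le> level n"] by (simp add: n_def)
    then have "t \<in> {level k<..level (Suc k)}" using 1 k by auto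
    then show "t \<in> (\<Union>n. {level n<..level (Suc n)})" by blast
  qed auto
  also have "\<dots> \<le> (\<Sum>n. emeasure N {level n<..level (Suc n)})"
    by (rule emeasure_subadditive_countably) auto
  also have "\<dots> \<le> (\<Sum>n. ennreal (exp (- g (level n) / c)))"
  proof (intro suminf_le)
    fix n
    have "emeasure N {level n<..level (Suc n)} = (\<integral>\<^sup>+t. ennreal (exp (- g t / c) * g t) * indicator {level n<..level (Suc n)} t \<partial>lborel)"
      by (simp add: N_def emeasure_density)
    also have "\<dots> \<le> (\<integral>\<^sup>+t. ennreal (exp (- g (level n) / c)) * (ennreal (g t) * indicator {level n<..level (Suc n)} t) \<partial>lborel)"
    proof (intro nn_integral_mono)
      fix t
      show "ennreal (exp (- g t / c) * g t) * indicator {level n<..level (Suc n)} t \<le> ennreal (exp (- g (level n) / c)) * (ennreal (g t) * indicator {level n<..level (Suc n)} t)"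
        using g_nonneg c by (auto simp: indicator_def ennreal_mult[symmetric] intro!: ennreal_leI mult_right_mono divide_right_mono monoD[OF g_mono])
    qed
    also have "\<dots> = ennreal (exp (- g (level n) / c)) * emeasure \<mu> {level n<..level (Suc n)}"
      by (subst nn_integral_cmult) (auto simp: \<mu>_def emeasure_density)
    also have "\<dots> = ennreal (exp (- g (level n) / c))" by (simp add: level_between)
    finally show "emeasure N {level n<..level (Suc n)} \<le> ennreal (exp (- g (level n) / c))" .
  qed auto
  also have "\<dots> < \<infinity>" using s' by (simp add: suminf_ennreal2 less_top[symmetric])
  finally have fin: "emeasure N {0<..} < \<infinity>" .
  have "(\<integral>\<^sup>+t\<in>{0..}. ennreal (exp (- g t / c) * g t) \<partial>lborel) = emeasure N {0<..}"
    unfolding N_def using AE_lborel_singleton[of 0]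
    by (subst emeasure_density) (auto intro!: nn_integral_cong_AE elim!: eventually_mono simp: indicator_def)
  with fin inf show False by simp
qed

lemma X_positive: "AE \<omega> in M. \<forall>n. X n \<omega> > 0"
proof -
  have "AE \<omega> in M. pp_count X {- real k..0} \<omega> = 0" for k :: nat
  proof -
    have cm: "pp_count X {- real k..0} \<in> measurable M (count_space UNIV)"
      by (rule pp_count_measurable[OF pp]) auto
    have z: "(\<integral>x\<in>{- real k..0}. g x \<partial>lborel) = 0"
    proof -
      have "(\<integral>x\<in>{- real k..0}. g x \<partial>lborel) = (\<integral>x. 0 \<partial>(lborel :: real measure))"
        unfolding set_lebesgue_integral_def using AE_lborel_singleton[of 0] g_neg
        by (intro integral_cong_AE) (auto elim!: eventually_mono simp: indicator_def)
      then show ?thesis by simp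
    qed
    have "prob {\<omega>\<in>space M. pp_count X {- real k..0} \<omega> = 0} = 1"
      using pp_count_distr[OF pp, of "{- real k..0}" 0] z by simp
    then show ?thesis using cm by (subst (asm) prob_Collect_eq_1) auto
  qed
  then have "AE \<omega> in M. \<forall>k::nat. pp_count X {- real k..0} \<omega> = 0" by (simp add: AE_all_countable)
  then show ?thesis
  proof (rule AE_mp, intro AE_I2 impI allI)
    fix \<omega> n assume w: "\<omega> \<in> space M" and z: "\<forall>k::nat. pp_count X {- real k..0} \<omega> = 0"
    show "X n \<omega> > 0"
    proof (rule ccontr)
      assume neg: "\<not> X n \<omega> > 0"
      obtain k :: nat where k: "real k > - X n \<omega>" using reals_Archimedean2 by blast
      \<comment> \<open>The cardinality of an infinite set is 0, so a count of 0 excludes points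
        only after finiteness is known; finiteness comes from the divergence of
        \<open>X\<close>.\<close>
      obtain N where N: "\<forall>j\<ge>N. X j \<omega> \<notin> {- real k..0}" using pp_bounded_ev[OF pp w, of "{- real k..0}"] by auto
      have "{j. X j \<omega> \<in> {- real k..0}} \<subseteq> {..<N}" using N by (auto simp: not_le[symmetric])
      then have "finite {j. X j \<omega> \<in> {- real k..0}}" by (rule finite_subset) auto
      moreover have "n \<in> {j. X j \<omega> \<in> {- real k..0}}" using neg k by auto
      ultimately have "pp_count X {- real k..0} \<omega> \<noteq> 0" unfolding pp_count_def by (auto simp: card_eq_0_iff)
      with z show False by simp
    qed
  qed
qed

lemma void_Un: "void M X Y (C \<union> D) = void M X Y C \<inter> void M X Y D"
  by (auto simp: void_def)

text \<open>The number \<open>r\<close> is a barrier: no frog starting at or before it gets beyond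
  it. It is found among the uncovered levels, which occur arbitrarily far out.\<close>

lemma dies_out:
  assumes inf: "(\<integral>\<^sup>+t\<in>{0..}. ennreal (exp (- g t / c) * g t) \<partial>lborel) = \<infinity>"
  shows "AE \<omega> in M. \<exists>r. Y 0 \<omega> \<le> r \<and> 0 \<le> r \<and> (\<forall>n. X n \<omega> \<le> r \<longrightarrow> X n \<omega> + Y (Suc n) \<omega> \<le> r)"
proof -
  define U where "U i = void M X Y (shadow 0 (level i))" for i
  have pU: "prob (U i) = exp (- intensity (shadow 0 (level i)))" for i
    unfolding U_def by (rule void_prob[OF shadow_sets shadow_window])
  have "AE \<omega> in M. \<exists>i\<ge>m. \<omega> \<in> U i" if m: "1 \<le> m" for m
  proof (rule renewal_covers[OF _ _ _ _ m])
    show "U i \<in> events" for i unfolding U_def by (rule void_sets[OF shadow_sets shadow_window])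
    show "\<not> summable (\<lambda>n. prob (U n))" unfolding pU by (rule level_divergence[OF inf])
    show "exp (- intensity (shadow (level k) (level n))) \<le> prob (U (n - k))" if "1 \<le> k" "k < n" for k n
    proof -
      have "intensity (shadow 0 (level (n - k))) \<le> intensity (shadow (level k) (level n))"
        by (rule intensity_shadow_shift) (use that in \<open>auto simp: level_mass level_between intro: level_le\<close>)
      then show ?thesis by (simp add: pU)
    qed
    fix S :: "nat set" and k n
    assume S: "finite S" "S \<subseteq> {1..<k}" and k: "1 \<le> k" "k < n"
    define C where "C = (\<Union>i\<in>S. shadow 0 (level i)) \<union> shadow 0 (level k)"
    define D where "D = shadow (level k) (level n)"
    have Sk: "level i \<le> level k" if "i \<in> S" for i using S that by (intro level_le) auto
    have lkn: "level k \<le> level n" using k by (intro level_le) auto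
    have Ck: "C \<subseteq> {0..level k} \<times> UNIV" unfolding C_def shadow_def using Sk by force
    then have Cn: "C \<subseteq> {0..level n} \<times> UNIV" using lkn by fastforce
    have Cs: "C \<in> sets (borel \<Otimes>\<^sub>M borel)" unfolding C_def using S shadow_sets by blast
    have Ds: "D \<in> sets (borel \<Otimes>\<^sub>M borel)" unfolding D_def by (rule shadow_sets)
    have Dn: "D \<subseteq> {0..level n} \<times> UNIV" using level_nonneg[of k] unfolding D_def shadow_def by auto
    have CD: "C \<inter> D = {}" using Ck unfolding D_def shadow_def by auto
    have vC: "{\<omega>\<in>space M. (\<forall>i\<in>S. \<omega> \<in> U i) \<and> \<omega> \<in> U k} = void M X Y C"
      unfolding U_def C_def void_def by blast
    \<comment> \<open>Regeneration: a frog from before \<open>level k\<close> that passes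
      \<open>level n\<close> also passes \<open>level k\<close>. Once \<open>level k\<close> is
      uncovered, \<open>level n\<close> can therefore be covered only by the frogs in
      \<open>D\<close>, which are disjoint from all points examined so far.\<close>
    have "shadow 0 (level n) \<union> C = C \<union> D"
    proof -
      have "shadow 0 (level n) \<subseteq> shadow 0 (level k) \<union> D"
        using lkn unfolding shadow_def D_def by auto
      moreover have "D \<subseteq> shadow 0 (level n)" using level_nonneg[of k] unfolding shadow_def D_def by auto
      ultimately show ?thesis unfolding C_def by blast
    qed
    then have vCD: "{\<omega>\<in>space M. (\<forall>i\<in>S. \<omega> \<in> U i) \<and> \<omega> \<in> U k \<and> \<omega> \<in> U n} = void M X Y (C \<union> D)"
      using vC void_Un[of "shadow 0 (level n)" C] unfolding U_def by auto
    show "prob {\<omega>\<in>space M. (\<forall>i\<in>S. \<omega> \<in> U i) \<and> \<omega> \<in> U k \<and> \<omega> \<in> U n} =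
       prob {\<omega>\<in>space M. (\<forall>i\<in>S. \<omega> \<in> U i) \<and> \<omega> \<in> U k} * exp (- intensity (shadow (level k) (level n)))"
      unfolding vC vCD D_def[symmetric] using void_prob[OF Cs Cn] void_prob[of "C \<union> D" 0 "level n"] Cs Ds Cn Dn intensity_Un[OF Cs Ds Cn Dn CD]
      by (simp add: mult_exp_exp)
  qed
  then have "AE \<omega> in M. \<forall>m. 1 \<le> m \<longrightarrow> (\<exists>i\<ge>m. \<omega> \<in> U i)" by (simp add: AE_all_countable)
  with X_positive show ?thesis
  proof (eventually_elim)
    fix \<omega> assume pos: "\<forall>n. 0 < X n \<omega>" and U: "\<forall>m. 1 \<le> m \<longrightarrow> (\<exists>i\<ge>m. \<omega> \<in> U i)"
    \<comment> \<open>An uncovered level beyond \<open>level j\<close> also stops the initial frog,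
      whose jump the void events ignore.\<close>
    obtain j where j: "level j > Y 0 \<omega>" using level_unbounded by blast
    have "\<exists>i\<ge>Suc j. \<omega> \<in> U i" using U by simp
    then obtain i where i: "i \<ge> Suc j" "\<omega> \<in> U i" by blast
    have "Y 0 \<omega> \<le> level i" using j i level_le[of j i] by auto
    moreover have "X n \<omega> + Y (Suc n) \<omega> \<le> level i" if "X n \<omega> \<le> level i" for n
      using i(2) pos that unfolding U_def void_def shadow_def by (force simp: not_less)
    ultimately show "\<exists>r. Y 0 \<omega> \<le> r \<and> 0 \<le> r \<and> (\<forall>n. X n \<omega> \<le> r \<longrightarrow> X n \<omega> + Y (Suc n) \<omega> \<le> r)"
      using level_nonneg by blast
  qed
qed

end

section \<open>Convergence of the integral\<close>

context marked_frogs begin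

text \<open>The marked points up to \<open>y\<close> that jump over all of
  \<open>(y, y + d]\<close>. One such point covers the whole cell at once, so a single void event
  controls uncountably many positions.\<close>

definition cell :: "real \<Rightarrow> real \<Rightarrow> (real \<times> real) set" where
  "cell y d = {(z, w). 0 < z \<and> z \<le> y \<and> y + d < z + w}"

lemma cell_sets: "cell y d \<in> sets (borel \<Otimes>\<^sub>M borel)"
proof -
  have "{p \<in> space (borel \<Otimes>\<^sub>M borel). 0 < fst p \<and> fst p \<le> y \<and> y + d < fst p + (snd p :: real)} \<in> sets (borel \<Otimes>\<^sub>M borel)"
    by measurable
  also have "{p \<in> space (borel \<Otimes>\<^sub>M borel). 0 < fst p \<and> fst p \<le> y \<and> y + d < fst p + (snd p :: real)} = cell y d"
    by (auto simp: cell_def space_pair_measure)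
  finally show ?thesis .
qed

lemma cell_window: "cell y d \<subseteq> {0..y} \<times> UNIV"
  by (auto simp: cell_def)

text \<open>Only the points of \<open>(s, y]\<close> are counted, where the intensity is at least
  \<open>c * k\<close>. The factor \<open>exp (- c * d)\<close> is the price for clearing the cell,
  the last factor the price for ignoring the points up to \<open>s\<close>.\<close>

lemma intensity_cell_ge:
  assumes s: "0 \<le> s" "s \<le> y" and d: "d \<ge> 0" and k: "k \<ge> 0" and g: "\<And>z. s < z \<Longrightarrow> z \<le> y \<Longrightarrow> c * k \<le> g z"
  shows "k * exp (- c * d) * (1 - exp (- c * (y - s))) \<le> intensity (cell y d)"
proof -
  have "k * exp (- c * d) * (1 - exp (- c * (y - s))) = c * k * ((exp (- c * (y + d - y)) - exp (- c * (y + d - s))) / c)"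
    using c by (simp add: field_simps mult_exp_exp)
  also have "\<dots> = c * k * (\<integral>x\<in>{s..y}. exp (- c * (y + d - x)) \<partial>lborel)"
    by (subst exp_primitive(1)[OF s(2)]) simp
  also have "\<dots> = (\<integral>x\<in>{s..y}. exp (- c * (y + d - x)) * (c * k) \<partial>lborel)"
    by (simp add: mult.commute)
  also have "\<dots> \<le> (\<integral>x\<in>{0..y}. measure \<nu> (Pair x -` cell y d) * g x \<partial>lborel)"
    unfolding set_lebesgue_integral_def
  proof (rule integral_mono_AE)
    show "integrable lborel (\<lambda>x. indicator {s..y} x *\<^sub>R (exp (- c * (y + d - x)) * (c * k)))"
      using set_integrable_mult_left[OF exp_primitive(2)[OF s(2), of "y + d"], of "c * k"] by (simp add: set_integrable_def)
    show "integrable lborel (\<lambda>x. indicator {0..y} x *\<^sub>R (measure \<nu> (Pair x -` cell y d) * g x))"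
      using set_integral_eq_measure_pair(3)[OF prob_space_\<nu> sets_\<nu> g_measurable g_nonneg cell_sets _ g_int cell_window, of y d]
      unfolding set_integrable_def by auto
    show "AE x in lborel. indicator {s..y} x *\<^sub>R (exp (- c * (y + d - x)) * (c * k)) \<le> indicator {0..y} x *\<^sub>R (measure \<nu> (Pair x -` cell y d) * g x)"
      \<comment> \<open>The lower bound on \<open>g\<close> starts strictly after \<open>s\<close>;
        the point \<open>s\<close> itself is a null set.\<close>
      using AE_lborel_singleton[of s]
    proof eventually_elim
      fix x assume xs: "x \<noteq> s"
      show "indicator {s..y} x *\<^sub>R (exp (- c * (y + d - x)) * (c * k)) \<le> indicator {0..y} x *\<^sub>R (measure \<nu> (Pair x -` cell y d) * g x)"
      proof (cases "x \<in> {s..y}")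
        case True
        then have "Pair x -` cell y d = {w. w > y + d - x}" using xs s by (auto simp: cell_def)
        then have "measure \<nu> (Pair x -` cell y d) = exp (- c * (y + d - x))"
          using \<nu>_gt[of "y + d - x"] True d by simp
        moreover have "exp (- c * (y + d - x)) * (c * k) \<le> exp (- c * (y + d - x)) * g x"
          using True xs by (intro mult_left_mono g) auto
        ultimately show ?thesis using True s by simp
      next
        case False then show ?thesis using g_nonneg by (auto simp: indicator_def)
      qed
    qed
  qed
  also have "\<dots> = intensity (cell y d)" by (rule intensity_eq[OF cell_sets cell_window, symmetric])
  finally show ?thesis .
qed

text \<open>Clearing a cell of length \<open>1 / k\<close> lowers the mean from \<open>k\<close> by
  at most \<open>k * (c / k) = c\<close>, and cutting the window at \<open>s\<close>, at least
  \<open>k\<close> before \<open>y\<close>, lowers it by at most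
  \<open>k * exp (- c * k) \<le> 1 / c\<close>. Hence the mean is at least
  \<open>k - c - 1 / c\<close>.\<close>

lemma void_cell_le:
  fixes k :: nat and y s :: real
  assumes k: "k \<ge> 1" and s: "0 \<le> s" "s + k \<le> y" and g: "\<And>z. s < z \<Longrightarrow> c * k \<le> g z"
  shows "exp (- intensity (cell y (1 / k))) \<le> exp (c + 1 / c) * exp (- real k)"
proof -
  have "1 - c / k \<le> exp (- c * (1 / k))" using exp_ge_add_one_self[of "- c * (1 / k)"] by simp
  then have "k * (1 - c / k) \<le> k * exp (- c * (1 / k))" by (intro mult_left_mono) auto
  then have 1: "k - c \<le> k * exp (- c * (1 / k))" using k by (simp add: algebra_simps)
  have ys: "s \<le> y" "k \<le> y - s" using s by auto
  have "k * exp (- c * (1 / k)) * exp (- c * (y - s)) \<le> real k * 1 * exp (- c * k)"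
  proof (rule mult_mono)
    have "exp (- c * (1 / k)) \<le> 1" using c by simp
    then show "k * exp (- c * (1 / k)) \<le> real k * 1" by (intro mult_left_mono) auto
    show "exp (- c * (y - s)) \<le> exp (- c * k)" using c ys by simp
  qed auto
  also have "\<dots> \<le> 1 / c"
  proof -
    have "c * k \<le> exp (c * k)" using exp_ge_add_one_self[of "c * k"] by linarith
    then show ?thesis using c by (simp add: exp_minus field_simps)
  qed
  finally have "k - c - 1 / c \<le> k * exp (- c * (1 / k)) * (1 - exp (- c * (y - s)))"
    using 1 by (simp add: algebra_simps)
  also have "\<dots> \<le> intensity (cell y (1 / k))"
    by (rule intensity_cell_ge) (use s ys g in auto)
  finally have "- intensity (cell y (1 / k)) \<le> c + 1 / c + (- real k)" by simp
  then show ?thesis unfolding exp_add[symmetric] by (subst exp_le_cancel_iff)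
qed

text \<open>The place where \<open>g\<close> climbs to \<open>c * k\<close>. The value of
  \<open>g\<close> at this place is left open, since \<open>g\<close> may jump there; hence the
  strict inequalities in \<open>hit_gt\<close> and \<open>hit_lt\<close>.\<close>

definition hit :: "nat \<Rightarrow> real" where "hit k = Inf {t. t \<ge> 0 \<and> g t \<ge> c * k}"

section \<open>Blocks of roughly constant intensity and the convergent case\<close>

context
  assumes fin: "(\<integral>\<^sup>+t\<in>{0..}. ennreal (exp (- g t / c) * g t) \<partial>lborel) < \<infinity>"
begin

text \<open>If \<open>g\<close> stayed below \<open>b\<close>, then from some \<open>t0\<close> on
  the integrand would be at least the positive constant \<open>exp (- b / c) * g t0\<close>, and the
  integral would be infinite.\<close>

lemma g_unbounded: "\<exists>t\<ge>0. g t \<ge> b"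
proof (rule ccontr)
  assume "\<not> (\<exists>t\<ge>0. b \<le> g t)"
  then have b: "g t \<le> b" if "t \<ge> 0" for t using that by (meson le_cases)
  obtain t0 where t0: "t0 \<ge> 0" "g t0 > 0" using g_pos by blast
  let ?q = "exp (- b / c) * g t0"
  let ?I = "\<integral>\<^sup>+t\<in>{0..}. ennreal (exp (- g t / c) * g t) \<partial>lborel"
  have le: "ennreal (?q * n) \<le> ?I" for n :: nat
  proof -
    have "ennreal (?q * n) = (\<integral>\<^sup>+t. ennreal ?q * indicator {t0..t0 + n} t \<partial>lborel)"
      using t0 by (subst nn_integral_cmult) (auto simp: ennreal_mult)
    also have "\<dots> \<le> ?I"
    proof (rule nn_integral_mono)
      fix t
      have "?q \<le> exp (- g t / c) * g t" if "t0 \<le> t"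
        using that t0 c b[of t] g_nonneg by (intro mult_mono) (auto intro!: divide_right_mono monoD[OF g_mono])
      then show "ennreal ?q * indicator {t0..t0 + n} t \<le> ennreal (exp (- g t / c) * g t) * indicator {0..} t"
        using t0 by (auto simp: indicator_def intro!: ennreal_leI)
    qed
    finally show ?thesis .
  qed
  obtain r where r: "r \<ge> 0" "?I = ennreal r" using fin by (cases ?I) auto
  have q: "?q > 0" using t0 by simp
  obtain n :: nat where "real n > r / ?q" using reals_Archimedean2 by blast
  then have "?q * n > r" using q by (simp only: pos_divide_less_eq) (simp add: mult.commute)
  moreover have "?q * n \<le> r" using le[of n] r by (simp add: ennreal_le_iff)
  ultimately show False by simp
qed

lemma hit_nonneg: "hit k \<ge> 0" and hit_gt: "t > hit k \<Longrightarrow> g t \<ge> c * k" and hit_lt: "0 \<le> t \<Longrightarrow> t < hit k \<Longrightarrow> g t < c * k"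
proof -
  let ?A = "{t. t \<ge> 0 \<and> g t \<ge> c * k}"
  have ne: "?A \<noteq> {}" using g_unbounded[of "c * k"] by auto
  have bd: "bdd_below ?A" by (rule bdd_belowI[of _ 0]) auto
  show "hit k \<ge> 0" unfolding hit_def using ne by (rule cInf_greatest) auto
  show "t > hit k \<Longrightarrow> g t \<ge> c * k"
  proof -
    assume "t > hit k"
    then obtain s where "s \<in> ?A" "s < t" unfolding hit_def using cInf_lessD[OF ne] by blast
    then show ?thesis using monoD[OF g_mono, of s t] by auto
  qed
  show "0 \<le> t \<Longrightarrow> t < hit k \<Longrightarrow> g t < c * k"
    unfolding hit_def using cInf_lower[OF _ bd, of t] by (auto simp: not_le[symmetric])
qed

lemma hit_mono: "hit k \<le> hit (Suc k)"
proof (rule ccontr)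
  assume "\<not> hit k \<le> hit (Suc k)"
  then obtain t where t: "hit (Suc k) < t" "t < hit k" using dense[of "hit (Suc k)" "hit k"] by auto
  then have "g t \<ge> c * Suc k" "g t < c * k" using hit_gt[of "Suc k" t] hit_lt[of t k] hit_nonneg[of "Suc k"] by auto
  then show False using c by (simp add: algebra_simps)
qed

text \<open>Strictly between two hits \<open>g\<close> lies between \<open>c * k\<close> and
  \<open>c * (k + 1)\<close>. The exponential and the linear factor of the integrand are bounded
  below separately, as their product is not monotone in \<open>g\<close>, and the disjoint intervals
  add up to at most the whole integral.\<close>

lemma hit_summable: "summable (\<lambda>k. exp (- (real k + 1)) * (c * k) * (hit (Suc k) - hit k))"
proof (rule summable_suminf_not_top)
  show "0 \<le> exp (- (real k + 1)) * (c * k) * (hit (Suc k) - hit k)" for k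
    using hit_mono[of k] c by simp
  define N where "N = density lborel (\<lambda>t. ennreal (exp (- g t / c) * g t))"
  have [simp]: "sets N = sets borel" by (simp add: N_def)
  let ?A = "\<lambda>k. {hit k<..<hit (Suc k)}"
  have mono: "i \<le> j \<Longrightarrow> hit i \<le> hit j" for i j by (rule lift_Suc_mono_le[of hit]) (auto intro: hit_mono)
  have disj: "disjoint_family ?A"
  proof -
    have "?A i \<inter> ?A j = {}" if "i < j" for i j
      using mono[of "Suc i" j] that by auto
    then show ?thesis unfolding disjoint_family_on_def by (metis Int_commute linorder_neqE_nat)
  qed
  have "(\<Sum>k. ennreal (exp (- (real k + 1)) * (c * k) * (hit (Suc k) - hit k))) \<le> (\<Sum>k. emeasure N (?A k))"
  proof (intro suminf_le)
    fix k
    have "ennreal (exp (- (real k + 1)) * (c * k) * (hit (Suc k) - hit k)) = (\<integral>\<^sup>+t. ennreal (exp (- (real k + 1)) * (c * k)) * indicator (?A k) t \<partial>lborel)"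
      using hit_mono[of k] c by (simp add: nn_integral_cmult ennreal_mult)
    also have "\<dots> \<le> (\<integral>\<^sup>+t. ennreal (exp (- g t / c) * g t) * indicator (?A k) t \<partial>lborel)"
    proof (intro nn_integral_mono)
      fix t
      have "exp (- (real k + 1)) * (c * k) \<le> exp (- g t / c) * g t" if t: "t \<in> ?A k"
      proof (rule mult_mono)
        have "g t < c * Suc k" using t hit_nonneg[of k] by (intro hit_lt) auto
        then have "g t / c \<le> real k + 1" using c by (simp add: field_simps)
        then show "exp (- (real k + 1)) \<le> exp (- g t / c)" by simp
        show "c * k \<le> g t" using t by (intro hit_gt) auto
      qed (use c in auto)
      then show "ennreal (exp (- (real k + 1)) * (c * k)) * indicator (?A k) t \<le> ennreal (exp (- g t / c) * g t) * indicator (?A k) t"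
        by (auto simp: indicator_def intro!: ennreal_leI)
    qed
    also have "\<dots> = emeasure N (?A k)" by (simp add: N_def emeasure_density)
    finally show "ennreal (exp (- (real k + 1)) * (c * k) * (hit (Suc k) - hit k)) \<le> emeasure N (?A k)" .
  qed auto
  also have "\<dots> = emeasure N (\<Union>k. ?A k)" using disj by (intro suminf_emeasure) auto
  also have "\<dots> \<le> emeasure N {0..}"
  proof (rule emeasure_mono)
    show "(\<Union>k. ?A k) \<subseteq> {0..}"
    proof
      fix t assume "t \<in> (\<Union>k. ?A k)"
      then obtain k where "hit k < t" by auto
      with hit_nonneg[of k] show "t \<in> {0..}" by simp
    qed
  qed simp
  also have "\<dots> < \<infinity>" using fin by (simp add: N_def emeasure_density)
  finally show "(\<Sum>k. ennreal (exp (- (real k + 1)) * (c * k) * (hit (Suc k) - hit k))) \<noteq> top" by simp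
qed

text \<open>Delaying the levels makes every block long enough for the coverage of its points to reach
  \<open>g / c\<close> up to a constant.\<close>

primrec start :: "nat \<Rightarrow> real" where
  "start 0 = hit 0"
| "start (Suc k) = max (start k + Suc k) (hit (Suc k))"

lemma start_ge_hit: "hit k \<le> start k"
  by (cases k) auto

lemma start_nonneg: "start k \<ge> 0"
  using start_ge_hit[of k] hit_nonneg[of k] by linarith

lemma start_gap: "start k + Suc k \<le> start (Suc k)"
  by simp

lemma start_length: "start (Suc k) - start k \<le> Suc k + (hit (Suc k) - hit k)"
  using start_ge_hit[of k] hit_mono[of k] by auto

lemma start_mono: "i \<le> j \<Longrightarrow> start i \<le> start j"
  by (rule lift_Suc_mono_le[of start]) (use start_gap in auto)

lemma start_unbounded: "start k \<ge> k"
proof (induction k)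
  case 0 then show ?case using start_nonneg[of 0] by simp
next
  case (Suc k) then show ?case using start_gap[of k] by simp
qed

text \<open>Cells of length \<open>1 / k\<close> that fill
  \<open>(start (k + 1), start (k + 2)]\<close>. The index is shifted by one because
  \<open>g\<close> is at least \<open>c * k\<close> already after \<open>start k\<close>: the
  preceding block, of length at least \<open>k + 1\<close>, serves as the window in which the
  covering frogs start.\<close>

definition ncells :: "nat \<Rightarrow> nat" where
  "ncells k = nat \<lceil>k * (start (k + 2) - start (k + 1))\<rceil>"

text \<open>A block is at most \<open>k + 2\<close> longer than the gap between its hits. The extra
  length and the rounding contribute a polynomial times \<open>exp (- k)\<close>; the gap
  contributes the terms of \<open>hit_summable\<close>, shifted by one, and \<open>exp 2 / c\<close>
  adjusts the exponent and the factor \<open>c\<close>.\<close>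

lemma ncells_summable: "summable (\<lambda>k. real (ncells k) * (exp (c + 1 / c) * exp (- real k)))"
proof -
  let ?h = "\<lambda>k. exp (- (real k + 1)) * (c * k) * (hit (Suc k) - hit k)"
  have s1: "summable (\<lambda>k. exp 2 / c * ?h (Suc k))"
    by (intro summable_mult) (subst summable_Suc_iff, rule hit_summable)
  have s2: "summable (\<lambda>k. (real k + 1)^2 * exp (- real k))"
  proof (rule summable_comparison_test_bigo)
    have "summable (\<lambda>k. exp (- 1 / 2 :: real) ^ k)" by (rule summable_geometric) simp
    then show "summable (\<lambda>k. norm (exp (- real k / 2)))" by (simp add: exp_of_nat_mult[symmetric])
    show "(\<lambda>k. (real k + 1)^2 * exp (- real k)) \<in> O(\<lambda>k. exp (- real k / 2))" by real_asymp
  qed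
  have "summable (\<lambda>k. exp (c + 1 / c) * ((real k + 1)^2 * exp (- real k) + exp 2 / c * ?h (Suc k)))"
    by (intro summable_mult summable_add s1 s2)
  then show ?thesis
  proof (rule summable_comparison_test'[of _ 0])
    fix k :: nat
    let ?L = "hit (Suc (Suc k)) - hit (Suc k)"
    have L: "?L \<ge> 0" using hit_mono[of "Suc k"] by simp
    have st: "start (k + 2) - start (k + 1) \<le> real k + 2 + ?L" using start_length[of "Suc k"] by simp
    have "start (k + 1) \<le> start (k + 2)" by (rule start_mono) simp
    then have "real (ncells k) \<le> k * (start (k + 2) - start (k + 1)) + 1"
      unfolding ncells_def by (simp add: of_nat_nat)
    also have "\<dots> \<le> k * (real k + 2 + ?L) + 1" using st by (intro add_mono mult_left_mono) auto
    also have "\<dots> \<le> (real k + 1)^2 + (real k + 1) * ?L" using L by (simp add: power2_eq_square algebra_simps)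
    finally have "real (ncells k) * exp (- real k) \<le> ((real k + 1)^2 + (real k + 1) * ?L) * exp (- real k)"
      by (intro mult_right_mono) auto
    also have "\<dots> = (real k + 1)^2 * exp (- real k) + exp 2 / c * ?h (Suc k)"
    proof -
      have "exp (- real k) = exp 2 * exp (- (real (Suc k) + 1))" by (simp add: mult_exp_exp)
      then show ?thesis using c by (simp only: distrib_right) (simp add: field_simps)
    qed
    finally show "norm (real (ncells k) * (exp (c + 1 / c) * exp (- real k))) \<le> exp (c + 1 / c) * ((real k + 1)^2 * exp (- real k) + exp 2 / c * ?h (Suc k))"
      by (simp add: mult.left_commute mult_left_mono)
  qed
qed

text \<open>The union bound is carried out inside the event that the first jump exceeds
  \<open>K\<close>. This jump is independent of the void events, so each failure keeps the factor
  \<open>prob ?Q\<close>; the failures together lose less than all of it once the tail of the sum is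
  below 1.\<close>

lemma survives:
  "\<exists>K E. K \<ge> 0 \<and> E \<in> events \<and> prob E > 0 \<and>
     (\<forall>\<omega>\<in>E. Y 0 \<omega> > K \<and> (\<forall>n. X n \<omega> > K \<longrightarrow> (\<exists>j<n. X j \<omega> + Y (Suc j) \<omega> > X n \<omega>)))"
proof -
  let ?q = "\<lambda>k. real (ncells k) * (exp (c + 1 / c) * exp (- real k))"
  obtain N where N: "\<And>n. n \<ge> N \<Longrightarrow> norm (\<Sum>i. ?q (i + n)) < 1"
    using suminf_exist_split[OF zero_less_one ncells_summable] by blast
  define k0 where "k0 = max N 1"
  have k0: "k0 \<ge> 1" "(\<Sum>i. ?q (i + k0)) < 1" using N[of k0] by (auto simp: k0_def)
  define K where "K = start (k0 + 1)"
  have K: "K \<ge> 0" unfolding K_def by (rule start_nonneg)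
  define pos where "pos k i = start (k + 1) + real i / real k" for k i
  define V where "V k i = void M X Y (cell (pos k i) (1 / real k))" for k i
  have VY: "{\<omega>\<in>V k i. Y 0 \<omega> \<in> {K<..}} \<in> events" for k i
  proof -
    have "V k i \<in> events" unfolding V_def by (rule void_sets[OF cell_sets cell_window])
    then have "V k i \<inter> (Y 0 -` {K<..} \<inter> space M) \<in> events" by (intro sets.Int measurable_sets[OF Y_measurable]) auto
    also have "V k i \<inter> (Y 0 -` {K<..} \<inter> space M) = {\<omega>\<in>V k i. Y 0 \<omega> \<in> {K<..}}" unfolding V_def void_def by auto
    finally show ?thesis .
  qed
  let ?Q = "{\<omega>\<in>space M. Y 0 \<omega> \<in> {K<..}}"
  have pQ: "prob ?Q > 0" using prob_Y_gt[OF K, of 0] by simp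
  have Qm: "?Q \<in> events" by measurable
  have pV: "prob {\<omega>\<in>V k i. Y 0 \<omega> \<in> {K<..}} \<le> prob ?Q * (exp (c + 1 / c) * exp (- real k))" if "k \<ge> 1" for k i
  proof -
    have "prob {\<omega>\<in>V k i. Y 0 \<omega> \<in> {K<..}} = prob ?Q * exp (- intensity (cell (pos k i) (1 / real k)))"
      unfolding V_def by (rule void_prob_Y[OF cell_sets cell_window]) auto
    also have "\<dots> \<le> prob ?Q * (exp (c + 1 / c) * exp (- real k))"
    proof (intro mult_left_mono void_cell_le[of k "start k"])
      have "start k + real k \<le> start (k + 1)" using start_gap[of k] by simp
      also have "\<dots> \<le> pos k i" unfolding pos_def by simp
      finally show "start k + real k \<le> pos k i" .
      show "c * real k \<le> g z" if "start k < z" for z using that start_ge_hit[of k] by (intro hit_gt) auto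
    qed (use that start_nonneg in auto)
    finally show ?thesis .
  qed
  define A where "A j = (\<Union>i<ncells (j + k0). {\<omega>\<in>V (j + k0) i. Y 0 \<omega> \<in> {K<..}})" for j
  have Am: "A j \<in> events" for j unfolding A_def using VY by auto
  have pA: "prob (A j) \<le> prob ?Q * ?q (j + k0)" for j
  proof -
    have "prob (A j) \<le> (\<Sum>i<ncells (j + k0). prob {\<omega>\<in>V (j + k0) i. Y 0 \<omega> \<in> {K<..}})"
      unfolding A_def using VY by (intro finite_measure_subadditive_finite) auto
    also have "\<dots> \<le> (\<Sum>i<ncells (j + k0). prob ?Q * (exp (c + 1 / c) * exp (- real (j + k0))))"
      using k0 by (intro sum_mono pV) auto
    finally show ?thesis by (simp add: mult_ac)
  qed
  have sq: "summable (\<lambda>j. prob ?Q * ?q (j + k0))"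
    by (intro summable_mult summable_ignore_initial_segment ncells_summable)
  have sA: "summable (\<lambda>j. prob (A j))"
    by (rule summable_comparison_test'[OF sq, of 0]) (use pA in auto)
  have "prob (\<Union>j. A j) \<le> (\<Sum>j. prob (A j))"
    using Am by (intro finite_measure_subadditive_countably sA) auto
  also have "\<dots> \<le> (\<Sum>j. prob ?Q * ?q (j + k0))" by (intro suminf_le pA sA sq)
  also have "\<dots> = prob ?Q * (\<Sum>j. ?q (j + k0))"
    by (intro suminf_mult summable_ignore_initial_segment ncells_summable)
  also have "\<dots> < prob ?Q * 1" using k0 pQ by (intro mult_strict_left_mono)
  finally have bad: "prob (\<Union>j. A j) < prob ?Q" by simp
  define E where "E = ?Q - (\<Union>j. A j)"
  have Em: "E \<in> events" unfolding E_def using Am Qm by auto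
  have "prob ?Q \<le> prob (E \<union> (\<Union>j. A j))" using Em Am by (intro finite_measure_mono) (auto simp: E_def)
  also have "\<dots> \<le> prob E + prob (\<Union>j. A j)" using Em Am by (intro measure_Un_le) auto
  finally have pE: "prob E > 0" using bad by simp
  have "\<exists>j<n. X j \<omega> + Y (Suc j) \<omega> > X n \<omega>" if w: "\<omega> \<in> E" and Xn: "X n \<omega> > K" for \<omega> n
  \<comment> \<open>Locate \<open>X n\<close> in its block and then in its cell. The block index is
    two less than the first \<open>l\<close> with \<open>X n \<le> start l\<close>, matching the
    shift in \<open>ncells\<close>.\<close>
  proof -
    define l where "l = (LEAST l. X n \<omega> \<le> start l)"
    obtain l' :: nat where "real l' > X n \<omega>" using reals_Archimedean2 by blast
    then have "X n \<omega> \<le> start l'" using start_unbounded[of l'] by linarith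
    then have l: "X n \<omega> \<le> start l" unfolding l_def by (rule LeastI)
    have "l > k0 + 1"
    proof (rule ccontr)
      assume "\<not> l > k0 + 1"
      then have "start l \<le> K" unfolding K_def by (intro start_mono) auto
      with l Xn show False by simp
    qed
    then have "l = (l - 2) + 2" "l - 2 \<ge> k0" by auto
    then obtain k where k: "l = k + 2" "k \<ge> k0" by blast
    have "\<not> X n \<omega> \<le> start (k + 1)" using not_less_Least[of "k + 1" "\<lambda>l. X n \<omega> \<le> start l"] k by (simp add: l_def)
    then have lo: "X n \<omega> > start (k + 1)" by (simp only: not_le)
    have kp: "real k > 0" using k k0 by simp
    \<comment> \<open>Ceiling minus one places \<open>X n\<close> in the left-open cell
      \<open>(pos k i, pos k i + 1 / k]\<close>. The frog that clears this cell starts at or before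
      \<open>pos k i\<close>, hence strictly before \<open>X n\<close>, which gives a smaller
      index.\<close>
    define i where "i = nat (\<lceil>k * (X n \<omega> - start (k + 1))\<rceil> - 1)"
    have pos0: "k * (X n \<omega> - start (k + 1)) > 0" using lo kp by simp
    then have i: "real i = real_of_int \<lceil>k * (X n \<omega> - start (k + 1))\<rceil> - 1" unfolding i_def by (simp add: of_nat_nat)
    have i1: "real i < k * (X n \<omega> - start (k + 1))" "k * (X n \<omega> - start (k + 1)) \<le> real i + 1"
      unfolding i by linarith+
    have "k * (X n \<omega> - start (k + 1)) \<le> k * (start (k + 2) - start (k + 1))"
      using l k by (intro mult_left_mono) auto
    with i1(1) have "real i < k * (start (k + 2) - start (k + 1))" by linarith
    then have "real i < real (ncells k)" unfolding ncells_def by linarith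
    then have ic: "i < ncells k" by simp
    have p1: "pos k i < X n \<omega>" unfolding pos_def using i1(1) kp by (simp add: field_simps)
    have p2: "X n \<omega> \<le> pos k i + 1 / k" unfolding pos_def using i1(2) kp by (simp add: field_simps)
    have "\<omega> \<notin> A (k - k0)" "\<omega> \<in> ?Q" using w unfolding E_def by auto
    then have "\<omega> \<notin> V k i" using ic k unfolding A_def by auto
    then obtain j where j: "(X j \<omega>, Y (Suc j) \<omega>) \<in> cell (pos k i) (1 / real k)"
      using \<open>\<omega> \<in> ?Q\<close> unfolding V_def void_def by auto
    have "X j \<omega> < X n \<omega>" using j p1 unfolding cell_def by auto
    then have "j < n" using strict_mono_less[OF pp_strict_mono[OF pp, of \<omega>], of j n] \<open>\<omega> \<in> ?Q\<close> by simp
    moreover have "X j \<omega> + Y (Suc j) \<omega> > X n \<omega>" using j p2 unfolding cell_def by auto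
    ultimately show ?thesis by blast
  qed
  moreover have "Y 0 \<omega> > K" if "\<omega> \<in> E" for \<omega> using that unfolding E_def by auto
  ultimately show ?thesis using K Em pE by blast
qed

end

end

section \<open>Frogs\<close>

text \<open>Rational times keep the supremum measurable for the product sigma-algebra over all
  times; for continuous paths nothing is lost. Extended reals are used because a path may be
  unbounded above on a null set.\<close>

definition drift_sup :: "real \<Rightarrow> (real \<Rightarrow> real) \<Rightarrow> ereal" where
  "drift_sup lam w = (SUP t\<in>{t\<in>\<rat>. t \<ge> 0}. ereal (w t - lam * t))"

lemma drift_sup_measurable [measurable]: "drift_sup lam \<in> borel_measurable (Pi\<^sub>M UNIV (\<lambda>_. borel))"
proof -
  have c: "countable {t\<in>\<rat>. t \<ge> (0::real)}" by (rule countable_subset[OF _ countable_rat]) auto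
  show ?thesis unfolding drift_sup_def[abs_def]
    by (intro borel_measurable_SUP[OF c]) measurable
qed

lemma drift_sup_gt_iff:
  assumes c: "continuous_on {0..} w"
  shows "drift_sup lam w > ereal a \<longleftrightarrow> (\<exists>t\<ge>0. w t - lam * t > a)"
proof
  assume "drift_sup lam w > ereal a"
  then show "\<exists>t\<ge>0. w t - lam * t > a" unfolding drift_sup_def by (auto simp: less_SUP_iff)
next
  assume "\<exists>t\<ge>0. w t - lam * t > a"
  then obtain t where t: "t \<ge> 0" "w t - lam * t > a" by blast
  have c': "continuous_on {0..} (\<lambda>t. w t - lam * t)" by (intro continuous_intros c)
  have "((\<lambda>t. w t - lam * t) \<longlongrightarrow> w t - lam * t) (at t within {0..})"
    using c' t by (simp add: continuous_on_def)
  then have ev: "\<forall>\<^sub>F s in at t within {0..}. w s - lam * s > a" using t(2) by (rule order_tendstoD)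
  then obtain d where d: "d > 0" "\<And>s. s \<ge> 0 \<Longrightarrow> s \<noteq> t \<Longrightarrow> dist s t < d \<Longrightarrow> w s - lam * s > a"
    unfolding eventually_at by auto
  obtain q where q: "q \<in> \<rat>" "t < q" "q < t + d" using Rats_dense_in_real[of t "t + d"] d(1) by auto
  then have "w q - lam * q > a" using t by (intro d(2)) (auto simp: dist_real_def)
  then show "drift_sup lam w > ereal a" unfolding drift_sup_def using q t by (auto simp: less_SUP_iff intro!: bexI[of _ q])
qed

text \<open>The equivalence holds for all \<open>a\<close> outside one null set, namely where the
  supremum is infinite. It is phrased with strict inequalities, so that it does not matter whether
  the supremum is attained.\<close>

lemma brownian_drift_sup:
  fixes lam :: real and B :: "real \<Rightarrow> 'a \<Rightarrow> real"
  assumes bm: "std_brownian_motion M B" and lam: "lam > 0"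
  defines "Y \<equiv> \<lambda>\<omega>. real_of_ereal (drift_sup lam (\<lambda>t. B t \<omega>))"
  shows "AE \<omega> in M. \<forall>a. Y \<omega> > a \<longleftrightarrow> (\<exists>t\<ge>0. B t \<omega> - lam * t > a)"
    and "distr M borel Y = density lborel (exponential_density (2 * lam))"
proof -
  interpret prob_space M using bm by (rule bm_prob_space)
  note [measurable] = bm_measurable[OF bm]
  have Bm[measurable]: "(\<lambda>\<omega> t. B t \<omega>) \<in> measurable M (Pi\<^sub>M UNIV (\<lambda>_. borel))"
    by (rule measurable_PiM_single') (auto simp: space_PiM)
  have S[measurable]: "(\<lambda>\<omega>. drift_sup lam (\<lambda>t. B t \<omega>)) \<in> borel_measurable M"
    by (rule measurable_compose[OF Bm drift_sup_measurable])
  have Ym[measurable]: "Y \<in> borel_measurable M" unfolding Y_def by measurable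
  have gt: "drift_sup lam (\<lambda>t. B t \<omega>) > ereal a \<longleftrightarrow> (\<exists>t\<ge>0. B t \<omega> - lam * t > a)" if "\<omega> \<in> space M" for \<omega> a
    by (rule drift_sup_gt_iff[OF bm_continuous[OF bm that]])
  have "prob {\<omega>\<in>space M. drift_sup lam (\<lambda>t. B t \<omega>) = \<infinity>} \<le> exp (- 2 * lam * real n)" for n :: nat
  proof -
    have "prob {\<omega>\<in>space M. drift_sup lam (\<lambda>t. B t \<omega>) = \<infinity>} \<le> prob {\<omega>\<in>space M. \<exists>t\<ge>0. B t \<omega> - lam * t > real n}"
    proof (intro finite_measure_mono brownian_drift_sup_law(1)[OF bm lam] subsetI)
      fix \<omega> assume w: "\<omega> \<in> {\<omega>\<in>space M. drift_sup lam (\<lambda>t. B t \<omega>) = \<infinity>}"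
      then have "drift_sup lam (\<lambda>t. B t \<omega>) > ereal (real n)" by simp
      then show "\<omega> \<in> {\<omega>\<in>space M. \<exists>t\<ge>0. B t \<omega> - lam * t > real n}" using w gt[of \<omega> "real n"] by auto
    qed simp
    then show ?thesis using brownian_drift_sup_law(2)[OF bm lam, of "real n"] by simp
  qed
  moreover have "(\<lambda>n. exp (- 2 * lam * real n)) \<longlonglongrightarrow> 0" using lam by real_asymp
  ultimately have "prob {\<omega>\<in>space M. drift_sup lam (\<lambda>t. B t \<omega>) = \<infinity>} \<le> 0"
    by (intro LIMSEQ_le_const[of _ 0]) auto
  then have "prob {\<omega>\<in>space M. drift_sup lam (\<lambda>t. B t \<omega>) = \<infinity>} = 0" by (simp add: measure_le_0_iff)
  then have fin: "AE \<omega> in M. drift_sup lam (\<lambda>t. B t \<omega>) \<noteq> \<infinity>"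
    by (subst (asm) prob_Collect_eq_0) auto
  \<comment> \<open>Time 0 contributes the value 0, which excludes minus infinity; with
    \<open>fin\<close> the conversion to a real is therefore faithful.\<close>
  have low: "drift_sup lam (\<lambda>t. B t \<omega>) \<ge> 0" if "\<omega> \<in> space M" for \<omega>
    unfolding drift_sup_def using bm_zero[OF bm that] by (intro SUP_upper2[of 0]) auto
  show *: "AE \<omega> in M. \<forall>a. Y \<omega> > a \<longleftrightarrow> (\<exists>t\<ge>0. B t \<omega> - lam * t > a)"
    using fin
  proof (rule AE_mp, intro AE_I2 impI allI)
    fix \<omega> a assume w: "\<omega> \<in> space M" and f: "drift_sup lam (\<lambda>t. B t \<omega>) \<noteq> \<infinity>"
    then have "drift_sup lam (\<lambda>t. B t \<omega>) = ereal (Y \<omega>)" unfolding Y_def using low[OF w]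
      by (cases "drift_sup lam (\<lambda>t. B t \<omega>)") auto
    then show "Y \<omega> > a \<longleftrightarrow> (\<exists>t\<ge>0. B t \<omega> - lam * t > a)" using gt[OF w, of a] by simp
  qed
  have "prob {\<omega>\<in>space M. Y \<omega> \<le> a} = 1 - exp (- a * (2 * lam))" if a: "0 \<le> a" for a
  proof -
    have "prob {\<omega>\<in>space M. Y \<omega> > a} = prob {\<omega>\<in>space M. \<exists>t\<ge>0. B t \<omega> - lam * t > a}"
      using * brownian_drift_sup_law(1)[OF bm lam a] by (intro finite_measure_eq_AE) (auto elim!: eventually_mono)
    then have p: "prob {\<omega>\<in>space M. Y \<omega> > a} = exp (- 2 * lam * a)"
      by (simp only: brownian_drift_sup_law(2)[OF bm lam a])
    have "{\<omega>\<in>space M. Y \<omega> \<le> a} = space M - {\<omega>\<in>space M. Y \<omega> > a}" by auto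
    then have "prob {\<omega>\<in>space M. Y \<omega> \<le> a} = 1 - prob {\<omega>\<in>space M. Y \<omega> > a}"
      by (simp only:) (rule prob_compl, measurable)
    then show ?thesis unfolding p by (simp add: mult_ac)
  qed
  then have "distributed M lborel Y (exponential_density (2 * lam))"
    using lam by (subst exponential_distributed_iff) auto
  then show "distr M borel Y = density lborel (exponential_density (2 * lam))"
    unfolding distributed_def by (metis distr_cong sets_lborel)
qed

text \<open>This brings every woken frog back to the origin. An exponential Markov bound at a single
  integer time \<open>n\<close>, with exponent \<open>lam\<close>, makes the probability of staying
  above \<open>- k\<close> at most a constant times
  \<open>exp (- lam\<^sup>2 * n / 2)\<close>.\<close>

lemma brownian_drift_to_minus_infinity:
  assumes bm: "std_brownian_motion M B" and lam: "lam > 0"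
  shows "AE \<omega> in M. \<forall>a. \<exists>t\<ge>0. B t \<omega> - lam * t \<le> a"
proof -
  interpret prob_space M using bm by (rule bm_prob_space)
  note [measurable] = bm_measurable[OF bm]
  have "AE \<omega> in M. \<exists>n::nat. B n \<omega> - lam * n \<le> - real k" for k :: nat
  proof -
    let ?E = "{\<omega>\<in>space M. \<not> (\<exists>n::nat. B n \<omega> - lam * n \<le> - real k)}"
    have le: "prob ?E \<le> exp (lam * k) * exp (- lam\<^sup>2 * n / 2)" if n: "n \<ge> 1" for n :: nat
    proof -
      have d: "distributed M lborel (\<lambda>\<omega>. B n \<omega> - B 0 \<omega>) (normal_density 0 (sqrt n))"
        using bm_increment[OF bm, of 0 "real n"] n by simp
      have sq: "sqrt (real n) > 0" using n by simp
      note mgf = normal_mgf[OF d sq, of lam]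
      have "prob ?E \<le> prob {\<omega>\<in>space M. exp (lam * (B n \<omega> - B 0 \<omega>)) \<ge> exp (lam * (lam * n - k))}"
      proof (intro finite_measure_mono subsetI)
        fix \<omega> assume w: "\<omega> \<in> ?E"
        then have "B n \<omega> - lam * n > - real k" by (auto simp: not_le)
        then have "lam * n - k \<le> B n \<omega> - B 0 \<omega>" using w bm_zero[OF bm, of \<omega>] by auto
        then have "lam * (lam * n - k) \<le> lam * (B n \<omega> - B 0 \<omega>)" using lam by (intro mult_left_mono) auto
        then show "\<omega> \<in> {\<omega>\<in>space M. exp (lam * (B n \<omega> - B 0 \<omega>)) \<ge> exp (lam * (lam * n - k))}" using w by simp
      qed measurable
      also have "\<dots> \<le> expectation (\<lambda>\<omega>. exp (lam * (B n \<omega> - B 0 \<omega>))) / exp (lam * (lam * n - k))"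
        by (rule integral_Markov_inequality_measure[OF mgf(1), of "space M"]) auto
      also have "\<dots> = exp (lam * k) * exp (- lam\<^sup>2 * n / 2)"
        unfolding mgf(2) using n by (simp add: exp_diff[symmetric] mult_exp_exp power2_eq_square algebra_simps)
      finally show ?thesis .
    qed
    have "(\<lambda>n. exp (lam * k) * exp (- lam\<^sup>2 * real n / 2)) \<longlonglongrightarrow> 0" using lam by real_asymp
    then have "prob ?E \<le> 0" by (rule LIMSEQ_le_const) (use le in blast)
    then have "prob ?E = 0" by (simp add: measure_le_0_iff)
    then show ?thesis by (subst (asm) prob_Collect_eq_0) auto
  qed
  then have "AE \<omega> in M. \<forall>k::nat. \<exists>n::nat. B n \<omega> - lam * n \<le> - real k" by (simp add: AE_all_countable)
  then show ?thesis
  proof (rule AE_mp, intro AE_I2 impI allI)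
    fix \<omega> a assume "\<forall>k::nat. \<exists>n::nat. B n \<omega> - lam * n \<le> - real k"
    moreover obtain k :: nat where "real k > - a" using reals_Archimedean2 by blast
    ultimately obtain n :: nat where "B n \<omega> - lam * n \<le> a" by (metis less_eq_real_def minus_less_iff order_trans)
    then show "\<exists>t\<ge>0. B t \<omega> - lam * t \<le> a" by (intro exI[of _ "real n"]) auto
  qed
qed

section \<open>Deterministic consequences for a single realization\<close>

lemma path_hits_above:
  fixes p :: "real \<Rightarrow> real"
  assumes "continuous_on {0..} p" "p 0 \<le> v" "t \<ge> 0" "p t \<ge> v"
  shows "\<exists>s\<ge>0. p s = v"
  using IVT'[of p 0 v t] assms continuous_on_subset[of "{0..}" p "{0..t}"] by auto

lemma path_hits_below:
  fixes p :: "real \<Rightarrow> real"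
  assumes "continuous_on {0..} p" "p 0 \<ge> v" "t \<ge> 0" "p t \<le> v"
  shows "\<exists>s\<ge>0. p s = v"
  using IVT2'[of p t v 0] assms continuous_on_subset[of "{0..}" p "{0..t}"] by auto

lemma Int_stable_vimages: "Int_stable {F -` S \<inter> A | S. S \<in> sets N}"
proof (rule Int_stableI)
  fix a b assume "a \<in> {F -` S \<inter> A | S. S \<in> sets N}" "b \<in> {F -` S \<inter> A | S. S \<in> sets N}"
  then obtain S T where "a = F -` S \<inter> A" "b = F -` T \<inter> A" "S \<in> sets N" "T \<in> sets N" by blast
  then have "a \<inter> b = F -` (S \<inter> T) \<inter> A" "S \<inter> T \<in> sets N" by auto
  then show "a \<inter> b \<in> {F -` S \<inter> A | S. S \<in> sets N}" by blast
qed

text \<open>By induction over the wake-ups every active frog starts at or before the barrier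
  \<open>r\<close>: its waker started there and cannot get past \<open>r\<close>. Only finitely many
  frogs sleep up to \<open>r\<close>.\<close>

lemma finite_activated:
  fixes Y :: "nat \<Rightarrow> real"
  assumes r: "Y 0 \<le> r" "0 \<le> r" "\<And>n. X n \<omega> \<le> r \<Longrightarrow> X n \<omega> + Y (Suc n) \<le> r"
    and Y: "\<And>i t. t \<ge> 0 \<Longrightarrow> W i t \<omega> - lam * t \<le> Y i"
    and top: "filterlim (\<lambda>n. X n \<omega>) at_top sequentially"
  shows "finite (activated (frog_pos X \<omega>) (frog_path lam X W \<omega>))"
proof -
  have "frog_pos X \<omega> i \<le> r" if "i \<in> activated (frog_pos X \<omega>) (frog_path lam X W \<omega>)" for i
    using that
  proof induction
    case start then show ?case using r by (simp add: frog_pos_def)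
  next
    case (wake j s i)
    have "frog_pos X \<omega> i \<le> frog_pos X \<omega> j + Y j"
      using wake(3) Y[OF wake(2), of j] unfolding frog_path_def by linarith
    also have "\<dots> \<le> r" using wake(4) r by (cases j) (auto simp: frog_pos_def)
    finally show ?case .
  qed
  then have "activated (frog_pos X \<omega>) (frog_path lam X W \<omega>) \<subseteq> insert 0 (Suc ` {n. X n \<omega> \<le> r})"
    by (force simp: frog_pos_def image_iff split: nat.splits elim: nat.exhaust)
  moreover have "finite {n. X n \<omega> \<le> r}"
  proof -
    have "\<forall>\<^sub>F n in sequentially. X n \<omega> > r" using top by (simp add: filterlim_at_top_dense)
    then obtain N where "\<forall>n\<ge>N. X n \<omega> > r" by (auto simp: eventually_sequentially)
    then have "{n. X n \<omega> \<le> r} \<subseteq> {..<N}" by (auto simp: not_le[symmetric])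
    then show ?thesis by (rule finite_subset) auto
  qed
  ultimately show ?thesis by (meson finite_imageI finite_insert finite_subset)
qed

text \<open>Strong induction on the index wakes every frog, since each one beyond \<open>K\<close>
  lies within reach of a frog of smaller index. A continuous path that moves above or below a site
  passes through it, which turns bounds on the path into actual hits.\<close>

lemma all_frogs_hit:
  fixes Y :: "nat \<Rightarrow> real"
  assumes K: "0 \<le> K" "Y 0 > K" and cover: "\<And>n. X n \<omega> > K \<Longrightarrow> \<exists>j<n. X j \<omega> + Y (Suc j) > X n \<omega>"
    and Y: "\<And>i a. a < Y i \<Longrightarrow> \<exists>t\<ge>0. W i t \<omega> - lam * t > a"
    and down: "\<And>i a. \<exists>t\<ge>0. W i t \<omega> - lam * t \<le> a"
    and cont: "\<And>i. continuous_on {0..} (\<lambda>t. W i t \<omega>)" and W0: "\<And>i. W i 0 \<omega> = 0"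
    and pos: "\<And>n. X n \<omega> > 0" and mono: "strict_mono (\<lambda>n. X n \<omega>)"
  shows "frogs_hitting_origin lam X W \<omega> = UNIV"
proof -
  let ?A = "activated (frog_pos X \<omega>) (frog_path lam X W \<omega>)"
  have cp: "continuous_on {0..} (frog_path lam X W \<omega> i)" for i
    unfolding frog_path_def[abs_def] by (intro continuous_intros cont)
  have p0: "frog_path lam X W \<omega> i 0 = frog_pos X \<omega> i" for i by (simp add: frog_path_def W0)
  have reach: "i \<in> ?A" if j: "j \<in> ?A" and le: "frog_pos X \<omega> j \<le> frog_pos X \<omega> i" and gt: "frog_pos X \<omega> j + Y j > frog_pos X \<omega> i" for i j
  proof -
    obtain t where t: "t \<ge> 0" "W j t \<omega> - lam * t > frog_pos X \<omega> i - frog_pos X \<omega> j"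
      using Y[of "frog_pos X \<omega> i - frog_pos X \<omega> j" j] gt by auto
    have "\<exists>s\<ge>0. frog_path lam X W \<omega> j s = frog_pos X \<omega> i"
      by (rule path_hits_above[OF cp _ t(1)]) (use t(2) le in \<open>auto simp: p0\<close>, simp add: frog_path_def)
    then show ?thesis using activated.wake[OF j] by blast
  qed
  have "Suc n \<in> ?A" for n
  proof (induction n rule: less_induct)
    case (less n)
    show ?case
    proof (cases "X n \<omega> > K")
      case True
      then obtain j where j: "j < n" "X j \<omega> + Y (Suc j) > X n \<omega>" using cover by blast
      have "X j \<omega> < X n \<omega>" using strict_monoD[OF mono j(1)] .
      then show ?thesis using j by (intro reach[OF less.IH[OF j(1)]]) (auto simp: frog_pos_def)
    next
      \<comment> \<open>Frogs up to \<open>K\<close> are woken by the initial frog, whose jump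
        exceeds \<open>K\<close>.\<close>
      case False
      then show ?thesis using K pos[of n] by (intro reach[OF activated.start]) (auto simp: frog_pos_def)
    qed
  qed
  then have all: "i \<in> ?A" for i by (cases i) (auto intro: activated.start)
  moreover have "\<exists>s\<ge>0. frog_path lam X W \<omega> i s = 0" for i
  proof -
    obtain t where t: "t \<ge> 0" "W i t \<omega> - lam * t \<le> - frog_pos X \<omega> i" using down by blast
    have "frog_pos X \<omega> i \<ge> 0" using less_imp_le[OF pos] by (cases i) (auto simp: frog_pos_def)
    then show ?thesis
      by (intro path_hits_below[OF cp _ t(1)]) (use t(2) in \<open>auto simp: p0\<close>, simp add: frog_path_def)
  qed
  ultimately show ?thesis unfolding frogs_hitting_origin_def by auto
qed

section \<open>Transfer of the covering results to the frog model\<close>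

theorem theorem1:
  fixes lam :: real and f :: "real \<Rightarrow> real" and M :: "'a measure"
    and X :: "nat \<Rightarrow> 'a \<Rightarrow> real" and W :: "nat \<Rightarrow> real \<Rightarrow> 'a \<Rightarrow> real"
  assumes lam_pos: "lam > 0"
    and f_nonneg: "\<forall>t\<ge>0. f t \<ge> 0"
    and f_mono: "mono_on {0..} f"
    and f_nonzero: "\<exists>t\<ge>0. f t \<noteq> 0"
    and M: "prob_space M"
    and PPP: "poisson_point_process M (\<lambda>x. if 0 \<le> x then f x else 0) X"
    and BM: "\<forall>i. std_brownian_motion M (W i)"
    and indep_BM: "prob_space.indep_vars M (\<lambda>_. Pi\<^sub>M UNIV (\<lambda>_. borel))
                     (\<lambda>i \<omega> t. W i t \<omega>) UNIV"
    and indep_PPP_BM: "prob_space.indep_set M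
                     {(\<lambda>\<omega> n. X n \<omega>) -` S \<inter> space M | S. S \<in> sets (Pi\<^sub>M UNIV (\<lambda>_. borel))}
                     {(\<lambda>\<omega> i t. W i t \<omega>) -` S \<inter> space M | S.
                         S \<in> sets (Pi\<^sub>M UNIV (\<lambda>_. Pi\<^sub>M UNIV (\<lambda>_. borel)))}"
  shows "frog_transient M lam X W \<longleftrightarrow>
    (\<integral>\<^sup>+ t\<in>{0..}. ennreal (exp (- f t / (2 * lam)) * f t) \<partial>lborel) = \<infinity>"
proof -
  interpret prob_space M by fact
  define g where "g x = (if 0 \<le> x then f x else 0)" for x
  define Y where "Y i \<omega> = real_of_ereal (drift_sup lam (\<lambda>t. W i t \<omega>))" for i \<omega>
  have bm: "std_brownian_motion M (W i)" for i using BM by blast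
  have pp: "poisson_point_process M g X" using PPP unfolding g_def[abs_def] .
  let ?PB = "Pi\<^sub>M UNIV (\<lambda>_. borel :: real measure) :: (real \<Rightarrow> real) measure"
  let ?PX = "Pi\<^sub>M UNIV (\<lambda>_. borel :: real measure) :: (nat \<Rightarrow> real) measure"
  let ?PW = "Pi\<^sub>M UNIV (\<lambda>_::nat. ?PB)"
  have Xm: "(\<lambda>\<omega> n. X n \<omega>) \<in> measurable M ?PX"
    by (rule measurable_PiM_single') (auto simp: space_PiM pp_measurable[OF pp])
  have Wm: "(\<lambda>\<omega> i t. W i t \<omega>) \<in> measurable M ?PW"
  proof (rule measurable_PiM_single')
    show "(\<lambda>\<omega> t. W i t \<omega>) \<in> measurable M ?PB" for i
      by (rule measurable_PiM_single') (auto simp: space_PiM bm_measurable[OF bm])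
  qed (auto simp: space_PiM)
  have hm: "(\<lambda>w. real_of_ereal (drift_sup lam w)) \<in> borel_measurable ?PB" by measurable
  have Hm: "(\<lambda>p i. real_of_ereal (drift_sup lam (p i))) \<in> measurable ?PW ?PX"
  proof (rule measurable_PiM_single')
    fix i :: nat
    have "(\<lambda>p. p i) \<in> measurable ?PW ?PB" by (rule measurable_component_singleton) simp
    from measurable_compose[OF this hm]
    show "(\<lambda>p. real_of_ereal (drift_sup lam (p i))) \<in> borel_measurable ?PW" .
  qed (simp add: space_PiM)
  have YW: "(\<lambda>\<omega> n. Y n \<omega>) = (\<lambda>p i. real_of_ereal (drift_sup lam (p i))) \<circ> (\<lambda>\<omega> i t. W i t \<omega>)"
    by (simp add: fun_eq_iff Y_def)
  have Ym: "(\<lambda>\<omega> n. Y n \<omega>) \<in> measurable M ?PX" unfolding YW by (rule measurable_comp[OF Wm Hm])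
  have XY: "indep_var ?PX (\<lambda>\<omega> n. X n \<omega>) ?PX (\<lambda>\<omega> n. Y n \<omega>)"
    unfolding indep_var_eq
  proof (intro conjI Xm Ym indep_set_sigma_sets Int_stable_vimages indep_setI)
    fix a b assume a: "a \<in> {(\<lambda>\<omega> n. X n \<omega>) -` S \<inter> space M | S. S \<in> sets ?PX}"
      and "b \<in> {(\<lambda>\<omega> n. Y n \<omega>) -` S \<inter> space M | S. S \<in> sets ?PX}"
    then obtain S where S: "S \<in> sets ?PX" and b: "b = (\<lambda>\<omega> n. Y n \<omega>) -` S \<inter> space M" by blast
    \<comment> \<open>All jumps together are a measurable function of all paths, so an event
      described by the jumps is also one described by the paths, and the assumed independence
      applies to it.\<close>
    have "(\<lambda>p i. real_of_ereal (drift_sup lam (p i))) -` S \<in> sets ?PW"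
      using measurable_sets[OF Hm S] by (simp add: space_PiM)
    moreover have "b = (\<lambda>\<omega> i t. W i t \<omega>) -` ((\<lambda>p i. real_of_ereal (drift_sup lam (p i))) -` S) \<inter> space M"
      unfolding b YW by auto
    ultimately have "b \<in> {(\<lambda>\<omega> i t. W i t \<omega>) -` S \<inter> space M | S. S \<in> sets ?PW}" by blast
    with a show "prob (a \<inter> b) = prob a * prob b" by (rule indep_setD[OF indep_PPP_BM])
  qed (use measurable_sets[OF Xm] measurable_sets[OF Ym] in auto)
  have Yi: "indep_vars (\<lambda>_. borel) Y UNIV"
    using indep_vars_compose2[OF indep_BM hm] by (simp add: Y_def[abs_def])
  have gmono: "mono g"
    using f_nonneg mono_onD[OF f_mono] by (intro monoI) (auto simp: g_def)
  interpret marked_frogs M g X Y "2 * lam"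
  proof
    show "\<exists>x\<ge>0. g x > 0"
      using f_nonzero f_nonneg by (auto simp: g_def less_le)
    show "distr M borel (Y i) = density lborel (exponential_density (2 * lam))" for i
      using brownian_drift_sup(2)[OF bm lam_pos] by (simp add: Y_def[abs_def])
  qed (use lam_pos gmono f_nonneg pp XY Yi in \<open>auto simp: g_def\<close>)
  have int_eq: "(\<integral>\<^sup>+ t\<in>{0..}. ennreal (exp (- f t / (2 * lam)) * f t) \<partial>lborel)
      = (\<integral>\<^sup>+ t\<in>{0..}. ennreal (exp (- g t / (2 * lam)) * g t) \<partial>lborel)"
    by (intro nn_integral_cong) (auto simp: g_def indicator_def)
  \<comment> \<open>The uncountable quantifier over \<open>a\<close> stays inside the null set of
    each frog; only the countable union over frogs has to be taken.\<close>
  have "AE \<omega> in M. \<forall>a. Y i \<omega> > a \<longleftrightarrow> (\<exists>t\<ge>0. W i t \<omega> - lam * t > a)" for i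
    using brownian_drift_sup(1)[OF bm lam_pos] unfolding Y_def .
  then have Y_sup: "AE \<omega> in M. \<forall>i a. Y i \<omega> > a \<longleftrightarrow> (\<exists>t\<ge>0. W i t \<omega> - lam * t > a)"
    by (simp add: AE_all_countable)
  show ?thesis
  proof
    assume "(\<integral>\<^sup>+ t\<in>{0..}. ennreal (exp (- f t / (2 * lam)) * f t) \<partial>lborel) = \<infinity>"
    then have "AE \<omega> in M. \<exists>r. Y 0 \<omega> \<le> r \<and> 0 \<le> r \<and> (\<forall>n. X n \<omega> \<le> r \<longrightarrow> X n \<omega> + Y (Suc n) \<omega> \<le> r)"
      unfolding int_eq by (rule dies_out)
    with Y_sup AE_space show "frog_transient M lam X W"
      unfolding frog_transient_def
    proof eventually_elim
      fix \<omega> assume Ys: "\<forall>i a. Y i \<omega> > a \<longleftrightarrow> (\<exists>t\<ge>0. W i t \<omega> - lam * t > a)" and w: "\<omega> \<in> space M"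
        and "\<exists>r. Y 0 \<omega> \<le> r \<and> 0 \<le> r \<and> (\<forall>n. X n \<omega> \<le> r \<longrightarrow> X n \<omega> + Y (Suc n) \<omega> \<le> r)"
      then obtain r where "Y 0 \<omega> \<le> r" "0 \<le> r" "\<forall>n. X n \<omega> \<le> r \<longrightarrow> X n \<omega> + Y (Suc n) \<omega> \<le> r" by blast
      moreover have "W i t \<omega> - lam * t \<le> Y i \<omega>" if "t \<ge> 0" for i t
        using spec[OF spec[OF Ys, of i], of "Y i \<omega>"] that by (auto simp: not_less)
      ultimately have "finite (activated (frog_pos X \<omega>) (frog_path lam X W \<omega>))"
        by (intro finite_activated[of "\<lambda>i. Y i \<omega>" r] pp_at_top[OF pp w]) auto
      then show "finite (frogs_hitting_origin lam X W \<omega>)"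
        by (rule finite_subset[rotated]) (auto simp: frogs_hitting_origin_def)
    qed
  next
    assume transient: "frog_transient M lam X W"
    show "(\<integral>\<^sup>+ t\<in>{0..}. ennreal (exp (- f t / (2 * lam)) * f t) \<partial>lborel) = \<infinity>"
    proof (rule ccontr)
      assume "(\<integral>\<^sup>+ t\<in>{0..}. ennreal (exp (- f t / (2 * lam)) * f t) \<partial>lborel) \<noteq> \<infinity>"
      then have "(\<integral>\<^sup>+ t\<in>{0..}. ennreal (exp (- g t / (2 * lam)) * g t) \<partial>lborel) < \<infinity>"
        unfolding int_eq by (simp add: less_top)
      from survives[OF this] obtain K E where K: "K \<ge> 0" and E: "E \<in> events" "prob E > 0"
        and cover: "\<And>\<omega>. \<omega> \<in> E \<Longrightarrow> Y 0 \<omega> > K \<and> (\<forall>n. X n \<omega> > K \<longrightarrow> (\<exists>j<n. X j \<omega> + Y (Suc j) \<omega> > X n \<omega>))"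
        by blast
      have down: "AE \<omega> in M. \<forall>i a. \<exists>t\<ge>0. W i t \<omega> - lam * t \<le> a"
        using brownian_drift_to_minus_infinity[OF bm lam_pos] by (simp add: AE_all_countable)
      \<comment> \<open>Almost surely on \<open>E\<close> all frogs would hit the origin, while
        transience allows only finitely many; so \<open>E\<close> must be null although its
        probability is positive.\<close>
      from Y_sup AE_space down X_positive transient[unfolded frog_transient_def]
      have "AE \<omega> in M. \<omega> \<notin> E"
      proof eventually_elim
        fix \<omega> assume Ys: "\<forall>i a. Y i \<omega> > a \<longleftrightarrow> (\<exists>t\<ge>0. W i t \<omega> - lam * t > a)" and w: "\<omega> \<in> space M"
          and down: "\<forall>i a. \<exists>t\<ge>0. W i t \<omega> - lam * t \<le> a" and pos: "\<forall>n. X n \<omega> > 0"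
          and fin: "finite (frogs_hitting_origin lam X W \<omega>)"
        show "\<omega> \<notin> E"
        proof
          assume "\<omega> \<in> E"
          note c = cover[OF this]
          have "frogs_hitting_origin lam X W \<omega> = UNIV"
            by (rule all_frogs_hit[of K "\<lambda>i. Y i \<omega>"])
              (use K c Ys down pos bm_continuous[OF bm w] bm_zero[OF bm w] pp_strict_mono[OF pp w] in auto)
          with fin show False by simp
        qed
      qed
      then have "prob E = 0" using E(1) by (simp add: prob_eq_0)
      with E(2) show False by simp
    qed
  qed
qed

end
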